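(* Let $p$ be a prime, let $K$ be a finite field extension of $\mathbb{Q}_p$ of degree $d$, ramification index $e$ and inertia degree $f$, let $R$ be the ring of integers of $K$, let $\pi\in R$ be a uniformizing parameter, and let $q=p^f$ be the cardinality of the residue field of $R$. Let $n\geq 2$ be an integer. For $\Sigma\in\{\mathrm{SL},\mathrm{Sp},\mathrm{SO}\}$ consider the following condition on $n$: - if $\Sigma=\mathrm{SL}$: $(n^2-1)d\leq p$; - if $\Sigma=\mathrm{Sp}$: $n$ is even and $(n^2+n)d\leq 2p$; - if $\Sigma=\mathrm{SO}$: $n\geq 3$ and $(n^2-n)d\leq 2p$. Let $\Sigma$ be any of the symbols $\mathrm{SL}$, $\mathrm{Sp}$, $\mathrm{SO}$ and assume that $n$ satisfies the condition corresponding to $\Sigma$. Then the following holds. (1) Every open subgroup of $\Sigma_n(R)$ is self-similar. (2) Let $k\geq 1$ and $m\geq e$ be integers, and let $G$ be a group with $\Sigma_n^m(R)\leq G\leq \Sigma_n(R)$. Then $G$ is self-similar of index $[G:\Sigma_n^m(R)]\,q^{F(n)k}$, where $$F(n)=\begin{cases} n-1 &\text{if }\Sigma=\mathrm{SL},\\ n&\text{if }\Sigma=\mathrm{Sp},\\ n-2&\text{if }\Sigma=\mathrm{SO}.\end{cases}$$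
   Context: Self-similarity of groups: for an integer $\delta\geq 1$, a group $G$ is self-similar of index $\delta$ if it admits a faithful self-similar action on a regular rooted $\delta$-ary tree that is transitive on the first level. Equivalently (known fact), $G$ admits a simple virtual endomorphism of index $\delta$: a group homomorphism $\varphi:D\to G$, where $D\leq G$ is a subgroup of index $\delta$, such that there is no nontrivial normal subgroup $N$ of $G$ with $N\subseteq D$ and $\varphi(N)\subseteq N$. A group is self-similar if it is self-similar of some index $\delta$. Classical groups: $\mathrm{SL}_n(R)=\{x\in \mathrm{M}_n(R): \det x=1\}$. For $n=2l$, $\mathrm{Sp}_{n}(R)=\{x\in \mathrm{M}_{n}(R): x^{\mathrm t}sx=s\}$ with $s=\begin{bmatrix}0&\mathrm{Id}_l\\-\mathrm{Id}_l&0\end{bmatrix}$. $\mathrm{SO}_n(R)=\{x\in \mathrm{SL}_n(R): x^{\mathrm t}sx=s\}$ with $s=\begin{bmatrix}0&\mathrm{Id}_l\\ \mathrm{Id}_l&0\end{bmatrix}$ if $n=2l$, and $s=\begin{bmatrix}1&0&0\\0&0&\mathrm{Id}_l\\0&\mathrm{Id}_l&0\end{bmatrix}$ if $n=2l+1$. These groups carry the $\pi$-adic topology. For $m\geq 1$, the $m$-th principal congruence subgroup $\Sigma_n^m(R)$ is the kernel of the map $\Sigma_n(R)\to\Sigma_n(R/\pi^mR)$ of reduction modulo $\pi^m$. *)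

theory Defs
  imports
    "HOL-Computational_Algebra.Computational_Algebra"
    "HOL-Algebra.Embedded_Algebras"
    "HOL-Algebra.Group_Action"
    "HOL-Algebra.QuotRing"
    "HOL-Decision_Procs.Algebra_Aux"
    "HOL-Analysis.Abstract_Topology"
    "Jordan_Normal_Form.Determinant"
begin

section \<open>The field of p-adic numbers\<close>

definition padic_abs :: "nat \<Rightarrow> rat \<Rightarrow> real" where
  "padic_abs p x =
    (if x = 0 then 0
     else real p powi
       (int (multiplicity (int p) (snd (quotient_of x)))
        - int (multiplicity (int p) (fst (quotient_of x)))))"

definition padic_Cauchy :: "nat \<Rightarrow> (nat \<Rightarrow> rat) \<Rightarrow> bool" where
  "padic_Cauchy p s \<longleftrightarrow>
    (\<forall>\<epsilon>>0. \<exists>N. \<forall>i\<ge>N. \<forall>j\<ge>N. padic_abs p (s i - s j) < \<epsilon>)"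

definition padic_Cauchy_ring :: "nat \<Rightarrow> (nat \<Rightarrow> rat) ring" where
  "padic_Cauchy_ring p =
    \<lparr>carrier = {s. padic_Cauchy p s},
     mult = (\<lambda>s t i. s i * t i), one = (\<lambda>i. 1),
     ring.zero = (\<lambda>i. 0), add = (\<lambda>s t i. s i + t i)\<rparr>"

definition padic_null_sequences :: "nat \<Rightarrow> (nat \<Rightarrow> rat) set" where
  "padic_null_sequences p = {s. (\<lambda>i. padic_abs p (s i)) \<longlonglongrightarrow> 0}"

definition padic_field :: "nat \<Rightarrow> (nat \<Rightarrow> rat) set ring" where
  "padic_field p = padic_Cauchy_ring p Quot padic_null_sequences p"

text \<open>
  The closed unit ball of the field of p-adic numbers. The p-adic absolute value of a convergent
  sequence with nonzero limit is eventually constant, so an element of absolute value at most 1 has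
  a representative all of whose terms have absolute value at most 1.
\<close>
definition padic_integers :: "nat \<Rightarrow> (nat \<Rightarrow> rat) set set" where
  "padic_integers p =
    {z \<in> carrier (padic_field p). \<exists>s\<in>z. \<forall>i. padic_abs p (s i) \<le> 1}"


section \<open>Finite extensions and their rings of integers\<close>

text \<open>
  The extension field is the whole type \<open>'k\<close> and \<open>\<iota>\<close> is the embedding of the p-adic numbers.
  The ring \<^const>\<open>cring_class_ops\<close> is \<open>'k\<close> as a ring with carrier \<^const>\<open>UNIV\<close>.
\<close>
definition padic_extension ::
  "nat \<Rightarrow> nat \<Rightarrow> ((nat \<Rightarrow> rat) set \<Rightarrow> 'k::field) \<Rightarrow> bool" where
  "padic_extension p d \<iota> \<longleftrightarrow>
    \<iota> \<in> Ring.ring_hom (padic_field p) cring_class_ops \<and>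
    ring.dimension cring_class_ops d (\<iota> ` carrier (padic_field p)) (UNIV :: 'k set)"

text \<open>The integral closure of the p-adic integers in \<open>'k\<close>.\<close>
definition ring_of_integers ::
  "nat \<Rightarrow> ((nat \<Rightarrow> rat) set \<Rightarrow> 'k::field) \<Rightarrow> 'k ring" where
  "ring_of_integers p \<iota> =
    cring_class_ops\<lparr>carrier :=
      {x. \<exists>P :: 'k poly. lead_coeff P = 1 \<and>
            (\<forall>i. Polynomial.coeff P i \<in> \<iota> ` padic_integers p) \<and> poly P x = 0}\<rparr>"

text \<open>A uniformizing parameter generates the unique maximal ideal.\<close>
definition uniformizer :: "'k ring \<Rightarrow> 'k \<Rightarrow> bool" where
  "uniformizer R \<pi> \<longleftrightarrow>
    \<pi> \<in> carrier R \<and> (\<forall>M. maximalideal M R \<longleftrightarrow> M = PIdl\<^bsub>R\<^esub> \<pi>)"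

definition reduction :: "'k ring \<Rightarrow> 'k \<Rightarrow> 'k \<Rightarrow> 'k set" where
  "reduction R a x = (PIdl\<^bsub>R\<^esub> a) +>\<^bsub>R\<^esub> x"

definition residue_field :: "'k ring \<Rightarrow> 'k \<Rightarrow> 'k set ring" where
  "residue_field R \<pi> = R Quot (PIdl\<^bsub>R\<^esub> \<pi>)"

definition ramification_index :: "nat \<Rightarrow> 'k::field ring \<Rightarrow> 'k \<Rightarrow> nat \<Rightarrow> bool" where
  "ramification_index p R \<pi> e \<longleftrightarrow> PIdl\<^bsub>R\<^esub> (of_nat p) = PIdl\<^bsub>R\<^esub> (\<pi> ^ e)"

text \<open>
  The degree of the residue field over the residue field of the p-adic numbers, the latter being
  embedded as the image of the p-adic integers.
\<close>
definition inertia_degree ::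
  "nat \<Rightarrow> ((nat \<Rightarrow> rat) set \<Rightarrow> 'k::field) \<Rightarrow> 'k \<Rightarrow> nat \<Rightarrow> bool" where
  "inertia_degree p \<iota> \<pi> f \<longleftrightarrow>
    (let R = ring_of_integers p \<iota>; k = residue_field R \<pi>
     in ring.dimension k f (reduction R \<pi> ` \<iota> ` padic_integers p) (carrier k))"


section \<open>Classical groups\<close>

datatype classical_type = SL | Sp | SO

definition symplectic_form :: "nat \<Rightarrow> 'k::field mat" where
  "symplectic_form l = four_block_mat (0\<^sub>m l l) (1\<^sub>m l) (- 1\<^sub>m l) (0\<^sub>m l l)"

definition split_form :: "nat \<Rightarrow> 'k::field mat" where
  "split_form l = four_block_mat (0\<^sub>m l l) (1\<^sub>m l) (1\<^sub>m l) (0\<^sub>m l l)"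

definition orthogonal_form :: "nat \<Rightarrow> 'k::field mat" where
  "orthogonal_form n =
    (let l = n div 2 in
     if even n then split_form l
     else four_block_mat (1\<^sub>m 1) (0\<^sub>m 1 (2 * l)) (0\<^sub>m (2 * l) 1) (split_form l))"

text \<open>For \<^const>\<open>Sp\<close> the definition is meaningful for even \<open>n\<close> only.\<close>
definition classical_matrices :: "classical_type \<Rightarrow> nat \<Rightarrow> 'k::field ring \<Rightarrow> 'k mat set" where
  "classical_matrices \<Sigma> n R =
    {x \<in> carrier_mat n n. elements_mat x \<subseteq> carrier R \<and>
      (case \<Sigma> of
         SL \<Rightarrow> det x = 1
       | Sp \<Rightarrow> transpose_mat x * symplectic_form (n div 2) * x = symplectic_form (n div 2)
       | SO \<Rightarrow> det x = 1 \<and> transpose_mat x * orthogonal_form n * x = orthogonal_form n)}"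

definition classical_group :: "classical_type \<Rightarrow> nat \<Rightarrow> 'k::field ring \<Rightarrow> 'k mat monoid" where
  "classical_group \<Sigma> n R =
    \<lparr>carrier = classical_matrices \<Sigma> n R, mult = (*), one = 1\<^sub>m n\<rparr>"

text \<open>
  The kernel of entrywise reduction modulo the ideal generated by \<open>\<pi> ^ m\<close>.
\<close>
definition congruence_subgroup ::
  "classical_type \<Rightarrow> nat \<Rightarrow> 'k::field ring \<Rightarrow> 'k \<Rightarrow> nat \<Rightarrow> 'k mat set" where
  "congruence_subgroup \<Sigma> n R \<pi> m =
    {x \<in> carrier (classical_group \<Sigma> n R).
       map_mat (reduction R (\<pi> ^ m)) x = map_mat (reduction R (\<pi> ^ m)) (1\<^sub>m n)}"

text \<open>
  The topology induced by the product topology on matrices: the elements congruent to \<open>x\<close>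
  modulo \<open>\<pi> ^ m\<close>, for varying \<open>m\<close>, form a neighbourhood base of \<open>x\<close>.
\<close>
definition adic_topology ::
  "classical_type \<Rightarrow> nat \<Rightarrow> 'k::field ring \<Rightarrow> 'k \<Rightarrow> 'k mat topology" where
  "adic_topology \<Sigma> n R \<pi> =
    topology_generated_by
      {{y \<in> carrier (classical_group \<Sigma> n R).
          map_mat (reduction R (\<pi> ^ m)) y = map_mat (reduction R (\<pi> ^ m)) x}
       | x m. x \<in> carrier (classical_group \<Sigma> n R)}"


section \<open>Self-similar groups\<close>

text \<open>
  The vertices of the regular rooted \<open>\<delta>\<close>-ary tree are the words over \<open>{..<\<delta>}\<close>; the root is
  the empty word and the children of \<open>w\<close> are the words \<open>w @ [x]\<close>.
\<close>
definition regular_tree :: "nat \<Rightarrow> nat list set" where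
  "regular_tree \<delta> = lists {..<\<delta>}"

definition tree_automorphism :: "nat \<Rightarrow> (nat list \<Rightarrow> nat list) \<Rightarrow> bool" where
  "tree_automorphism \<delta> a \<longleftrightarrow>
    a \<in> Bij (regular_tree \<delta>) \<and> a [] = [] \<and>
    (\<forall>w \<in> regular_tree \<delta>. \<forall>x<\<delta>. \<exists>y<\<delta>. a (w @ [x]) = a w @ [y])"

definition self_similar_action ::
  "('g, 'm) monoid_scheme \<Rightarrow> nat \<Rightarrow> ('g \<Rightarrow> nat list \<Rightarrow> nat list) \<Rightarrow> bool" where
  "self_similar_action G \<delta> act \<longleftrightarrow>
    group_action G (regular_tree \<delta>) act \<and>
    (\<forall>g \<in> carrier G. tree_automorphism \<delta> (act g)) \<and>
    (\<forall>g \<in> carrier G. \<forall>x<\<delta>. \<exists>h \<in> carrier G. \<exists>y<\<delta>.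
       \<forall>w \<in> regular_tree \<delta>. act g (x # w) = y # act h w)"

definition self_similar_of_index :: "('g, 'm) monoid_scheme \<Rightarrow> nat \<Rightarrow> bool" where
  "self_similar_of_index G \<delta> \<longleftrightarrow>
    \<delta> \<ge> 1 \<and>
    (\<exists>act. self_similar_action G \<delta> act \<and>
       faithful_action G (regular_tree \<delta>) act \<and>
       (\<forall>x<\<delta>. \<forall>y<\<delta>. \<exists>g \<in> carrier G. act g [x] = [y]))"

definition self_similar :: "('g, 'm) monoid_scheme \<Rightarrow> bool" where
  "self_similar G \<longleftrightarrow> (\<exists>\<delta>. self_similar_of_index G \<delta>)"

definition subgroup_index :: "('g, 'm) monoid_scheme \<Rightarrow> 'g set \<Rightarrow> nat" where
  "subgroup_index G H = card (rcosets\<^bsub>G\<^esub> H)"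


section \<open>The numerical data of the classical groups\<close>

definition admissible :: "classical_type \<Rightarrow> nat \<Rightarrow> nat \<Rightarrow> nat \<Rightarrow> bool" where
  "admissible \<Sigma> n d p \<longleftrightarrow>
    (case \<Sigma> of
       SL \<Rightarrow> (n\<^sup>2 - 1) * d \<le> p
     | Sp \<Rightarrow> even n \<and> (n\<^sup>2 + n) * d \<le> 2 * p
     | SO \<Rightarrow> n \<ge> 3 \<and> (n\<^sup>2 - n) * d \<le> 2 * p)"

fun index_exponent :: "classical_type \<Rightarrow> nat \<Rightarrow> nat" where
  "index_exponent SL n = n - 1"
| "index_exponent Sp n = n"
| "index_exponent SO n = n - 2"

end

theory Submission
  imports Defs
begin

text \<open>
  Let \<open>a = diag(\<pi>\<^sup>k, 1, \<dots>)\<close>, with an additional entry \<open>\<pi>\<^sup>-\<^sup>k\<close> dual to the first one for \<open>Sp\<close> and \<open>SO\<close>.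
  Conjugation by \<open>a\<close> maps the subgroup \<open>D\<close> of those \<open>x \<in> \<Sigma>\<^sup>m\<close> with \<open>a x a\<^sup>-\<^sup>1 \<in> \<Sigma>\<^sup>m\<close> back into the group, so it is
  a virtual endomorphism. Every \<open>x \<in> \<Sigma>\<^sup>m\<close> is \<open>u y\<close> with \<open>u\<close> in the opposite unipotent radical and
  \<open>y \<in> D\<close> stabilising the first coordinate line; counting \<open>u\<close> modulo \<open>D\<close> gives the index \<open>q\<^sup>F\<^sup>k\<close>.
  An element of a normal subgroup \<open>N \<subseteq> D\<close> stable under the endomorphism fixes the first coordinate line,
  as the other entries of its first column are divisible by every power of \<open>\<pi>\<close>. By normality it fixes the
  whole \<open>\<Sigma>\<^sup>m\<close>-orbit of this line, and as its eigenvalues are \<open>1\<close> modulo \<open>\<pi>\<close> it is the identity.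
  The bound on \<open>p\<close> enters only by making \<open>2\<close> or \<open>n\<close> a unit.
\<close>

text \<open>The exponent \<open>F\<close> adds up, over the free parameters of the opposite
  unipotent radical, the powers of \<open>\<pi>^k\<close> by which conjugation divides them. For
  \<open>SL\<close> these are the \<open>n - 1\<close> lower entries of the first column. For a
  bilinear form there are \<open>n - 2\<close> entries off the hyperbolic pair, each divided by
  \<open>\<pi>^k\<close>, and a corner entry divided by \<open>\<pi>^(2k)\<close>. The corner is
  free for \<open>Sp\<close>, which gives \<open>n - 2 + 2\<close>; for \<open>SO\<close> isotropy
  of the column makes it a quadratic function of the other entries, which leaves
  \<open>n - 2\<close>. The obstacle at the end is that all lines known to be fixed are congruent to
  the first one, each with an eigenvalue of its own. For \<open>SL\<close> a comparison of
  neighbouring lines makes the element a scalar \<open>r\<close> with \<open>r^n = 1\<close>, and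
  \<open>r = 1\<close> since \<open>n\<close> is a unit. For a form, eigenvalues along
  non-orthogonal lines are inverse to each other, so three pairwise non-orthogonal isotropic lines
  have to be found inside this small orbit; \<open>2\<close> being a unit then excludes the
  eigenvalue \<open>-1\<close>.\<close>

lemma ex1_iff_cong: "(\<And>x. P x \<longleftrightarrow> Q x) \<Longrightarrow> \<exists>!x. Q x \<Longrightarrow> \<exists>!x. P x"
  by simp

lemma ex1_unique: "\<exists>!x. P x \<Longrightarrow> P x \<Longrightarrow> P y \<Longrightarrow> x = y"
  by blast

section \<open>Virtual endomorphisms and self-similar actions\<close>

text \<open>This is the wreath recursion: \<open>i g x\<close> is the image of the first letter, and
  \<open>c g x\<close> is the state of \<open>g\<close> at \<open>x\<close>, which acts on the rest
  of the word.\<close>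

primrec tree_act :: "('g \<Rightarrow> nat \<Rightarrow> nat) \<Rightarrow> ('g \<Rightarrow> nat \<Rightarrow> 'g) \<Rightarrow> 'g \<Rightarrow> nat list \<Rightarrow> nat list" where
  "tree_act i c g [] = []"
| "tree_act i c g (x # w) = i g x # tree_act i c (c g x) w"

text \<open>The letters label the left cosets \<open>t x D\<close>, so
  \<open>inv (t x) \<otimes> g \<in> D\<close> says that \<open>g\<close> lies in the coset of
  \<open>x\<close>. No letter is required to have representative \<open>\<one>\<close>; the coset
  \<open>D\<close> itself is merely represented by some element of \<open>D\<close>.\<close>

locale virtual_endomorphism = group G for G (structure) +
  fixes D :: "'a set" and \<phi> :: "'a \<Rightarrow> 'a" and t :: "nat \<Rightarrow> 'a" and \<delta> :: nat
  assumes D: "subgroup D G"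
    and \<phi>_closed: "\<And>x. x \<in> D \<Longrightarrow> \<phi> x \<in> carrier G"
    and \<phi>_mult: "\<And>x y. x \<in> D \<Longrightarrow> y \<in> D \<Longrightarrow> \<phi> (x \<otimes> y) = \<phi> x \<otimes> \<phi> y"
    and t_closed: "\<And>x. x < \<delta> \<Longrightarrow> t x \<in> carrier G"
    and transversal: "\<And>g. g \<in> carrier G \<Longrightarrow> \<exists>!x. x < \<delta> \<and> inv (t x) \<otimes> g \<in> D"
begin

definition coset_index :: "'a \<Rightarrow> nat \<Rightarrow> nat" where
  "coset_index g x = (THE y. y < \<delta> \<and> inv (t y) \<otimes> (g \<otimes> t x) \<in> D)"

definition cofactor_elt :: "'a \<Rightarrow> nat \<Rightarrow> 'a" where
  "cofactor_elt g x = inv (t (coset_index g x)) \<otimes> (g \<otimes> t x)"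

text \<open>Elements of \<open>Bij\<close> are extensional, hence the \<open>restrict\<close>;
  inductions run on the unrestricted recursion \<open>word_action\<close>.\<close>

definition action :: "'a \<Rightarrow> nat list \<Rightarrow> nat list" where
  "action g = restrict (tree_act coset_index (\<lambda>g x. \<phi> (cofactor_elt g x)) g) (regular_tree \<delta>)"

lemma D_closed: "x \<in> D \<Longrightarrow> x \<in> carrier G"
  using D subgroup.subset by blast

lemma coset_index_props:
  assumes "g \<in> carrier G" "x < \<delta>"
  shows "coset_index g x < \<delta>" and "cofactor_elt g x \<in> D"
    and "t (coset_index g x) \<otimes> cofactor_elt g x = g \<otimes> t x"
proof -
  have "g \<otimes> t x \<in> carrier G" using assms t_closed by auto
  from theI'[OF transversal[OF this]]
  have *: "coset_index g x < \<delta> \<and> cofactor_elt g x \<in> D"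
    unfolding coset_index_def cofactor_elt_def .
  then show "coset_index g x < \<delta>" and "cofactor_elt g x \<in> D" by auto
  show "t (coset_index g x) \<otimes> cofactor_elt g x = g \<otimes> t x"
    unfolding cofactor_elt_def using * assms t_closed
    by (simp add: m_assoc[symmetric])
qed

lemma coset_index_eqI:
  assumes "g \<in> carrier G" "x < \<delta>" "y < \<delta>" "d \<in> D" "g \<otimes> t x = t y \<otimes> d"
  shows "coset_index g x = y" and "cofactor_elt g x = d"
proof -
  have gx: "g \<otimes> t x \<in> carrier G" using assms(1,2) t_closed by auto
  have eq: "inv (t y) \<otimes> (g \<otimes> t x) = d"
    unfolding assms(5) using D_closed[OF assms(4)] t_closed[OF assms(3)]
    by (simp add: m_assoc[symmetric])
  then show i: "coset_index g x = y"
    unfolding coset_index_def using transversal[OF gx] assms by (intro the1_equality) auto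
  show "cofactor_elt g x = d" unfolding cofactor_elt_def i by (rule eq)
qed

lemma coset_index_one:
  assumes "x < \<delta>"
  shows "coset_index \<one> x = x" and "cofactor_elt \<one> x = \<one>"
proof -
  have "\<one> \<otimes> t x = t x \<otimes> \<one>" "\<one> \<in> D"
    using assms t_closed D subgroup.one_closed by auto
  then show "coset_index \<one> x = x" "cofactor_elt \<one> x = \<one>"
    using coset_index_eqI[of \<one> x x \<one>] assms by auto
qed

lemma coset_index_mult:
  assumes "g \<in> carrier G" "h \<in> carrier G" "x < \<delta>"
  shows "coset_index (g \<otimes> h) x = coset_index g (coset_index h x)"
    and "cofactor_elt (g \<otimes> h) x = cofactor_elt g (coset_index h x) \<otimes> cofactor_elt h x"
proof -
  define y where "y = coset_index h x"
  note h = coset_index_props[OF assms(2,3), folded y_def]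
  note g = coset_index_props[OF assms(1) h(1)]
  have c: "cofactor_elt h x \<in> carrier G" "cofactor_elt g y \<in> carrier G"
    using D_closed[OF h(2)] D_closed[OF g(2)] .
  have tc: "t x \<in> carrier G" "t y \<in> carrier G" "t (coset_index g y) \<in> carrier G"
    using t_closed[OF assms(3)] t_closed[OF h(1)] t_closed[OF g(1)] .
  have "g \<otimes> h \<otimes> t x = g \<otimes> (t y \<otimes> cofactor_elt h x)"
    unfolding h(3) by (rule m_assoc[OF assms(1,2) tc(1)])
  also have "\<dots> = t (coset_index g y) \<otimes> cofactor_elt g y \<otimes> cofactor_elt h x"
    unfolding g(3) by (rule m_assoc[OF assms(1) tc(2) c(1), symmetric])
  also have "\<dots> = t (coset_index g y) \<otimes> (cofactor_elt g y \<otimes> cofactor_elt h x)"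
    by (rule m_assoc[OF tc(3) c(2,1)])
  finally have eq: "g \<otimes> h \<otimes> t x
      = t (coset_index g y) \<otimes> (cofactor_elt g y \<otimes> cofactor_elt h x)" .
  have d: "cofactor_elt g y \<otimes> cofactor_elt h x \<in> D"
    by (rule subgroup.m_closed[OF D g(2) h(2)])
  show "coset_index (g \<otimes> h) x = coset_index g (coset_index h x)"
    and "cofactor_elt (g \<otimes> h) x = cofactor_elt g (coset_index h x) \<otimes> cofactor_elt h x"
    using coset_index_eqI[OF m_closed[OF assms(1,2)] assms(3) g(1) d eq] unfolding y_def .
qed

lemma \<phi>_one: "\<phi> \<one> = \<one>"
proof -
  have 1: "\<one> \<in> D" using D subgroup.one_closed by auto
  have "\<phi> \<one> \<otimes> \<phi> \<one> = \<phi> \<one>" using \<phi>_mult[OF 1 1] by simp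
  then show ?thesis using \<phi>_closed[OF 1] by (metis l_cancel_one')
qed

abbreviation "word_action \<equiv> tree_act coset_index (\<lambda>g x. \<phi> (cofactor_elt g x))"

lemma regular_tree_Cons: "x # w \<in> regular_tree \<delta> \<longleftrightarrow> x < \<delta> \<and> w \<in> regular_tree \<delta>"
  by (auto simp: regular_tree_def)

lemma regular_tree_Nil: "[] \<in> regular_tree \<delta>"
  by (auto simp: regular_tree_def)

lemma word_action_closed:
  "g \<in> carrier G \<Longrightarrow> w \<in> regular_tree \<delta> \<Longrightarrow> word_action g w \<in> regular_tree \<delta>"
  by (induction w arbitrary: g)
    (auto simp: regular_tree_Cons regular_tree_Nil coset_index_props \<phi>_closed)

lemma word_action_one: "w \<in> regular_tree \<delta> \<Longrightarrow> word_action \<one> w = w"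
  by (induction w) (auto simp: regular_tree_Cons coset_index_one \<phi>_one)

lemma word_action_mult:
  "g \<in> carrier G \<Longrightarrow> h \<in> carrier G \<Longrightarrow> w \<in> regular_tree \<delta> \<Longrightarrow>
    word_action (g \<otimes> h) w = word_action g (word_action h w)"
  by (induction w arbitrary: g h)
    (auto simp: regular_tree_Cons coset_index_mult coset_index_props \<phi>_closed \<phi>_mult)

lemma word_action_snoc:
  "g \<in> carrier G \<Longrightarrow> w \<in> regular_tree \<delta> \<Longrightarrow> x < \<delta> \<Longrightarrow>
    \<exists>y<\<delta>. word_action g (w @ [x]) = word_action g w @ [y]"
  by (induction w arbitrary: g)
    (auto simp: regular_tree_Cons coset_index_props \<phi>_closed)

lemma action_Bij:
  assumes "g \<in> carrier G"
  shows "action g \<in> Bij (regular_tree \<delta>)"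
proof -
  have "word_action (inv g) (word_action g w) = w" "word_action g (word_action (inv g) w) = w"
    if "w \<in> regular_tree \<delta>" for w
    using word_action_mult[of g "inv g" w] word_action_mult[of "inv g" g w] assms that
    by (auto simp: word_action_one)
  then have "bij_betw (word_action g) (regular_tree \<delta>) (regular_tree \<delta>)"
    using assms word_action_closed[of g] word_action_closed[of "inv g"]
    by (intro bij_betw_byWitness[where f' = "word_action (inv g)"]) auto
  then show ?thesis
    by (auto simp: Bij_def action_def)
qed

lemma action_group_action: "group_action G (regular_tree \<delta>) action"
proof -
  have "action \<in> hom G (BijGroup (regular_tree \<delta>))"
  proof (rule homI)
    show "action g \<in> carrier (BijGroup (regular_tree \<delta>))" if "g \<in> carrier G" for g
      using action_Bij[OF that] by (simp add: BijGroup_def)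
    show "action (g \<otimes> h) = action g \<otimes>\<^bsub>BijGroup (regular_tree \<delta>)\<^esub> action h"
      if "g \<in> carrier G" "h \<in> carrier G" for g h
    proof -
      have "action (g \<otimes> h) = compose (regular_tree \<delta>) (action g) (action h)"
        using that word_action_mult word_action_closed
        unfolding compose_def action_def by (intro ext) simp
      then show ?thesis using action_Bij that by (simp add: BijGroup_def)
    qed
  qed
  then show ?thesis
    by (intro group_action.intro group_hom.intro group_hom_axioms.intro group_BijGroup is_group)
qed

lemma \<delta>_pos: "\<delta> \<ge> 1"
  using transversal[OF one_closed] by auto

text \<open>The kernel \<open>N\<close> of the action is itself a normal subgroup of the forbidden
  kind. If \<open>g\<close> acts trivially, it fixes the letter \<open>b\<close> of the coset
  \<open>D\<close>, so \<open>g\<close> is the conjugate by \<open>t b\<close> of its cofactor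
  \<open>c \<in> D\<close>. The state \<open>\<phi> c\<close> acts trivially on the subtree at
  \<open>b\<close>, hence lies in \<open>N\<close>, and \<open>\<phi> g\<close> is its conjugate by
  \<open>\<phi> (t b)\<close>, hence lies in \<open>N\<close> by normality.\<close>

theorem self_similar_of_indexI:
  assumes simple: "\<And>N. N \<lhd> G \<Longrightarrow> N \<subseteq> D \<Longrightarrow> \<phi> ` N \<subseteq> N \<Longrightarrow> N \<subseteq> {\<one>}"
  shows "self_similar_of_index G \<delta>"
proof -
  interpret A: group_action G "regular_tree \<delta>" action by (rule action_group_action)
  interpret H: group_hom G "BijGroup (regular_tree \<delta>)" action by (rule A.group_hom)
  define N where "N = kernel G (BijGroup (regular_tree \<delta>)) action"
  have N: "N \<lhd> G" unfolding N_def by (rule H.normal_kernel)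
  have N_iff: "g \<in> N \<longleftrightarrow> g \<in> carrier G \<and> (\<forall>w \<in> regular_tree \<delta>. word_action g w = w)" for g
  proof -
    have "action g = (\<lambda>w\<in>regular_tree \<delta>. w) \<longleftrightarrow> (\<forall>w \<in> regular_tree \<delta>. word_action g w = w)"
      unfolding action_def fun_eq_iff restrict_def by metis
    then show ?thesis unfolding N_def kernel_def BijGroup_def by simp
  qed
  \<comment> \<open>\<open>b\<close> is the letter of the trivial coset: \<open>D\<close> contains
    \<open>inv (t b)\<close> and therefore \<open>t b\<close>.\<close>
  obtain b where b: "b < \<delta>" "inv (t b) \<in> D"
    using transversal[OF one_closed] t_closed by (metis inv_closed r_one)
  then have tb: "t b \<in> D" using D t_closed[OF b(1)] subgroup.m_inv_closed[OF D b(2)] by simp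
  have main: "g \<in> D \<and> \<phi> g \<in> N" if g: "g \<in> N" for g
  proof -
    have gc: "g \<in> carrier G" using g N_iff by auto
    define c where "c = cofactor_elt g b"
    note gp = coset_index_props[OF gc b(1), folded c_def]
    have wg: "word_action g w = w" if "w \<in> regular_tree \<delta>" for w
      using g that unfolding N_iff by blast
    have fx: "coset_index g b = b"
      using wg[of "[b]"] b(1) by (simp add: regular_tree_Cons regular_tree_Nil)
    have fx2: "word_action (\<phi> c) w = w" if "w \<in> regular_tree \<delta>" for w
      using wg[of "b # w"] b(1) that by (simp add: regular_tree_Cons c_def)
    have cN: "\<phi> c \<in> N" using fx2 gp(2) \<phi>_closed N_iff by auto
    have geq: "g = t b \<otimes> c \<otimes> inv (t b)"
      using gp(3)[unfolded fx] inv_solve_right[of g "t b \<otimes> c" "t b"] gc t_closed[OF b(1)]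
        D_closed[OF gp(2)] by simp
    have tc: "t b \<otimes> c \<in> D" using subgroup.m_closed[OF D tb gp(2)] .
    have gD: "g \<in> D" unfolding geq using subgroup.m_closed[OF D tc b(2)] .
    have "\<phi> g = \<phi> (t b) \<otimes> \<phi> c \<otimes> \<phi> (inv (t b))"
      unfolding geq \<phi>_mult[OF tc b(2)] \<phi>_mult[OF tb gp(2)] ..
    also have "\<phi> (inv (t b)) = inv (\<phi> (t b))"
    proof -
      have "\<phi> (t b) \<otimes> \<phi> (inv (t b)) = \<one>"
        using \<phi>_mult[OF tb b(2)] \<phi>_one D_closed[OF tb] by simp
      then show ?thesis using inv_unique'[OF \<phi>_closed[OF tb] \<phi>_closed[OF b(2)]]
          inv_comm[OF _ \<phi>_closed[OF tb] \<phi>_closed[OF b(2)]] by blast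
    qed
    finally have "\<phi> g \<in> N"
      using normal.inv_op_closed2[OF N \<phi>_closed[OF tb] cN] by simp
    with gD show ?thesis by blast
  qed
  then have "N \<subseteq> {\<one>}" using simple[OF N] by blast
  then have "N = {\<one>}"
    using subgroup.one_closed[OF normal_imp_subgroup[OF N]] by blast
  then have "inj_on action (carrier G)"
    unfolding N_def by (rule H.trivial_ker_imp_inj)
  then have "faithful_action G (regular_tree \<delta>) action"
    by unfold_locales
  moreover have "\<exists>g \<in> carrier G. action g [x] = [y]" if "x < \<delta>" "y < \<delta>" for x y
  proof
    show "t y \<otimes> inv (t x) \<in> carrier G" using that t_closed by auto
    have "t y \<otimes> inv (t x) \<otimes> t x = t y \<otimes> \<one>"
      using that t_closed by (simp add: m_assoc)
    then have "coset_index (t y \<otimes> inv (t x)) x = y"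
      using that t_closed D subgroup.one_closed by (intro coset_index_eqI[where d = \<one>]) auto
    then show "action (t y \<otimes> inv (t x)) [x] = [y]"
      using that by (simp add: action_def regular_tree_Cons regular_tree_Nil)
  qed
  moreover have "tree_automorphism \<delta> (action g)" if "g \<in> carrier G" for g
    unfolding tree_automorphism_def
  proof (intro conjI ballI allI impI)
    show "action g [] = []" by (simp add: action_def regular_tree_Nil)
    show "\<exists>y<\<delta>. action g (w @ [x]) = action g w @ [y]" if w: "w \<in> regular_tree \<delta>" "x < \<delta>" for w x
    proof -
      have "w @ [x] \<in> regular_tree \<delta>" using w by (auto simp: regular_tree_def)
      then show ?thesis using word_action_snoc[OF \<open>g \<in> carrier G\<close> w] w by (simp add: action_def)
    qed
  qed (rule action_Bij[OF that])
  moreover have "\<exists>h\<in>carrier G. \<exists>y<\<delta>. \<forall>w\<in>regular_tree \<delta>. action g (x # w) = y # action h w"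
    if "g \<in> carrier G" "x < \<delta>" for g x
  proof (intro bexI exI conjI ballI)
    note c = coset_index_props[OF that]
    show "\<phi> (cofactor_elt g x) \<in> carrier G" by (rule \<phi>_closed[OF c(2)])
    show "coset_index g x < \<delta>" by (rule c(1))
    show "action g (x # w) = coset_index g x # action (\<phi> (cofactor_elt g x)) w"
      if "w \<in> regular_tree \<delta>" for w
      using that \<open>x < \<delta>\<close> by (simp add: action_def regular_tree_Cons)
  qed
  ultimately have "self_similar_action G \<delta> action \<and> faithful_action G (regular_tree \<delta>) action \<and>
      (\<forall>x<\<delta>. \<forall>y<\<delta>. \<exists>g \<in> carrier G. action g [x] = [y])"
    unfolding self_similar_action_def
    by (intro conjI allI ballI impI action_group_action) assumption+
  with \<delta>_pos show ?thesis unfolding self_similar_of_index_def by (intro conjI exI[of _ action]) simp_all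
qed

end

text \<open>If the \<open>r i\<close> represent the right cosets of \<open>S\<close>, then
  \<open>r i \<otimes> g \<in> S\<close> holds exactly when \<open>S r_i\<close> is the coset of
  \<open>inv g\<close>. So their inverses represent the left cosets, without a choice of a second
  enumeration.\<close>

lemma (in group) finite_index_left_transversal:
  assumes S: "subgroup S G" and fin: "finite (rcosets S)"
  shows "\<exists>r. (\<forall>i < card (rcosets S). r i \<in> carrier G) \<and>
    (\<forall>g \<in> carrier G. \<exists>!i. i < card (rcosets S) \<and> r i \<otimes> g \<in> S)"
proof -
  let ?M = "card (rcosets S)"
  interpret S: subgroup S G by (rule S)
  obtain h where h: "bij_betw h {0..<?M} (rcosets S)"
    using ex_bij_betw_nat_finite[OF fin] by blast
  have "\<exists>x \<in> carrier G. h i = S #> x" if "i < ?M" for i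
    using bij_betwE[OF h] that unfolding RCOSETS_def by auto
  then obtain r where r: "\<And>i. i < ?M \<Longrightarrow> r i \<in> carrier G" "\<And>i. i < ?M \<Longrightarrow> h i = S #> r i"
    by metis
  have iff: "r i \<otimes> g \<in> S \<longleftrightarrow> h i = S #> inv g" if i: "i < ?M" and g: "g \<in> carrier G" for i g
  proof
    assume "r i \<otimes> g \<in> S"
    then have "r i \<otimes> g \<otimes> inv g \<in> S #> inv g" by (rule rcosI[OF _ S.subset]) (use g in simp)
    then have "r i \<in> S #> inv g" using r(1)[OF i] g by (simp add: m_assoc)
    then show "h i = S #> inv g"
      unfolding r(2)[OF i] by (rule repr_independence[OF _ inv_closed[OF g] S, symmetric])
  next
    assume "h i = S #> inv g"
    then have "r i \<in> S #> inv g"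
      using rcos_self[OF r(1)[OF i] S] r(2)[OF i] by simp
    then obtain s where s: "s \<in> S" "r i = s \<otimes> inv g" unfolding r_coset_def by auto
    have "s \<otimes> inv g \<otimes> g = s" using s(1) S.subset g by (simp add: m_assoc subset_iff)
    then show "r i \<otimes> g \<in> S" using s by simp
  qed
  have "\<exists>!i. i < ?M \<and> r i \<otimes> g \<in> S" if g: "g \<in> carrier G" for g
  proof -
    have "S #> inv g \<in> rcosets S" using S.subset g by (intro rcosetsI) auto
    then have "S #> inv g \<in> h ` {0..<?M}" unfolding bij_betw_imp_surj_on[OF h] .
    then obtain i where i: "i < ?M" "S #> inv g = h i" by (elim imageE) simp
    show ?thesis
    proof (rule ex1I[of _ i])
      show "i < ?M \<and> r i \<otimes> g \<in> S" using i(1) iffD2[OF iff[OF i(1) g] i(2)[symmetric]] by (rule conjI)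
      fix j assume j: "j < ?M \<and> r j \<otimes> g \<in> S"
      then have "h j = h i" unfolding i(2)[symmetric] using iffD1[OF iff[OF _ g]] by blast
      then show "j = i" by (rule inj_onD[OF bij_betw_imp_inj_on[OF h]]) (use j i(1) in simp_all)
    qed
  qed
  then show ?thesis using r(1) by (intro exI[of _ r] conjI allI ballI impI) simp_all
qed

text \<open>Indices multiply in \<open>D \<subseteq> S \<subseteq> G\<close>: if the
  \<open>inv (r i)\<close> represent \<open>G / S\<close> and the \<open>h j\<close> represent
  \<open>S / D\<close>, then the products \<open>inv (r i) \<otimes> h j\<close> represent
  \<open>G / D\<close>. This separates the factor that depends on \<open>G\<close> from the factor
  computed inside the congruence subgroup.\<close>

theorem (in group) self_similar_of_subgroup_endomorphism:
  assumes S: "subgroup S G" and fin: "finite (rcosets S)"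
    and D: "subgroup D G" "D \<subseteq> S"
    and \<phi>_closed: "\<And>x. x \<in> D \<Longrightarrow> \<phi> x \<in> carrier G"
    and \<phi>_mult: "\<And>x y. x \<in> D \<Longrightarrow> y \<in> D \<Longrightarrow> \<phi> (x \<otimes> y) = \<phi> x \<otimes> \<phi> y"
    and T: "finite T" "T \<subseteq> S"
    and transversal: "\<And>x. x \<in> S \<Longrightarrow> \<exists>!t. t \<in> T \<and> inv t \<otimes> x \<in> D"
    and simple: "\<And>N. N \<lhd> G \<Longrightarrow> N \<subseteq> D \<Longrightarrow> \<phi> ` N \<subseteq> N \<Longrightarrow> N \<subseteq> {\<one>}"
  shows "self_similar_of_index G (card (rcosets S) * card T)"
proof -
  let ?M = "card (rcosets S)" and ?N = "card T"
  interpret S: subgroup S G by (rule S)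
  from finite_index_left_transversal[OF S fin] obtain r where
    r_props: "(\<forall>i < ?M. r i \<in> carrier G) \<and> (\<forall>g \<in> carrier G. \<exists>!i. i < ?M \<and> r i \<otimes> g \<in> S)"
    by (elim exE)
  note r = mp[OF spec[OF conjunct1[OF r_props]]] and r1 = bspec[OF conjunct2[OF r_props]]
  obtain h where h: "bij_betw h {0..<?N} T" using ex_bij_betw_nat_finite[OF T(1)] by blast
  have h_in: "h j \<in> T" if "j < ?N" for j using bij_betwE[OF h] that by simp
  have h_carr: "h j \<in> carrier G" if "j < ?N" for j
    by (rule subsetD[OF S.subset subsetD[OF T(2) h_in[OF that]]])
  \<comment> \<open>The pair \<open>(i, j)\<close> is encoded as the letter
    \<open>i * ?N + j\<close>.\<close>
  define t where "t x = inv (r (x div ?N)) \<otimes> h (x mod ?N)" for x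
  have lt: "x div ?N < ?M" "x mod ?N < ?N" if "x < ?M * ?N" for x
    using that by (simp add: less_mult_imp_div_less) (use that in \<open>cases "?N = 0"; simp\<close>)
  have t_closed: "t x \<in> carrier G" if "x < ?M * ?N" for x
    unfolding t_def using r[OF lt(1)[OF that]] h_carr[OF lt(2)[OF that]] by simp
  have inv_t: "inv (t x) \<otimes> g = inv (h (x mod ?N)) \<otimes> (r (x div ?N) \<otimes> g)"
    if "x < ?M * ?N" "g \<in> carrier G" for x g
    unfolding t_def using r[OF lt(1)[OF that(1)]] h_carr[OF lt(2)[OF that(1)]] that(2)
    by (simp add: inv_mult_group m_assoc)
  have tr: "\<exists>!x. x < ?M * ?N \<and> inv (t x) \<otimes> g \<in> D" if g: "g \<in> carrier G" for g
  proof -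
    from r1[OF g] obtain i where i: "i < ?M \<and> r i \<otimes> g \<in> S"
      and "\<forall>i'. i' < ?M \<and> r i' \<otimes> g \<in> S \<longrightarrow> i' = i" by (rule ex1E)
    note i1 = mp[OF spec[OF this(2)], OF conjI] and i = conjunct1[OF i] conjunct2[OF i]
    from transversal[OF i(2)] obtain y where y: "y \<in> T \<and> inv y \<otimes> (r i \<otimes> g) \<in> D"
      and "\<forall>y'. y' \<in> T \<and> inv y' \<otimes> (r i \<otimes> g) \<in> D \<longrightarrow> y' = y" by (rule ex1E)
    note y1 = mp[OF spec[OF this(2)], OF conjI] and y = conjunct1[OF y] conjunct2[OF y]
    from y(1) have "y \<in> h ` {0..<?N}" unfolding bij_betw_imp_surj_on[OF h] .
    then obtain j where j: "j < ?N" "y = h j" by (elim imageE) simp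
    define x where "x = i * ?N + j"
    have "i * ?N + j < Suc i * ?N" using j(1) by simp
    also have "\<dots> \<le> ?M * ?N" using i(1) by (intro mult_right_mono) auto
    finally have x: "x < ?M * ?N" unfolding x_def .
    have xd: "x div ?N = i" "x mod ?N = j" unfolding x_def using j(1) by auto
    show ?thesis
    proof (rule ex1I[of _ x])
      show "x < ?M * ?N \<and> inv (t x) \<otimes> g \<in> D"
        using x y(2) unfolding inv_t[OF x g] xd j(2) by (rule conjI)
      fix x' assume x': "x' < ?M * ?N \<and> inv (t x') \<otimes> g \<in> D"
      then have l: "x' div ?N < ?M" "x' mod ?N < ?N" using lt by auto
      have d: "inv (h (x' mod ?N)) \<otimes> (r (x' div ?N) \<otimes> g) \<in> D"
        using conjunct2[OF x'] unfolding inv_t[OF conjunct1[OF x'] g] .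
      have rg: "r (x' div ?N) \<otimes> g \<in> carrier G" using r[OF l(1)] g by simp
      \<comment> \<open>Since \<open>D \<subseteq> S\<close> and \<open>T \<subseteq> S\<close>,
        membership in \<open>D\<close> already forces \<open>r i' \<otimes> g \<in> S\<close>, which
        determines \<open>i'\<close>; only then is the uniqueness in \<open>T\<close>
        applicable.\<close>
      have "h (x' mod ?N) \<otimes> (inv (h (x' mod ?N)) \<otimes> (r (x' div ?N) \<otimes> g)) \<in> S"
        by (rule S.m_closed[OF subsetD[OF T(2) h_in[OF l(2)]] subsetD[OF D(2) d]])
      then have "r (x' div ?N) \<otimes> g \<in> S"
        using h_carr[OF l(2)] rg by (simp add: m_assoc[symmetric])
      then have i': "x' div ?N = i" by (rule i1[OF l(1)])
      have "h (x' mod ?N) = h j"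
        using y1[OF h_in[OF l(2)] d[unfolded i']] unfolding j(2) .
      then have "x' mod ?N = j"
        by (rule inj_onD[OF bij_betw_imp_inj_on[OF h]]) (use l(2) j(1) in simp_all)
      then show "x' = x" using i' div_mult_mod_eq[of x' ?N] unfolding x_def by simp
    qed
  qed
  interpret virtual_endomorphism G D \<phi> t "?M * ?N"
    by (intro virtual_endomorphism.intro virtual_endomorphism_axioms.intro is_group D(1))
      (fact \<phi>_closed \<phi>_mult t_closed tr)+
  show ?thesis by (rule self_similar_of_indexI[OF simple])
qed

section \<open>The p-adic absolute value\<close>

context
  fixes p :: nat
  assumes p: "prime p"
begin

lemma prime_int: "prime (int p)" and p_gt_1: "real p > 1" and p_pos: "real p > 0"
  using p prime_gt_1_nat[OF p] by auto

text \<open>The definition uses the reduced fraction. Cross-multiplication with an arbitrary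
  fraction shows that the difference of multiplicities is the same, so products and common
  denominators can be handled without cancelling.\<close>

lemma padic_abs_of_int_div:
  assumes "a \<noteq> 0" "b \<noteq> 0"
  shows "padic_abs p (of_int a / of_int b)
    = real p powi (int (multiplicity (int p) b) - int (multiplicity (int p) a))"
proof -
  let ?x = "of_int a / of_int b :: rat"
  obtain c d where cd: "quotient_of ?x = (c, d)" by force
  have d: "d > 0" using quotient_of_denom_pos[OF cd] .
  have eq: "?x = of_int c / of_int d" using quotient_of_div[OF cd] .
  have x0: "?x \<noteq> 0" using assms by simp
  then have c: "c \<noteq> 0" using eq by auto
  have "of_int (a * d) = (of_int (c * b) :: rat)"
    using eq assms d by (simp add: field_simps)
  then have "a * d = c * b" by (simp only: of_int_eq_iff)
  then have "multiplicity (int p) (a * d) = multiplicity (int p) (c * b)" by simp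
  then have "multiplicity (int p) a + multiplicity (int p) d
      = multiplicity (int p) c + multiplicity (int p) b"
    using prime_int assms c d by (simp add: prime_elem_multiplicity_mult_distrib)
  then have "int (multiplicity (int p) d) - int (multiplicity (int p) c)
      = int (multiplicity (int p) b) - int (multiplicity (int p) a)" by linarith
  then show ?thesis using x0 cd by (simp add: padic_abs_def)
qed

lemma rat_fraction_cases:
  fixes x :: rat
  obtains (zero) "x = 0" | (frac) a b where "a \<noteq> 0" "b \<noteq> 0" "x = of_int a / of_int b"
proof (cases "x = 0")
  case False
  obtain c d where cd: "quotient_of x = (c, d)" by force
  have "d > 0" "x = of_int c / of_int d" using quotient_of_denom_pos[OF cd] quotient_of_div[OF cd] .
  then show thesis using False frac[of c d] by auto
qed (rule zero)

lemma padic_abs_zero [simp]: "padic_abs p 0 = 0"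
  by (simp add: padic_abs_def)

lemma padic_abs_nonneg [simp]: "padic_abs p x \<ge> 0"
  by (simp add: padic_abs_def)

lemma padic_abs_mult: "padic_abs p (x * y) = padic_abs p x * padic_abs p y"
proof (cases x rule: rat_fraction_cases)
  case (frac a b)
  note x = frac
  show ?thesis
  proof (cases y rule: rat_fraction_cases)
    case (frac c d)
    have "x * y = of_int (a * c) / of_int (b * d)" using x frac by simp
    also have "padic_abs p \<dots> = real p powi
      ((int (multiplicity (int p) b) - int (multiplicity (int p) a))
        + (int (multiplicity (int p) d) - int (multiplicity (int p) c)))"
      using x frac prime_int padic_abs_of_int_div[of "a * c" "b * d"]
      by (simp add: prime_elem_multiplicity_mult_distrib algebra_simps)
    also have "\<dots> = padic_abs p x * padic_abs p y"
      using x frac p_pos by (simp add: padic_abs_of_int_div power_int_add)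
    finally show ?thesis .
  qed auto
qed auto

lemma padic_abs_one [simp]: "padic_abs p 1 = 1"
  using padic_abs_of_int_div[of 1 1] by simp

lemma padic_abs_minus [simp]: "padic_abs p (- x) = padic_abs p x"
proof -
  have "padic_abs p (-1) * padic_abs p (-1) = 1"
    using padic_abs_mult[of "-1" "-1"] by simp
  then have "padic_abs p (-1) = 1"
    using padic_abs_nonneg[of "-1"] by (metis abs_of_nonneg abs_mult_self_eq abs_1 real_sqrt_abs2 real_sqrt_one)
  then show ?thesis using padic_abs_mult[of "-1" x] by simp
qed

lemma padic_abs_inverse: "padic_abs p (inverse x) = inverse (padic_abs p x)"
proof (cases "x = 0")
  case False
  then have "padic_abs p x * padic_abs p (inverse x) = 1"
    using padic_abs_mult[of x "inverse x"] by simp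
  then show ?thesis by (simp add: inverse_unique)
qed simp

text \<open>Over a common denominator the claim is about numerators: the smaller of two powers of
  \<open>p\<close> that divide the summands divides the sum.\<close>

lemma padic_abs_add: "padic_abs p (x + y) \<le> max (padic_abs p x) (padic_abs p y)"
proof (cases x rule: rat_fraction_cases)
  case (frac a b)
  note x = frac
  show ?thesis
  proof (cases y rule: rat_fraction_cases)
    case (frac c d)
    show ?thesis
    proof (cases "x + y = 0")
      case False
      let ?v = "multiplicity (int p)"
      have xy: "x = of_int (a * d) / of_int (b * d)" "y = of_int (c * b) / of_int (b * d)"
        "x + y = of_int (a * d + c * b) / of_int (b * d)"
        using x frac by (auto simp: field_simps)
      have "a * d + c * b \<noteq> 0"
      proof
        assume "a * d + c * b = 0"
        then have "x + y = of_int 0 / of_int (b * d)" using xy(3) by (simp only:)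
        with False show False by simp
      qed
      then have nz: "a * d + c * b \<noteq> 0" "b * d \<noteq> 0" "a * d \<noteq> 0" "c * b \<noteq> 0"
        using x frac by auto
      have "int p ^ min (?v (a * d)) (?v (c * b)) dvd a * d + c * b"
        by (intro dvd_add multiplicity_dvd') auto
      then have "min (?v (a * d)) (?v (c * b)) \<le> ?v (a * d + c * b)"
        using nz prime_int by (intro multiplicity_geI) auto
      then have "?v (a * d) \<le> ?v (a * d + c * b) \<or> ?v (c * b) \<le> ?v (a * d + c * b)"
        by (simp add: min_le_iff_disj)
      moreover have "padic_abs p x = real p powi (int (?v (b * d)) - int (?v (a * d)))"
        "padic_abs p y = real p powi (int (?v (b * d)) - int (?v (c * b)))"
        "padic_abs p (x + y) = real p powi (int (?v (b * d)) - int (?v (a * d + c * b)))"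
        using padic_abs_of_int_div[OF nz(3,2)] padic_abs_of_int_div[OF nz(4,2)]
          padic_abs_of_int_div[OF nz(1,2)] xy by metis+
      ultimately show ?thesis
        using p_gt_1 unfolding le_max_iff_disj by (auto intro!: power_int_increasing)
    qed (simp add: le_max_iff_disj)
  qed (simp add: le_max_iff_disj)
qed (simp add: le_max_iff_disj)

lemma padic_abs_diff: "padic_abs p (x - y) \<le> max (padic_abs p x) (padic_abs p y)"
  using padic_abs_add[of x "- y"] by simp

lemma padic_abs_p: "padic_abs p (of_nat p) = 1 / real p"
  using padic_abs_of_int_div[of "int p" 1] p p_pos prime_int by (simp add: power_int_minus field_simps)

lemma padic_abs_p_power: "padic_abs p (of_nat p ^ k) = 1 / real p ^ k"
  by (induction k) (auto simp: padic_abs_mult padic_abs_p field_simps)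

lemma padic_abs_of_int_le: "padic_abs p (of_int a) \<le> 1"
proof (cases "a = 0")
  case False
  have "real p powi (- int (multiplicity (int p) a)) \<le> real p powi 0"
    using p_gt_1 by (intro power_int_increasing) auto
  then show ?thesis using padic_abs_of_int_div[OF False, of 1] by simp
qed simp

lemma padic_abs_of_nat_le: "padic_abs p (of_nat a) \<le> 1"
  using padic_abs_of_int_le[of "int a"] by simp

text \<open>Absolute value at most 1 means that \<open>p\<close> does not divide the reduced
  denominator \<open>b\<close>. A Bezout identity then provides an inverse \<open>v\<close> of
  \<open>b\<close> modulo \<open>p\<close>, and \<open>j\<close> is the residue of
  \<open>a * v\<close>.\<close>

lemma padic_integral_rat_residue:
  assumes "padic_abs p x \<le> 1"
  shows "\<exists>j<p. padic_abs p (x - of_nat j) \<le> 1 / real p"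
proof (cases "x = 0")
  case True
  then show ?thesis using p prime_gt_0_nat by (intro exI[of _ 0]) auto
next
  case False
  obtain a b where ab: "quotient_of x = (a, b)" by force
  have b: "b > 0" "x = of_int a / of_int b" "coprime a b"
    using quotient_of_denom_pos[OF ab] quotient_of_div[OF ab] quotient_of_coprime[OF ab] .
  have a: "a \<noteq> 0" using False b by auto
  have ndvd: "\<not> int p dvd b"
  proof
    assume d: "int p dvd b"
    then have "\<not> int p dvd a"
      using b(3) prime_int by (meson coprime_common_divisor not_prime_unit)
    then have "multiplicity (int p) a = 0" by (rule not_dvd_imp_multiplicity_0)
    moreover have "multiplicity (int p) b > 0"
      using d b(1) prime_int by (subst prime_multiplicity_gt_zero_iff) auto
    ultimately have "real p powi 1 \<le> padic_abs p x"
      unfolding b(2) padic_abs_of_int_div[OF a, of b, OF less_imp_neq[OF b(1), symmetric]]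
      using p_gt_1 by (intro power_int_increasing) auto
    then show False using assms p_gt_1 by simp
  qed
  have "coprime (int p) b"
    using ndvd prime_int by (intro prime_imp_coprime) auto
  then obtain u v where uv: "u * int p + v * b = 1"
    using bezout_int[of "int p" b] by (auto simp: coprime_iff_gcd_eq_1)
  define j where "j = nat ((a * v) mod int p)"
  have p0: "int p > 0" using p prime_gt_0_nat by simp
  have j: "int j = (a * v) mod int p" unfolding j_def using p0 by simp
  have "a - b * int j = a * (u * int p + v * b) - b * int j" unfolding uv by simp
  also have "\<dots> = int p * (a * u) + b * (a * v - (a * v) mod int p)"
    unfolding j by (simp add: algebra_simps)
  finally have "int p dvd a - b * int j"
    by (simp add: dvd_minus_mod)
  then obtain k where k: "a - b * int j = int p * k" by (elim dvdE)
  have "x - of_nat j = of_nat p * (of_int k / of_int b)"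
  proof -
    have "of_int (a - b * int j) = (of_int (int p * k) :: rat)" using k by simp
    then show ?thesis using b(1,2) by (simp add: field_simps)
  qed
  moreover have "padic_abs p (of_int k / of_int b) \<le> 1"
  proof (cases "k = 0")
    case kn: False
    have "multiplicity (int p) b = 0" using ndvd by (rule not_dvd_imp_multiplicity_0)
    then have "padic_abs p (of_int k / of_int b) = padic_abs p (of_int k / of_int 1)"
      using padic_abs_of_int_div[OF kn, of b] padic_abs_of_int_div[OF kn, of 1] b(1) by simp
    then show ?thesis using padic_abs_of_int_le[of k] by simp
  qed simp
  ultimately have "padic_abs p (x - of_nat j) \<le> 1 / real p"
    using p_pos by (simp only: padic_abs_mult padic_abs_p) (simp add: divide_right_mono)
  moreover have "j < p" using j p0 pos_mod_bound[OF p0, of "a * v"] by linarith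
  ultimately show ?thesis by blast
qed

section \<open>Cauchy sequences of rational numbers\<close>

lemma padic_Cauchy_bounded:
  assumes "padic_Cauchy p s"
  shows "\<exists>B>0. \<forall>i. padic_abs p (s i) \<le> B"
proof -
  obtain N where N: "padic_abs p (s i - s j) < 1" if "i \<ge> N" "j \<ge> N" for i j
    using assms[unfolded padic_Cauchy_def, rule_format, of 1] by auto
  define B where "B = Max (insert 1 ((\<lambda>i. padic_abs p (s i)) ` {..N}))"
  have B: "1 \<le> B" "\<And>i. i \<le> N \<Longrightarrow> padic_abs p (s i) \<le> B"
    unfolding B_def by (rule Max_ge; simp)+
  have "padic_abs p (s i) \<le> B" for i
  proof (cases "i \<le> N")
    case False
    have "padic_abs p (s i) \<le> max (padic_abs p (s i - s N)) (padic_abs p (s N))"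
      using padic_abs_add[of "s i - s N" "s N"] by simp
    also have "\<dots> \<le> B" using N[of i N] False B(1) B(2)[of N] by simp
    finally show ?thesis .
  qed (rule B(2))
  with B(1) show ?thesis by (intro exI[of _ B]) auto
qed

lemma padic_Cauchy_const [simp]: "padic_Cauchy p (\<lambda>i. c)"
  by (simp add: padic_Cauchy_def)

lemma padic_Cauchy_add:
  assumes "padic_Cauchy p s" "padic_Cauchy p t"
  shows "padic_Cauchy p (\<lambda>i. s i + t i)"
  unfolding padic_Cauchy_def
proof (intro allI impI)
  fix \<epsilon> :: real assume e: "\<epsilon> > 0"
  obtain M N where M: "\<And>i j. i \<ge> M \<Longrightarrow> j \<ge> M \<Longrightarrow> padic_abs p (s i - s j) < \<epsilon>"
    and N: "\<And>i j. i \<ge> N \<Longrightarrow> j \<ge> N \<Longrightarrow> padic_abs p (t i - t j) < \<epsilon>"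
    using assms e unfolding padic_Cauchy_def by metis
  have "padic_abs p (s i + t i - (s j + t j)) < \<epsilon>" if "i \<ge> max M N" "j \<ge> max M N" for i j
  proof -
    have "s i + t i - (s j + t j) = (s i - s j) + (t i - t j)" by simp
    then have "padic_abs p (s i + t i - (s j + t j))
        \<le> max (padic_abs p (s i - s j)) (padic_abs p (t i - t j))"
      using padic_abs_add by metis
    then show ?thesis using M[of i j] N[of i j] that by simp
  qed
  then show "\<exists>N. \<forall>i\<ge>N. \<forall>j\<ge>N. padic_abs p (s i + t i - (s j + t j)) < \<epsilon>" by blast
qed

lemma padic_Cauchy_mult:
  assumes "padic_Cauchy p s" "padic_Cauchy p t"
  shows "padic_Cauchy p (\<lambda>i. s i * t i)"
  unfolding padic_Cauchy_def
proof (intro allI impI)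
  fix \<epsilon> :: real assume e: "\<epsilon> > 0"
  obtain B C where B: "B > 0" "\<And>i. padic_abs p (s i) \<le> B"
    and C: "C > 0" "\<And>i. padic_abs p (t i) \<le> C"
    using assms padic_Cauchy_bounded by metis
  have "\<epsilon> / C > 0" "\<epsilon> / B > 0" using e B C by auto
  then obtain M N where M: "\<And>i j. i \<ge> M \<Longrightarrow> j \<ge> M \<Longrightarrow> padic_abs p (s i - s j) < \<epsilon> / C"
    and N: "\<And>i j. i \<ge> N \<Longrightarrow> j \<ge> N \<Longrightarrow> padic_abs p (t i - t j) < \<epsilon> / B"
    using assms unfolding padic_Cauchy_def by metis
  have "padic_abs p (s i * t i - s j * t j) < \<epsilon>" if "i \<ge> max M N" "j \<ge> max M N" for i j
  proof -
    have "s i * t i - s j * t j = (s i - s j) * t i + s j * (t i - t j)" by (simp add: algebra_simps)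
    then have "padic_abs p (s i * t i - s j * t j)
        \<le> max (padic_abs p (s i - s j) * padic_abs p (t i)) (padic_abs p (s j) * padic_abs p (t i - t j))"
      using padic_abs_add padic_abs_mult by metis
    moreover have "padic_abs p (s i - s j) * padic_abs p (t i) \<le> padic_abs p (s i - s j) * C"
      by (intro mult_left_mono C) auto
    moreover have "\<dots> < \<epsilon>" using M[of i j] that C by (simp add: pos_less_divide_eq)
    moreover have "padic_abs p (s j) * padic_abs p (t i - t j) \<le> B * padic_abs p (t i - t j)"
      by (intro mult_right_mono B) auto
    moreover have "\<dots> < \<epsilon>" using N[of i j] that B by (simp add: pos_less_divide_eq mult.commute)
    ultimately show ?thesis by linarith
  qed
  then show "\<exists>N. \<forall>i\<ge>N. \<forall>j\<ge>N. padic_abs p (s i * t i - s j * t j) < \<epsilon>" by blast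
qed

lemma padic_Cauchy_minus: "padic_Cauchy p s \<Longrightarrow> padic_Cauchy p (\<lambda>i. - s i)"
  using padic_Cauchy_mult[OF padic_Cauchy_const[of "-1"]] by simp

text \<open>The difference of inverses is \<open>(s j - s i) / (s i * s j)\<close>, and the
  denominator is bounded below by \<open>\<epsilon>\<^sup>2\<close> from \<open>M\<close> on. Terms
  before \<open>M\<close> may vanish; the convention \<open>inverse 0 = 0\<close> is harmless
  there.\<close>

lemma padic_Cauchy_inverse:
  assumes s: "padic_Cauchy p s" and e: "\<epsilon> > 0" and M: "\<And>i. i \<ge> M \<Longrightarrow> padic_abs p (s i) \<ge> \<epsilon>"
  shows "padic_Cauchy p (\<lambda>i. inverse (s i))"
  unfolding padic_Cauchy_def
proof (intro allI impI)
  fix \<eta> :: real assume h: "\<eta> > 0"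
  have "\<eta> * \<epsilon>\<^sup>2 > 0" using e h by simp
  then obtain N where N: "\<And>i j. i \<ge> N \<Longrightarrow> j \<ge> N \<Longrightarrow> padic_abs p (s i - s j) < \<eta> * \<epsilon>\<^sup>2"
    using s unfolding padic_Cauchy_def by metis
  have "padic_abs p (inverse (s i) - inverse (s j)) < \<eta>" if "i \<ge> max M N" "j \<ge> max M N" for i j
  proof -
    have ge: "padic_abs p (s i) \<ge> \<epsilon>" "padic_abs p (s j) \<ge> \<epsilon>" using M that by auto
    then have "s i \<noteq> 0" "s j \<noteq> 0" using e by auto
    then have "s j - s i = (inverse (s i) - inverse (s j)) * (s i * s j)"
      by (simp add: field_simps)
    then have "padic_abs p (s j - s i)
        = padic_abs p (inverse (s i) - inverse (s j)) * (padic_abs p (s i) * padic_abs p (s j))"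
      using padic_abs_mult by metis
    moreover have "\<epsilon>\<^sup>2 \<le> padic_abs p (s i) * padic_abs p (s j)"
      unfolding power2_eq_square using ge e by (intro mult_mono) auto
    ultimately have "padic_abs p (inverse (s i) - inverse (s j)) * \<epsilon>\<^sup>2 \<le> padic_abs p (s j - s i)"
      by (simp add: mult_left_mono)
    also have "\<dots> < \<eta> * \<epsilon>\<^sup>2" using N[of j i] that by simp
    finally show ?thesis using e by simp
  qed
  then show "\<exists>N. \<forall>i\<ge>N. \<forall>j\<ge>N. padic_abs p (inverse (s i) - inverse (s j)) < \<eta>" by blast
qed

text \<open>A single late index \<open>k\<close> with absolute value at least
  \<open>\<epsilon>\<close> suffices. All later terms differ from \<open>s k\<close> by less than
  \<open>\<epsilon>\<close>, so by the ultrametric inequality none of them can be smaller than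
  \<open>\<epsilon>\<close>.\<close>

lemma padic_nonnull_bounded_below:
  assumes s: "padic_Cauchy p s" and nn: "s \<notin> padic_null_sequences p"
  obtains \<epsilon> M where "\<epsilon> > 0" "\<And>i. i \<ge> M \<Longrightarrow> padic_abs p (s i) \<ge> \<epsilon>"
proof -
  from nn obtain \<epsilon> where e: "\<epsilon> > 0" "\<forall>N. \<exists>i\<ge>N. padic_abs p (s i) \<ge> \<epsilon>"
    unfolding padic_null_sequences_def LIMSEQ_iff by (auto simp: not_less)
  obtain M where M: "\<And>i j. i \<ge> M \<Longrightarrow> j \<ge> M \<Longrightarrow> padic_abs p (s i - s j) < \<epsilon>"
    using s e(1) unfolding padic_Cauchy_def by metis
  obtain k where k: "k \<ge> M" "padic_abs p (s k) \<ge> \<epsilon>" using e by blast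
  have "padic_abs p (s i) \<ge> \<epsilon>" if "i \<ge> M" for i
  proof -
    have "padic_abs p (s k) \<le> max (padic_abs p (s k - s i)) (padic_abs p (s i))"
      using padic_abs_add[of "s k - s i" "s i"] by simp
    then show ?thesis using M[OF k(1) that] k(2) by simp
  qed
  then show thesis using that e by blast
qed

end

section \<open>The ring of Cauchy sequences and its ideal of null sequences\<close>

lemma cring_padic_Cauchy_ring:
  assumes p: "prime p"
  shows "cring (padic_Cauchy_ring p)"
proof (rule cringI)
  show "abelian_group (padic_Cauchy_ring p)"
  proof (rule abelian_groupI)
    show "\<exists>y\<in>carrier (padic_Cauchy_ring p). y \<oplus>\<^bsub>padic_Cauchy_ring p\<^esub> x = \<zero>\<^bsub>padic_Cauchy_ring p\<^esub>"
      if "x \<in> carrier (padic_Cauchy_ring p)" for x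
      using that padic_Cauchy_minus[OF p, of x]
      by (intro bexI[of _ "\<lambda>i. - x i"]) (auto simp: padic_Cauchy_ring_def)
  qed (auto simp: padic_Cauchy_ring_def padic_Cauchy_add[OF p] padic_Cauchy_const[OF p] algebra_simps)
  show "Group.comm_monoid (padic_Cauchy_ring p)"
    by (rule comm_monoidI)
      (auto simp: padic_Cauchy_ring_def padic_Cauchy_mult[OF p] padic_Cauchy_const[OF p] algebra_simps)
qed (auto simp: padic_Cauchy_ring_def algebra_simps)

lemma padic_null_sequence_Cauchy:
  assumes p: "prime p" and s: "s \<in> padic_null_sequences p"
  shows "padic_Cauchy p s"
  unfolding padic_Cauchy_def
proof (intro allI impI)
  fix \<epsilon> :: real assume "\<epsilon> > 0"
  then have "\<exists>N. \<forall>i\<ge>N. padic_abs p (s i) < \<epsilon>"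
    using s padic_abs_nonneg[OF p] unfolding padic_null_sequences_def LIMSEQ_iff by auto
  then obtain N where N: "\<And>i. i \<ge> N \<Longrightarrow> padic_abs p (s i) < \<epsilon>" by blast
  have "padic_abs p (s i - s j) < \<epsilon>" if "i \<ge> N" "j \<ge> N" for i j
    using padic_abs_diff[OF p, of "s i" "s j"] N[OF that(1)] N[OF that(2)] by linarith
  then show "\<exists>N. \<forall>i\<ge>N. \<forall>j\<ge>N. padic_abs p (s i - s j) < \<epsilon>" by blast
qed

lemma padic_null_sequences_mult:
  assumes p: "prime p" and s: "s \<in> padic_null_sequences p" and t: "padic_Cauchy p t"
  shows "(\<lambda>i. t i * s i) \<in> padic_null_sequences p"
proof -
  obtain B where B: "B > 0" "\<And>i. padic_abs p (t i) \<le> B"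
    using padic_Cauchy_bounded[OF p t] by blast
  have "(\<lambda>i. B * padic_abs p (s i)) \<longlonglongrightarrow> B * 0"
    using s unfolding padic_null_sequences_def by (intro tendsto_intros) auto
  then have "(\<lambda>i. B * padic_abs p (s i)) \<longlonglongrightarrow> 0" by simp
  moreover have "\<forall>\<^sub>F i in sequentially. 0 \<le> padic_abs p (t i * s i)"
    using padic_abs_nonneg[OF p] by simp
  moreover have "\<forall>\<^sub>F i in sequentially. padic_abs p (t i * s i) \<le> B * padic_abs p (s i)"
    unfolding padic_abs_mult[OF p] by (intro always_eventually allI mult_right_mono B padic_abs_nonneg[OF p])
  ultimately have "(\<lambda>i. padic_abs p (t i * s i)) \<longlonglongrightarrow> 0"
    by (rule tendsto_sandwich[OF _ _ tendsto_const, rotated 2])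
  then show ?thesis unfolding padic_null_sequences_def by simp
qed

lemma padic_null_sequences_add:
  assumes p: "prime p" and "s \<in> padic_null_sequences p" "t \<in> padic_null_sequences p"
  shows "(\<lambda>i. s i + t i) \<in> padic_null_sequences p"
proof -
  have "(\<lambda>i. padic_abs p (s i) + padic_abs p (t i)) \<longlonglongrightarrow> 0 + 0"
    using assms(2,3) unfolding padic_null_sequences_def by (intro tendsto_intros) auto
  then have "(\<lambda>i. padic_abs p (s i) + padic_abs p (t i)) \<longlonglongrightarrow> 0" by simp
  moreover have "\<forall>\<^sub>F i in sequentially. 0 \<le> padic_abs p (s i + t i)"
    using padic_abs_nonneg[OF p] by simp
  moreover have "\<forall>\<^sub>F i in sequentially. padic_abs p (s i + t i) \<le> padic_abs p (s i) + padic_abs p (t i)"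
  proof (intro always_eventually allI)
    fix i show "padic_abs p (s i + t i) \<le> padic_abs p (s i) + padic_abs p (t i)"
      using padic_abs_add[OF p, of "s i" "t i"] padic_abs_nonneg[OF p, of "s i"]
        padic_abs_nonneg[OF p, of "t i"] by linarith
  qed
  ultimately have "(\<lambda>i. padic_abs p (s i + t i)) \<longlonglongrightarrow> 0"
    by (rule tendsto_sandwich[OF _ _ tendsto_const, rotated 2])
  then show ?thesis unfolding padic_null_sequences_def by simp
qed

lemma ideal_padic_null_sequences:
  assumes p: "prime p"
  shows "ideal (padic_null_sequences p) (padic_Cauchy_ring p)"
proof -
  interpret cring "padic_Cauchy_ring p" by (rule cring_padic_Cauchy_ring[OF p])
  have mul: "x \<otimes>\<^bsub>padic_Cauchy_ring p\<^esub> a \<in> padic_null_sequences p"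
    if "a \<in> padic_null_sequences p" "x \<in> carrier (padic_Cauchy_ring p)" for a x
    using padic_null_sequences_mult[OF p that(1), of x] that(2) by (simp add: padic_Cauchy_ring_def)
  have sub: "padic_null_sequences p \<subseteq> carrier (padic_Cauchy_ring p)"
    using padic_null_sequence_Cauchy[OF p] by (auto simp: padic_Cauchy_ring_def)
  show ?thesis
  proof (rule idealI)
    show "subgroup (padic_null_sequences p) (add_monoid (padic_Cauchy_ring p))"
    proof (rule add.subgroupI)
      show "padic_null_sequences p \<noteq> {}"
        using padic_abs_zero[OF p] by (auto simp: padic_null_sequences_def intro!: exI[of _ "\<lambda>i. 0"])
      show "a \<oplus>\<^bsub>padic_Cauchy_ring p\<^esub> b \<in> padic_null_sequences p"
        if "a \<in> padic_null_sequences p" "b \<in> padic_null_sequences p" for a b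
        using padic_null_sequences_add[OF p that] by (simp add: padic_Cauchy_ring_def)
      show "\<ominus>\<^bsub>padic_Cauchy_ring p\<^esub> a \<in> padic_null_sequences p"
        if a: "a \<in> padic_null_sequences p" for a
      proof -
        have "\<ominus>\<^bsub>padic_Cauchy_ring p\<^esub> a = \<ominus>\<^bsub>padic_Cauchy_ring p\<^esub> \<one>\<^bsub>padic_Cauchy_ring p\<^esub> \<otimes>\<^bsub>padic_Cauchy_ring p\<^esub> a"
          using a sub by (simp add: l_minus subset_iff)
        then show ?thesis using mul[OF a] by (metis a_inv_closed one_closed)
      qed
    qed (rule sub)
    show "a \<otimes>\<^bsub>padic_Cauchy_ring p\<^esub> x \<in> padic_null_sequences p"
      if "a \<in> padic_null_sequences p" "x \<in> carrier (padic_Cauchy_ring p)" for a x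
      using mul[OF that] that sub by (simp add: m_comm subset_iff)
  qed (use mul ring_axioms in auto)
qed

section \<open>The p-adic numbers and p-adic integers inside the extension field\<close>

locale padic_extension_field =
  fixes p d :: nat and \<iota> :: "(nat \<Rightarrow> rat) set \<Rightarrow> 'k::field"
  assumes p: "prime p" and ext: "padic_extension p d \<iota>"
begin

abbreviation Qp :: "'k set" where "Qp \<equiv> \<iota> ` carrier (padic_field p)"
abbreviation Zp :: "'k set" where "Zp \<equiv> \<iota> ` padic_integers p"

text \<open>For a Cauchy sequence this is the p-adic number that it represents, seen in the
  extension field. The composite of the quotient map with \<open>\<iota>\<close> replaces cosets by
  explicit rational sequences in everything that follows.\<close>

definition limit :: "(nat \<Rightarrow> rat) \<Rightarrow> 'k" where
  "limit s = \<iota> (padic_null_sequences p +>\<^bsub>padic_Cauchy_ring p\<^esub> s)"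

lemma limit_hom: "limit \<in> Ring.ring_hom (padic_Cauchy_ring p) (cring_class_ops :: 'k ring)"
proof -
  interpret I: ideal "padic_null_sequences p" "padic_Cauchy_ring p"
    by (rule ideal_padic_null_sequences[OF p])
  have "\<iota> \<in> Ring.ring_hom (padic_field p) cring_class_ops"
    using ext unfolding padic_extension_def by blast
  then show ?thesis
    using ring_hom_trans[OF I.rcos_ring_hom, of \<iota>] unfolding padic_field_def limit_def comp_def by blast
qed

lemma limit_add: "padic_Cauchy p s \<Longrightarrow> padic_Cauchy p t \<Longrightarrow> limit (\<lambda>i. s i + t i) = limit s + limit t"
  using ring_hom_add[OF limit_hom, of s t] by (simp add: padic_Cauchy_ring_def cring_class_ops_def)

lemma limit_mult: "padic_Cauchy p s \<Longrightarrow> padic_Cauchy p t \<Longrightarrow> limit (\<lambda>i. s i * t i) = limit s * limit t"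
  using ring_hom_mult[OF limit_hom, of s t] by (simp add: padic_Cauchy_ring_def cring_class_ops_def)

lemma limit_one: "limit (\<lambda>i. 1) = 1"
  using ring_hom_one[OF limit_hom] by (simp add: padic_Cauchy_ring_def cring_class_ops_def)

lemma limit_zero: "limit (\<lambda>i. 0) = 0"
  using limit_add[of "\<lambda>i. 0" "\<lambda>i. 0"] padic_Cauchy_const[OF p]
  by (metis add.right_neutral add_left_cancel)

lemma limit_of_nat: "limit (\<lambda>i. of_nat n) = of_nat n"
proof (induction n)
  case (Suc n)
  have "limit (\<lambda>i. 1 + of_nat n) = limit (\<lambda>i. 1) + limit (\<lambda>i. of_nat n)"
    by (intro limit_add padic_Cauchy_const[OF p])
  then show ?case using Suc limit_one by simp
qed (simp add: limit_zero)

lemma limit_minus: 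
  assumes "padic_Cauchy p s"
  shows "limit (\<lambda>i. - s i) = - limit s"
  using limit_add[OF assms padic_Cauchy_minus[OF p assms]] limit_zero
  by (simp add: eq_neg_iff_add_eq_0 add.commute)

lemma limit_null:
  assumes "s \<in> padic_null_sequences p"
  shows "limit s = 0"
proof -
  interpret I: ideal "padic_null_sequences p" "padic_Cauchy_ring p"
    by (rule ideal_padic_null_sequences[OF p])
  have "padic_null_sequences p +>\<^bsub>padic_Cauchy_ring p\<^esub> s
      = padic_null_sequences p +>\<^bsub>padic_Cauchy_ring p\<^esub> \<zero>\<^bsub>padic_Cauchy_ring p\<^esub>"
    using I.a_rcos_const[OF assms] I.a_rcos_const[OF additive_subgroup.zero_closed[OF I.additive_subgroup_axioms]] by simp
  then show ?thesis using limit_zero unfolding limit_def by (simp add: padic_Cauchy_ring_def)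
qed

lemma Qp_eq: "Qp = limit ` {s. padic_Cauchy p s}"
  unfolding padic_field_def FactRing_def limit_def A_RCOSETS_def'
  by (auto simp: padic_Cauchy_ring_def image_iff)

lemma Zp_eq: "Zp = limit ` {s. padic_Cauchy p s \<and> (\<forall>i. padic_abs p (s i) \<le> 1)}"
proof -
  interpret I: ideal "padic_null_sequences p" "padic_Cauchy_ring p"
    by (rule ideal_padic_null_sequences[OF p])
  let ?N = "padic_null_sequences p" and ?C = "padic_Cauchy_ring p"
  have "padic_integers p = (\<lambda>s. ?N +>\<^bsub>?C\<^esub> s) ` {s. padic_Cauchy p s \<and> (\<forall>i. padic_abs p (s i) \<le> 1)}"
  proof (intro equalityI subsetI)
    fix z assume "z \<in> padic_integers p"
    then obtain s u where s: "s \<in> z" "\<forall>i. padic_abs p (s i) \<le> 1" and u: "u \<in> carrier ?C" "z = ?N +>\<^bsub>?C\<^esub> u"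
      unfolding padic_integers_def padic_field_def FactRing_def A_RCOSETS_def' by auto
    have "?N +>\<^bsub>?C\<^esub> u = ?N +>\<^bsub>?C\<^esub> s"
      using I.a_repr_independence'[of s u] s(1) u by blast
    moreover have "s \<in> carrier ?C"
      using I.a_r_coset_subset_G[OF I.a_subset u(1)] s(1) u(2) by blast
    ultimately show "z \<in> (\<lambda>s. ?N +>\<^bsub>?C\<^esub> s) ` {s. padic_Cauchy p s \<and> (\<forall>i. padic_abs p (s i) \<le> 1)}"
      using s u by (auto simp: padic_Cauchy_ring_def)
  next
    fix z assume "z \<in> (\<lambda>s. ?N +>\<^bsub>?C\<^esub> s) ` {s. padic_Cauchy p s \<and> (\<forall>i. padic_abs p (s i) \<le> 1)}"
    then obtain s where s: "padic_Cauchy p s" "\<forall>i. padic_abs p (s i) \<le> 1" "z = ?N +>\<^bsub>?C\<^esub> s" by auto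
    have sc: "s \<in> carrier ?C" using s by (simp add: padic_Cauchy_ring_def)
    have "s \<in> z" using I.a_rcos_self[OF sc] s(3) by simp
    then show "z \<in> padic_integers p"
      unfolding padic_integers_def padic_field_def FactRing_def A_RCOSETS_def' using s sc by auto
  qed
  then show ?thesis unfolding limit_def by (simp add: image_image)
qed

text \<open>The product of the two sequences is 1 from \<open>M\<close> on, so it differs from the
  constant sequence 1 by a null sequence, whatever happens at the earlier terms.\<close>

lemma limit_inverse:
  assumes s: "padic_Cauchy p s" and e: "\<epsilon> > 0" and M: "\<And>i. i \<ge> M \<Longrightarrow> padic_abs p (s i) \<ge> \<epsilon>"
  shows "limit s * limit (\<lambda>i. inverse (s i)) = 1"
proof -
  have c: "padic_Cauchy p (\<lambda>i. inverse (s i))" by (rule padic_Cauchy_inverse[OF p s e M])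
  have "(\<lambda>i. s i * inverse (s i) + (-1)) \<in> padic_null_sequences p"
    unfolding padic_null_sequences_def mem_Collect_eq
  proof (rule tendsto_eventually, unfold eventually_sequentially, intro exI allI impI)
    fix i assume "M \<le> i"
    then have "padic_abs p (s i) \<noteq> 0" using M[of i] e by auto
    then have "s i \<noteq> 0" using padic_abs_zero[OF p] by auto
    then show "padic_abs p (s i * inverse (s i) + (-1)) = 0" by (simp add: padic_abs_zero[OF p])
  qed
  then have "limit (\<lambda>i. s i * inverse (s i) + (-1)) = 0" by (rule limit_null)
  also have "limit (\<lambda>i. s i * inverse (s i) + (-1)) = limit (\<lambda>i. s i * inverse (s i)) + limit (\<lambda>i. -1)"
    by (intro limit_add padic_Cauchy_mult[OF p] s c padic_Cauchy_const[OF p])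
  also have "limit (\<lambda>i. -1) = -1" using limit_minus[OF padic_Cauchy_const[OF p, of 1]] limit_one by simp
  finally show ?thesis using limit_mult[OF s c] by simp
qed

text \<open>The linear algebra of \<open>ring.dimension\<close> asks for a subfield of scalars.
  Inverses exist because a sequence with nonzero limit is bounded away from zero.\<close>

lemma Qp_subfield: "subfield Qp (cring_class_ops :: 'k ring)"
proof (rule field.subfieldI'[OF field_class])
  show "subring Qp (cring_class_ops :: 'k ring)"
  proof (rule ring.subringI[OF cring.axioms(1)[OF cring_class]])
    show "\<one>\<^bsub>cring_class_ops\<^esub> \<in> Qp"
      unfolding Qp_eq one_class using limit_one padic_Cauchy_const[OF p] by (metis (mono_tags) image_eqI mem_Collect_eq)
    show "\<ominus>\<^bsub>cring_class_ops\<^esub> h \<in> Qp" if "h \<in> Qp" for h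
      using that padic_Cauchy_minus[OF p] limit_minus[symmetric] unfolding Qp_eq uminus_class by auto
    show "h1 \<otimes>\<^bsub>cring_class_ops\<^esub> h2 \<in> Qp" if "h1 \<in> Qp" "h2 \<in> Qp" for h1 h2
      using that padic_Cauchy_mult[OF p] limit_mult[symmetric] unfolding Qp_eq times_class by auto
    show "h1 \<oplus>\<^bsub>cring_class_ops\<^esub> h2 \<in> Qp" if "h1 \<in> Qp" "h2 \<in> Qp" for h1 h2
      using that padic_Cauchy_add[OF p] limit_add[symmetric] unfolding Qp_eq plus_class by auto
  qed (simp add: cring_class_ops_def)
  show "inv\<^bsub>cring_class_ops\<^esub> k \<in> Qp" if k: "k \<in> Qp - {\<zero>\<^bsub>cring_class_ops\<^esub>}" for k
  proof -
    obtain s where s: "padic_Cauchy p s" "k = limit s" using k unfolding Qp_eq by auto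
    have "s \<notin> padic_null_sequences p" using k s limit_null by (auto simp: zero_class)
    then obtain \<epsilon> M where e: "\<epsilon> > 0" "\<And>i. i \<ge> M \<Longrightarrow> padic_abs p (s i) \<ge> \<epsilon>"
      using padic_nonnull_bounded_below[OF p s(1)] by metis
    have "inv\<^bsub>cring_class_ops\<^esub> k = limit (\<lambda>i. inverse (s i))"
      using limit_inverse[OF s(1) e] s(2)
      by (intro cring_class.comm_inv_char) (auto simp: carrier_class)
    then show ?thesis using padic_Cauchy_inverse[OF p s(1) e] unfolding Qp_eq by auto
  qed
qed

lemma Zp_mult: "x \<in> Zp \<Longrightarrow> y \<in> Zp \<Longrightarrow> x * y \<in> Zp"
proof -
  assume "x \<in> Zp" "y \<in> Zp"
  then obtain s t where s: "padic_Cauchy p s" "\<forall>i. padic_abs p (s i) \<le> 1" "x = limit s"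
    and t: "padic_Cauchy p t" "\<forall>i. padic_abs p (t i) \<le> 1" "y = limit t"
    unfolding Zp_eq by auto
  have "padic_abs p (s i * t i) \<le> 1" for i
    using s(2) t(2) by (simp add: padic_abs_mult[OF p] mult_le_one padic_abs_nonneg[OF p])
  then show ?thesis unfolding Zp_eq
    using s t padic_Cauchy_mult[OF p s(1) t(1)] limit_mult[OF s(1) t(1)]
    by (intro image_eqI[of _ _ "\<lambda>i. s i * t i"]) auto
qed

lemma Zp_add: "x \<in> Zp \<Longrightarrow> y \<in> Zp \<Longrightarrow> x + y \<in> Zp"
proof -
  assume "x \<in> Zp" "y \<in> Zp"
  then obtain s t where s: "padic_Cauchy p s" "\<forall>i. padic_abs p (s i) \<le> 1" "x = limit s"
    and t: "padic_Cauchy p t" "\<forall>i. padic_abs p (t i) \<le> 1" "y = limit t"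
    unfolding Zp_eq by auto
  have "padic_abs p (s i + t i) \<le> 1" for i
    using s(2) t(2) padic_abs_add[OF p, of "s i" "t i"] by (meson max.bounded_iff order_trans max.boundedI)
  then show ?thesis unfolding Zp_eq
    using s t padic_Cauchy_add[OF p s(1) t(1)] limit_add[OF s(1) t(1)]
    by (intro image_eqI[of _ _ "\<lambda>i. s i + t i"]) auto
qed

lemma Zp_of_nat: "of_nat n \<in> Zp"
  unfolding Zp_eq using padic_abs_of_nat_le[OF p, of n] limit_of_nat[of n, symmetric] padic_Cauchy_const[OF p]
  by (intro image_eqI[of _ _ "\<lambda>i. of_nat n"]) auto

lemma Zp_zero: "0 \<in> Zp" and Zp_one: "1 \<in> Zp"
  using Zp_of_nat[of 0] Zp_of_nat[of 1] by auto

lemma Zp_minus: "x \<in> Zp \<Longrightarrow> - x \<in> Zp"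
proof -
  assume "x \<in> Zp"
  then obtain s where s: "padic_Cauchy p s" "\<forall>i. padic_abs p (s i) \<le> 1" "x = limit s"
    unfolding Zp_eq by auto
  then show ?thesis unfolding Zp_eq
    using limit_minus[OF s(1)] padic_Cauchy_minus[OF p s(1)] padic_abs_minus[OF p]
    by (intro image_eqI[of _ _ "\<lambda>i. - s i"]) auto
qed

lemma Zp_power: "x \<in> Zp \<Longrightarrow> x ^ n \<in> Zp"
  by (induction n) (auto simp: Zp_one Zp_mult)

lemma of_nat_p_nonzero: "of_nat p \<noteq> (0::'k)"
proof -
  have "limit (\<lambda>i. of_nat p) * limit (\<lambda>i. inverse (of_nat p)) = 1"
    using padic_abs_p[OF p] p prime_gt_0_nat
    by (intro limit_inverse[where \<epsilon> = "1 / real p" and M = 0] padic_Cauchy_const[OF p]) auto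
  then show ?thesis using limit_of_nat by auto
qed

text \<open>A Cauchy sequence is bounded, and \<open>p ^ N\<close> divides absolute values by
  \<open>real p ^ N\<close>, which eventually exceeds the bound.\<close>

lemma Qp_scale_Zp:
  assumes "z \<in> Qp"
  shows "\<exists>N. of_nat p ^ N * z \<in> Zp"
proof -
  obtain s where s: "padic_Cauchy p s" "z = limit s" using assms unfolding Qp_eq by auto
  obtain B where B: "B > 0" "\<And>i. padic_abs p (s i) \<le> B" using padic_Cauchy_bounded[OF p s(1)] by auto
  obtain N where N: "B < real p ^ N" using real_arch_pow[of "real p" B] p_gt_1[OF p] by auto
  let ?t = "\<lambda>i. of_nat (p ^ N) * s i"
  have "padic_abs p (?t i) \<le> 1" for i
  proof -
    have "padic_abs p (?t i) = padic_abs p (s i) / real p ^ N"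
      using padic_abs_p_power[OF p, of N] by (simp add: padic_abs_mult[OF p])
    also have "\<dots> \<le> 1" using B(2)[of i] N p_pos[OF p] by (simp add: field_simps)
    finally show ?thesis .
  qed
  moreover have "padic_Cauchy p ?t" by (intro padic_Cauchy_mult[OF p] padic_Cauchy_const[OF p] s)
  moreover have "limit ?t = of_nat p ^ N * z"
    using limit_mult[OF padic_Cauchy_const[OF p] s(1), of "of_nat (p ^ N)"] limit_of_nat[of "p ^ N"] s(2)
    by simp
  ultimately have "of_nat p ^ N * z \<in> Zp" unfolding Zp_eq by (intro image_eqI[of _ _ ?t]) auto
  then show ?thesis by blast
qed

text \<open>The residue of one sufficiently late term \<open>s N\<close> is the residue of all later
  terms, since these differ from it by less than \<open>1 / p\<close>. Thus every p-adic integer is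
  congruent modulo \<open>p\<close> to one of \<open>0, ..., p - 1\<close>.\<close>

lemma Zp_residue:
  assumes "z \<in> Zp"
  shows "\<exists>j<p. \<exists>w\<in>Zp. z = of_nat j + of_nat p * w"
proof -
  obtain s where s: "padic_Cauchy p s" "\<forall>i. padic_abs p (s i) \<le> 1" "z = limit s"
    using assms unfolding Zp_eq by auto
  have "1 / real p > 0" using p_pos[OF p] by simp
  then obtain N where N: "\<And>i j. i \<ge> N \<Longrightarrow> j \<ge> N \<Longrightarrow> padic_abs p (s i - s j) < 1 / real p"
    using s(1) unfolding padic_Cauchy_def by metis
  obtain j where j: "j < p" "padic_abs p (s N - of_nat j) \<le> 1 / real p"
    using padic_integral_rat_residue[OF p] s(2) by blast
  have close: "padic_abs p (s i - of_nat j) \<le> 1 / real p" if "i \<ge> N" for i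
    using padic_abs_add[OF p, of "s i - s N" "s N - of_nat j"] N[OF that order_refl] j(2) by simp
  \<comment> \<open>The description of \<open>Zp\<close> asks for absolute value at most 1 at every
    index, but only the terms from \<open>N\<close> on are close to \<open>j\<close>. The earlier
    ones are replaced by 0, which changes the sequence by a null sequence.\<close>
  let ?u = "\<lambda>i. if i < N then 0 else (s i + - of_nat j) * inverse (of_nat p)"
  let ?u' = "\<lambda>i. (s i + - of_nat j) * inverse (of_nat p)"
  have pa: "padic_abs p (inverse (of_nat p)) = real p"
    using padic_abs_p[OF p] by (simp add: padic_abs_inverse[OF p])
  have p0: "of_nat p \<noteq> (0::rat)" using p prime_gt_0_nat by simp
  have "padic_abs p (?u i) \<le> 1" for i
  proof (cases "i < N")
    case False
    then have "padic_abs p (?u i) = padic_abs p (s i - of_nat j) * real p"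
      using padic_abs_mult[OF p, of "s i - of_nat j" "inverse (of_nat p)"] pa by simp
    also have "\<dots> \<le> 1" using close[of i] False p_pos[OF p] by (simp add: field_simps)
    finally show ?thesis .
  qed (simp add: padic_abs_zero[OF p])
  moreover have u': "padic_Cauchy p ?u'"
    by (intro padic_Cauchy_mult[OF p] padic_Cauchy_add[OF p] padic_Cauchy_const[OF p] s)
  have null: "(\<lambda>i. ?u i + - ?u' i) \<in> padic_null_sequences p"
    unfolding padic_null_sequences_def mem_Collect_eq
    by (rule tendsto_eventually, unfold eventually_sequentially, intro exI[of _ N])
      (auto simp: padic_abs_zero[OF p])
  have "?u = (\<lambda>i. (?u i + - ?u' i) + ?u' i)" by auto
  moreover have "padic_Cauchy p (\<lambda>i. (?u i + - ?u' i) + ?u' i)"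
    by (intro padic_Cauchy_add[OF p] u' padic_null_sequence_Cauchy[OF p null])
  ultimately have u: "padic_Cauchy p ?u" by simp
  have "limit ?u + - limit ?u' = 0"
    using limit_null[OF null] limit_add[OF u padic_Cauchy_minus[OF p u']] limit_minus[OF u'] by simp
  then have uu: "limit ?u = limit ?u'" by simp
  have "of_nat p * limit ?u' = limit (\<lambda>i. of_nat p * ?u' i)"
    using limit_mult[OF padic_Cauchy_const[OF p] u', of "of_nat p"] limit_of_nat[of p] by simp
  also have "(\<lambda>i. of_nat p * ?u' i) = (\<lambda>i. s i + - of_nat j)" using p0 by (auto simp: field_simps)
  also have "limit \<dots> = z + - of_nat j"
    using limit_add[OF s(1) padic_Cauchy_const[OF p, of "- of_nat j"]] s(3)
      limit_minus[OF padic_Cauchy_const[OF p, of "of_nat j"]] limit_of_nat[of j] by simp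
  finally have "z = of_nat j + of_nat p * limit ?u" using uu by simp
  moreover have "limit ?u \<in> Zp" unfolding Zp_eq using u \<open>\<And>i. padic_abs p (?u i) \<le> 1\<close> by (intro imageI) simp
  ultimately show ?thesis using j(1) by blast
qed

text \<open>Every term of \<open>1 + p * s i\<close> has absolute value at least 1, so the limit is
  invertible. This is the fact that keeps \<open>1 / p\<close> out of the integral closure.\<close>

lemma Zp_one_plus_p_nonzero:
  assumes "z \<in> Zp"
  shows "1 + of_nat p * z \<noteq> 0"
proof -
  obtain s where s: "padic_Cauchy p s" "\<forall>i. padic_abs p (s i) \<le> 1" "z = limit s"
    using assms unfolding Zp_eq by auto
  let ?u = "\<lambda>i. 1 + of_nat p * s i"
  have u: "padic_Cauchy p ?u" by (intro padic_Cauchy_mult[OF p] padic_Cauchy_add[OF p] padic_Cauchy_const[OF p] s)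
  have "padic_abs p (?u i) \<ge> 1" for i
  proof -
    have "padic_abs p (of_nat p * s i) < 1"
    proof -
      have "padic_abs p (of_nat p * s i) = padic_abs p (s i) / real p" by (simp add: padic_abs_mult[OF p] padic_abs_p[OF p])
      also have "\<dots> \<le> 1 / real p" using s(2) p_pos[OF p] by (simp add: divide_right_mono)
      also have "\<dots> < 1" using p_gt_1[OF p] by simp
      finally show ?thesis .
    qed
    then show ?thesis
      using padic_abs_add[OF p, of "?u i" "- (of_nat p * s i)"] padic_abs_one[OF p]
        padic_abs_minus[OF p, of "of_nat p * s i"] by simp
  qed
  then have "limit ?u * limit (\<lambda>i. inverse (?u i)) = 1"
    by (intro limit_inverse[where \<epsilon> = 1 and M = 0] u) auto
  then have "limit ?u \<noteq> 0" by auto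
  moreover have "limit ?u = 1 + of_nat p * z"
    using limit_add[OF padic_Cauchy_const[OF p] padic_Cauchy_mult[OF p padic_Cauchy_const[OF p] s(1)], of 1 "of_nat p"]
      limit_mult[OF padic_Cauchy_const[OF p] s(1), of "of_nat p"] limit_one limit_of_nat[of p] s(3) by simp
  ultimately show ?thesis by simp
qed

end

section \<open>Rings of integers\<close>

lemma (in ring) ideal_Union_chain:
  assumes "C \<noteq> {}" and I: "\<And>I. I \<in> C \<Longrightarrow> ideal I R" and chain: "\<And>I J. I \<in> C \<Longrightarrow> J \<in> C \<Longrightarrow> I \<subseteq> J \<or> J \<subseteq> I"
  shows "ideal (\<Union>C) R"
proof (rule idealI[OF ring_axioms])
  have sub: "subgroup I (add_monoid R)" if "I \<in> C" for I
    using I[OF that] by (rule additive_subgroup.a_subgroup[OF ideal.axioms(1)])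
  show "subgroup (\<Union>C) (add_monoid R)"
  proof (rule add.subgroupI)
    show "\<Union>C \<subseteq> carrier R" using subgroup.subset[OF sub] by auto
    show "\<Union>C \<noteq> {}" using \<open>C \<noteq> {}\<close> subgroup.one_closed[OF sub] by fastforce
    show "\<ominus> x \<in> \<Union>C" if "x \<in> \<Union>C" for x
      using that additive_subgroup.a_inv_closed[OF ideal.axioms(1)[OF I]] by blast
    fix x y assume "x \<in> \<Union>C" "y \<in> \<Union>C"
    then obtain I1 I2 where C: "I1 \<in> C" "I2 \<in> C" and xy: "x \<in> I1" "y \<in> I2" by blast
    from chain[OF C] obtain K where "K \<in> C" "x \<in> K" "y \<in> K" using C xy by blast
    then show "x \<oplus> y \<in> \<Union>C"
      using additive_subgroup.a_closed[OF ideal.axioms(1)[OF I]] by blast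
  qed
  show "x \<otimes> a \<in> \<Union>C" "a \<otimes> x \<in> \<Union>C" if a: "a \<in> \<Union>C" and x: "x \<in> carrier R" for a x
    using a ideal.I_l_closed[OF I _ x] ideal.I_r_closed[OF I _ x] by blast+
qed

text \<open>Krull's theorem, by Zorn's lemma on the ideals above \<open>J\<close> that avoid
  \<open>\<one>\<close>. It converts the uniqueness of the maximal ideal of the ring of integers
  into a criterion for units.\<close>

lemma (in ring) exists_maximalideal:
  assumes J: "ideal J R" and "\<one> \<notin> J"
  shows "\<exists>M. maximalideal M R \<and> J \<subseteq> M"
proof -
  let ?F = "{I. ideal I R \<and> J \<subseteq> I \<and> \<one> \<notin> I}"
  have "\<exists>M\<in>?F. \<forall>X\<in>?F. M \<subseteq> X \<longrightarrow> X = M"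
  proof (rule subset_Zorn_nonempty)
    show "?F \<noteq> {}" using assms by auto
    fix C assume C: "C \<noteq> {}" "subset.chain ?F C"
    then have CF: "C \<subseteq> ?F" and chain: "\<And>X Y. X \<in> C \<Longrightarrow> Y \<in> C \<Longrightarrow> X \<subseteq> Y \<or> Y \<subseteq> X"
      unfolding subset_chain_def by simp_all
    have "ideal (\<Union>C) R" using CF by (intro ideal_Union_chain[OF C(1) _ chain]) auto
    then show "\<Union>C \<in> ?F" using CF C(1) by auto
  qed
  then obtain M where M: "ideal M R" "J \<subseteq> M" "\<one> \<notin> M" and max: "\<And>X. X \<in> ?F \<Longrightarrow> M \<subseteq> X \<Longrightarrow> X = M"
    by auto
  have "maximalideal M R"
  proof (rule maximalidealI[OF M(1)])
    show "carrier R \<noteq> M" using M(3) by blast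
    fix I assume I: "ideal I R" "M \<subseteq> I" "I \<subseteq> carrier R"
    show "I = M \<or> I = carrier R"
    proof (cases "\<one> \<in> I")
      case True
      then show ?thesis using ideal.one_imp_carrier[OF I(1)] by blast
    next
      case False
      then show ?thesis using max[of I] I M(2) by blast
    qed
  qed
  then show ?thesis using M(2) by blast
qed

text \<open>Each dimension step adjoins a vector \<open>v\<close> outside \<open>E\<close>, so that
  \<open>(k, e)\<close> is determined by \<open>k v + e\<close> and the cardinality is multiplied by
  that of \<open>K\<close>.\<close>

lemma (in ring) card_dimension:
  assumes K: "subfield K R" and fin: "finite K" and "dimension n K E"
  shows "finite E \<and> card E = card K ^ n"
  using assms(3) K fin
proof (induction n K E rule: dimension.induct)
  case (Suc_dim v E n K)
  let ?h = "\<lambda>(k, e). k \<otimes> v \<oplus> e"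
  note K = Suc_dim.prems(1)
  note sub = subfieldE(3)[OF K]
  note E = space_subgroup_props[OF K Suc_dim.hyps(3)]
  have "line_extension K v E = ?h ` (K \<times> E)"
    by (auto simp: line_extension_mem_iff image_iff) blast
  moreover have "inj_on ?h (K \<times> E)"
  proof (rule inj_onI, clarify)
    fix k e l g assume k: "k \<in> K" "l \<in> K" and e: "e \<in> E" "g \<in> E"
      and eq: "k \<otimes> v \<oplus> e = l \<otimes> v \<oplus> g"
    have c: "k \<in> carrier R" "l \<in> carrier R" "e \<in> carrier R" "g \<in> carrier R"
      using k e sub E(1) by auto
    have "(k \<ominus> l) \<otimes> v = (k \<otimes> v \<oplus> e) \<ominus> (l \<otimes> v) \<ominus> e"
      using c Suc_dim.hyps(1) by algebra
    also have "\<dots> = g \<ominus> e" unfolding eq using c Suc_dim.hyps(1) by algebra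
    finally have kl: "(k \<ominus> l) \<otimes> v = g \<oplus> \<ominus> e" by (simp add: a_minus_def)
    have "k = l"
    proof (rule ccontr)
      assume "k \<noteq> l"
      then have "k \<ominus> l \<noteq> \<zero>" using c by simp
      moreover have "k \<ominus> l \<in> K"
        using k subringE(5,7)[OF subfieldE(1)[OF K]] unfolding a_minus_def by auto
      ultimately have "v \<in> E"
        using E(6)[of "k \<ominus> l" v] Suc_dim.hyps(1) kl E(3)[OF e(2) E(4)[OF e(1)]] by auto
      with Suc_dim.hyps(2) show False by blast
    qed
    moreover from this eq have "e = g" using c Suc_dim.hyps(1) by simp
    ultimately show "k = l \<and> e = g" by blast
  qed
  ultimately show ?case
    using Suc_dim.IH Suc_dim.prems by (simp add: card_image card_cartesian_product)
qed auto

text \<open>Multiplication by a nonzero element is injective on the finite set \<open>F\<close>,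
  hence surjective, and so reaches \<open>\<one>\<close>. It is meant for the image of the p-adic
  integers in the residue field.\<close>

lemma (in field) finite_subring_is_subfield:
  assumes F: "subring F R" and fin: "finite F"
  shows "subfield F R"
proof (rule subfieldI'[OF F])
  fix a assume a: "a \<in> F - {\<zero>}"
  have sub: "F \<subseteq> carrier R" by (rule subringE(1)[OF F])
  have ac: "a \<in> carrier R" "a \<noteq> \<zero>" using a sub by auto
  have "inj_on (\<lambda>b. a \<otimes> b) F"
  proof (rule inj_onI)
    fix x y assume "x \<in> F" "y \<in> F" "a \<otimes> x = a \<otimes> y"
    then show "x = y" using m_lcancel[OF ac(2,1), of x y] sub by blast
  qed
  moreover have "(\<lambda>b. a \<otimes> b) ` F \<subseteq> F" using a subringE(6)[OF F] by blast
  ultimately have "(\<lambda>b. a \<otimes> b) ` F = F" by (rule endo_inj_surj[OF fin, rotated])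
  then have "\<one> \<in> (\<lambda>b. a \<otimes> b) ` F" using subringE(3)[OF F] by simp
  then obtain b where b: "\<one> = a \<otimes> b" "b \<in> F" by (rule imageE)
  have "inv a = b"
    by (rule comm_inv_char[OF ac(1) subsetD[OF sub b(2)] b(1)[symmetric]])
  then show "inv a \<in> F" using b(2) by simp
qed

section \<open>The ring of integers as a local ring with finite residue field\<close>

locale extension_integers = padic_extension_field p d \<iota>
    for p d :: nat and \<iota> :: "(nat \<Rightarrow> rat) set \<Rightarrow> 'k::field" +
  fixes R :: "'k ring" and \<pi> :: 'k and e f :: nat
  assumes R_def: "R = ring_of_integers p \<iota>"
    and unif: "uniformizer R \<pi>"
    and ram: "ramification_index p R \<pi> e"
    and inert: "inertia_degree p \<iota> \<pi> f"
begin

abbreviation A :: "'k set" where "A \<equiv> carrier R"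

lemma R_eq: "R = cring_class_ops\<lparr>carrier := A\<rparr>"
  unfolding R_def ring_of_integers_def by simp

lemma R_ops [simp]: "x \<oplus>\<^bsub>R\<^esub> y = x + y" "x \<otimes>\<^bsub>R\<^esub> y = x * y" "\<one>\<^bsub>R\<^esub> = 1" "\<zero>\<^bsub>R\<^esub> = 0"
  by (subst R_eq, simp add: cring_class_ops_def)+

lemma PIdl_R: "PIdl\<^bsub>R\<^esub> a = {r * a |r. r \<in> A}"
  unfolding cgenideal_def by simp

lemma maximalideal_pi: "maximalideal (PIdl\<^bsub>R\<^esub> \<pi>) R"
  using unif unfolding uniformizer_def by blast

text \<open>The ring axioms are contained in the predicate \<open>maximalideal\<close>, which the
  uniformizer provides. Closure of the integral elements under sums and products is read off from
  there.\<close>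

lemma ring_R: "ring R"
  by (rule ideal.axioms(2)[OF maximalideal.axioms(1)[OF maximalideal_pi]])

lemma cring_R: "cring R"
proof -
  interpret ring R by (rule ring_R)
  show ?thesis
    by (intro cring.intro ring_R comm_monoid.intro comm_monoid_axioms.intro is_monoid) auto
qed

lemma pi_in: "\<pi> \<in> A"
  using unif unfolding uniformizer_def by blast

lemma A_one: "1 \<in> A" and A_zero: "0 \<in> A"
  using ring.ring_simprules(6)[OF ring_R] ring.ring_simprules(2)[OF ring_R] by auto

lemma A_add: "x \<in> A \<Longrightarrow> y \<in> A \<Longrightarrow> x + y \<in> A"
  using ring.ring_simprules(1)[OF ring_R, of x y] by simp

lemma A_mult: "x \<in> A \<Longrightarrow> y \<in> A \<Longrightarrow> x * y \<in> A"
  using ring.ring_simprules(5)[OF ring_R, of x y] by simp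

lemma R_minus: "x \<in> A \<Longrightarrow> \<ominus>\<^bsub>R\<^esub> x = - x"
  using ring.ring_simprules(9)[OF ring_R, of x] by (simp add: eq_neg_iff_add_eq_0)

lemma A_uminus: "x \<in> A \<Longrightarrow> - x \<in> A"
  using ring.ring_simprules(3)[OF ring_R, of x] R_minus by simp

lemma A_diff: "x \<in> A \<Longrightarrow> y \<in> A \<Longrightarrow> x - y \<in> A"
  using A_add[of x "- y"] A_uminus by simp

lemma A_power: "x \<in> A \<Longrightarrow> x ^ n \<in> A"
  by (induction n) (auto simp: A_one A_mult)

lemma reduction_eq_iff:
  assumes "a \<in> A" "x \<in> A" "y \<in> A"
  shows "reduction R a x = reduction R a y \<longleftrightarrow> (\<exists>r\<in>A. x - y = r * a)"
proof -
  interpret cring R by (rule cring_R)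
  have "x \<ominus>\<^bsub>R\<^esub> y = x - y" using assms by (simp add: a_minus_def R_minus)
  then show ?thesis
    unfolding reduction_def
    using quotient_eq_iff_same_a_r_cos[OF cgenideal_ideal[OF assms(1)] assms(2,3)]
    by (auto simp: PIdl_R)
qed

lemma one_notin_pi: "1 \<noteq> r * \<pi>" if "r \<in> A"
proof
  assume 1: "1 = r * \<pi>"
  interpret maximalideal "PIdl\<^bsub>R\<^esub> \<pi>" R by (rule maximalideal_pi)
  have "\<one>\<^bsub>R\<^esub> \<in> PIdl\<^bsub>R\<^esub> \<pi>" unfolding PIdl_R R_ops using that 1 by blast
  then show False using one_imp_carrier I_notcarr by blast
qed

text \<open>The ring is local: a non-unit lies in some maximal ideal, and the only one is generated
  by \<open>\<pi>\<close>.\<close>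

lemma unit_if_not_pi_multiple:
  assumes x: "x \<in> A" and ndvd: "\<And>r. r \<in> A \<Longrightarrow> x \<noteq> r * \<pi>"
  shows "inverse x \<in> A"
proof (rule ccontr)
  assume "inverse x \<notin> A"
  interpret cring R by (rule cring_R)
  have x0: "x \<noteq> 0" using ndvd[OF A_zero] by auto
  have "\<one>\<^bsub>R\<^esub> \<notin> PIdl\<^bsub>R\<^esub> x"
  proof
    assume "\<one>\<^bsub>R\<^esub> \<in> PIdl\<^bsub>R\<^esub> x"
    then obtain r where "r \<in> A" "x * r = 1" unfolding PIdl_R R_ops by (auto simp: mult.commute)
    then have "inverse x = r" by (simp add: inverse_unique)
    with \<open>r \<in> A\<close> \<open>inverse x \<notin> A\<close> show False by simp
  qed
  then obtain M where M: "maximalideal M R" "PIdl\<^bsub>R\<^esub> x \<subseteq> M"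
    using exists_maximalideal[OF cgenideal_ideal[OF x]] by blast
  then have "M = PIdl\<^bsub>R\<^esub> \<pi>" using unif unfolding uniformizer_def by blast
  moreover have "x \<in> PIdl\<^bsub>R\<^esub> x" unfolding PIdl_R using A_one by force
  ultimately have "x \<in> PIdl\<^bsub>R\<^esub> \<pi>" using M by blast
  then show False using ndvd by (auto simp: PIdl_R)
qed

lemma A_iff: "x \<in> A \<longleftrightarrow> (\<exists>P. lead_coeff P = 1 \<and> (\<forall>i. Polynomial.coeff P i \<in> Zp) \<and> poly P x = 0)"
  unfolding R_def ring_of_integers_def by simp

text \<open>Together with \<open>A_E\<close> this trades monic polynomials for explicit sums, in
  which equations can be rescaled by powers of \<open>p\<close> term by term.\<close>

lemma A_I:
  assumes c: "\<And>i. i < r \<Longrightarrow> c i \<in> Zp" and eq: "x ^ r + (\<Sum>i<r. c i * x ^ i) = 0"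
  shows "x \<in> A"
proof -
  define P where "P = Polynomial.monom 1 r + (\<Sum>i<r. Polynomial.monom (c i) i)"
  have co: "Polynomial.coeff P j = (if j = r then 1 else if j < r then c j else 0)" for j
    unfolding P_def by (auto simp: coeff_sum)
  have "degree P = r" by (rule antisym) (auto intro!: degree_le le_degree simp: co)
  then have "lead_coeff P = 1" by (simp add: co)
  moreover have "Polynomial.coeff P i \<in> Zp" for i using c Zp_zero Zp_one by (auto simp: co)
  moreover have "poly P x = 0" unfolding P_def using eq by (simp add: poly_sum poly_monom)
  ultimately show ?thesis unfolding A_iff by blast
qed

lemma A_E:
  assumes "x \<in> A"
  obtains r c where "\<And>i. c i \<in> Zp" "x ^ r + (\<Sum>i<r. c i * x ^ i) = 0"
proof -
  obtain P where P: "lead_coeff P = 1" "\<And>i. Polynomial.coeff P i \<in> Zp" "poly P x = 0"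
    using assms unfolding A_iff by blast
  have "(\<Sum>i\<le>degree P. Polynomial.coeff P i * x ^ i) = 0" using P(3) by (simp add: poly_altdef)
  then have "x ^ degree P + (\<Sum>i<degree P. Polynomial.coeff P i * x ^ i) = 0"
    using P(1) by (simp add: lessThan_Suc_atMost[symmetric] add.commute)
  then show thesis using that P(2) by blast
qed

lemma Zp_subset_A: "z \<in> Zp \<Longrightarrow> z \<in> A"
  using A_I[of 1 "\<lambda>_. - z" z] Zp_minus by simp

lemma A_of_nat: "of_nat n \<in> A"
  by (rule Zp_subset_A[OF Zp_of_nat])

text \<open>Multiplying an integral equation for \<open>1 / p\<close> of degree \<open>r\<close> by
  \<open>p ^ r\<close> leaves \<open>1 + p * z = 0\<close> with \<open>z\<close> a p-adic
  integer.\<close>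

lemma inverse_p_notin: "inverse (of_nat p) \<notin> A"
proof
  let ?p = "of_nat p :: 'k"
  assume "inverse ?p \<in> A"
  then obtain r c where c: "\<And>i. c i \<in> Zp" and eq: "inverse ?p ^ r + (\<Sum>i<r. c i * inverse ?p ^ i) = 0"
    by (rule A_E) auto
  note p0 = of_nat_p_nonzero
  have fin: "(\<Sum>i\<in>I. c i * ?p ^ (r - i - 1)) \<in> Zp" if "finite I" for I
    using that by (induction I) (auto intro!: Zp_zero Zp_add Zp_mult c Zp_power Zp_of_nat)
  have "1 + ?p * (\<Sum>i<r. c i * ?p ^ (r - i - 1)) = ?p ^ r * (inverse ?p ^ r + (\<Sum>i<r. c i * inverse ?p ^ i))"
  proof -
    have "?p * (\<Sum>i<r. c i * ?p ^ (r - i - 1)) = ?p ^ r * (\<Sum>i<r. c i * inverse ?p ^ i)"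
      unfolding sum_distrib_left
    proof (rule sum.cong[OF refl])
      fix i assume "i \<in> {..<r}"
      then have "Suc (r - i - 1) + i = r" by simp
      moreover have "?p ^ (Suc (r - i - 1) + i) = ?p * ?p ^ (r - i - 1) * ?p ^ i"
        by (simp only: power_add power_Suc)
      ultimately have "?p ^ r = ?p * ?p ^ (r - i - 1) * ?p ^ i" by simp
      then show "?p * (c i * ?p ^ (r - i - 1)) = ?p ^ r * (c i * inverse ?p ^ i)"
        using p0 by (simp add: field_simps)
    qed
    then show ?thesis using p0 by (simp add: algebra_simps flip: power_mult_distrib)
  qed
  then show False using eq Zp_one_plus_p_nonzero[OF fin[of "{..<r}"]] by simp
qed

lemma p_pi_assoc:
  obtains r s where "r \<in> A" "s \<in> A" "of_nat p = r * \<pi> ^ e" "\<pi> ^ e = s * of_nat p"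
proof -
  have eq: "PIdl\<^bsub>R\<^esub> (of_nat p) = PIdl\<^bsub>R\<^esub> (\<pi> ^ e)" using ram unfolding ramification_index_def .
  have "of_nat p \<in> PIdl\<^bsub>R\<^esub> (of_nat p)" "\<pi> ^ e \<in> PIdl\<^bsub>R\<^esub> (\<pi> ^ e)" unfolding PIdl_R using A_one by force+
  then have "of_nat p \<in> PIdl\<^bsub>R\<^esub> (\<pi> ^ e)" "\<pi> ^ e \<in> PIdl\<^bsub>R\<^esub> (of_nat p)" unfolding eq by auto
  then show thesis using that unfolding PIdl_R by blast
qed

text \<open>For \<open>e = 0\<close> the ideals generated by \<open>p\<close> and by 1 would
  coincide, and \<open>1 / p\<close> would be integral. This turns \<open>m \<ge> e\<close> into
  \<open>m \<ge> 1\<close>, the form in which the matrix arguments use it.\<close>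

lemma e_pos: "e \<ge> 1"
proof (rule ccontr)
  assume "\<not> e \<ge> 1"
  obtain r s where "s \<in> A" "\<pi> ^ e = s * of_nat p" using p_pi_assoc by blast
  then have "inverse (of_nat p) = s" using \<open>\<not> e \<ge> 1\<close> of_nat_p_nonzero by (simp add: field_simps not_less_eq_eq)
  with \<open>s \<in> A\<close> inverse_p_notin show False by simp
qed

lemma pi_nonzero: "\<pi> \<noteq> 0"
proof
  assume "\<pi> = 0"
  obtain r where "of_nat p = r * \<pi> ^ e" using p_pi_assoc by blast
  then show False using \<open>\<pi> = 0\<close> e_pos of_nat_p_nonzero by (simp add: power_0_left split: if_splits)
qed

lemma p_pi_multiple: "\<exists>r\<in>A. of_nat p = r * \<pi>"
proof -
  obtain r where r: "r \<in> A" "of_nat p = r * \<pi> ^ e" using p_pi_assoc by blast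
  have "\<pi> ^ e = \<pi> ^ (e - 1) * \<pi>" using e_pos by (cases e) auto
  then show ?thesis using r A_mult[OF r(1) A_power[OF pi_in, of "e - 1"]]
    by (intro bexI[of _ "r * \<pi> ^ (e - 1)"]) (auto simp: mult.assoc)
qed

text \<open>A Bezout identity for \<open>j\<close> and \<open>p\<close> would put 1 into the ideal
  of \<open>\<pi>\<close>, because \<open>p\<close> lies in it. The lemma separates the residues
  \<open>0, ..., p - 1\<close> and makes \<open>2\<close> and \<open>n\<close> units.\<close>

lemma small_nat_not_pi_multiple:
  assumes "0 < j" "j < p" "r \<in> A"
  shows "of_nat j \<noteq> r * \<pi>"
proof
  assume eq: "of_nat j = r * \<pi>"
  have "\<not> p dvd j" using assms nat_dvd_not_less by blast
  then have "coprime (int j) (int p)"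
    using p prime_imp_coprime coprime_commute by (metis coprime_int_iff)
  then obtain u v where uv: "u * int j + v * int p = 1"
    using bezout_int[of "int j" "int p"] by (auto simp: coprime_iff_gcd_eq_1)
  obtain s where s: "s \<in> A" "of_nat p = s * \<pi>" using p_pi_multiple by blast
  have int_in: "of_int z \<in> A" for z
    using A_of_nat[of "nat z"] A_uminus[OF A_of_nat[of "nat (- z)"]] by (cases "z \<ge> 0") auto
  have "1 = of_int (u * int j + v * int p)" unfolding uv by simp
  also have "\<dots> = (of_int u * r + of_int v * s) * \<pi>" using eq s(2) by (simp add: algebra_simps)
  finally show False
    using one_notin_pi[of "of_int u * r + of_int v * s"] A_add A_mult int_in assms(3) s(1) by blast
qed

lemma combine_class:
  "length Ks = length Us \<Longrightarrow> ring.combine (cring_class_ops :: 'k ring) Ks Us = (\<Sum>i<length Ks. Ks ! i * Us ! i)"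
proof (induction Ks Us rule: list_induct2)
  case Nil
  show ?case by (simp add: ring.combine.simps[OF cring.axioms(1)[OF cring_class]] zero_class)
next
  case (Cons k Ks u Us)
  then show ?case
    by (simp add: ring.combine.simps[OF cring.axioms(1)[OF cring_class]] plus_class times_class
        sum.lessThan_Suc_shift del: sum.lessThan_Suc)
qed

text \<open>The \<open>d + 1\<close> powers \<open>1, y, ..., y^d\<close> are linearly dependent
  over \<open>Qp\<close>. A normalised relation \<open>y^r + \<Sum> b_i y^i = 0\<close> multiplied
  by \<open>p^(M r)\<close> becomes a monic relation for \<open>p^M y\<close> with coefficients
  \<open>p^(M (r - i)) b_i\<close>, which are p-adic integers for large \<open>M\<close>.\<close>

lemma p_multiple_integral: "\<exists>N. of_nat p ^ N * y \<in> A" for y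
proof -
  note ring_class = cring.axioms(1)[OF cring_class[where 'a = 'k]]
  let ?p = "of_nat p :: 'k"
  have dim: "ring.dimension (cring_class_ops :: 'k ring) d Qp UNIV" using ext unfolding padic_extension_def by blast
  let ?Us = "map (\<lambda>i. y ^ i) [0..<Suc d]"
  have "\<not> ring.independent (cring_class_ops :: 'k ring) Qp ?Us"
    using ring.independent_length_le_dimension[OF ring_class Qp_subfield dim, of ?Us] by auto
  then obtain Ks where Ks: "length Ks = length ?Us" "ring.combine cring_class_ops Ks ?Us = \<zero>\<^bsub>cring_class_ops\<^esub>"
      "set Ks \<subseteq> Qp" "set Ks \<noteq> {\<zero>\<^bsub>cring_class_ops\<^esub>}"
    using ring.dependent_imp_non_trivial_combine[OF ring_class Qp_subfield, of ?Us] carrier_class by blast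
  have len: "length Ks = Suc d" using Ks(1) by simp
  have sum: "(\<Sum>i<Suc d. Ks ! i * y ^ i) = 0"
    using Ks(2) combine_class[OF Ks(1)] by (simp add: zero_class len nth_append del: upt_Suc)
  define I where "I = {i. i < Suc d \<and> Ks ! i \<noteq> 0}"
  have "I \<noteq> {}"
  proof
    assume "I = {}"
    then have "set Ks \<subseteq> {0}" unfolding I_def using len by (auto simp: in_set_conv_nth)
    then show False using Ks(4) len by (cases Ks) (auto simp: zero_class)
  qed
  moreover have "finite I" unfolding I_def by auto
  \<comment> \<open>The highest index with a nonzero coefficient; division by that coefficient makes
    the relation monic.\<close>
  moreover define r where "r = Max I"
  ultimately have r: "r \<in> I" and rmax: "\<And>i. i \<in> I \<Longrightarrow> i \<le> r" by auto
  have "(\<Sum>i<Suc d. Ks ! i * y ^ i) = (\<Sum>i<Suc r. Ks ! i * y ^ i)"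
    using r rmax unfolding I_def by (intro sum.mono_neutral_right) force+
  then have sum': "Ks ! r * y ^ r + (\<Sum>i<r. Ks ! i * y ^ i) = 0" using sum by (simp add: add.commute)
  have r0: "Ks ! r \<noteq> 0" and rd: "r < Suc d" using r unfolding I_def by auto
  have Kq: "Ks ! i \<in> Qp" if "i < Suc d" for i using Ks(3) that len nth_mem[of i Ks] by auto
  define b where "b i = Ks ! i * inverse (Ks ! r)" for i
  have b: "b i \<in> Qp" if "i < r" for i
  proof -
    have iq: "inv\<^bsub>cring_class_ops\<^esub> (Ks ! r) \<in> Qp"
      using ring.subfield_m_inv(1)[OF ring_class Qp_subfield, of "Ks ! r"] Kq[OF rd] r0 by (simp add: zero_class)
    have "inv\<^bsub>cring_class_ops\<^esub> (Ks ! r) = inverse (Ks ! r)"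
      using r0 by (intro cring_class.comm_inv_char) (auto simp: carrier_class)
    then show ?thesis
      using iq subringE(6)[OF subfieldE(1)[OF Qp_subfield] Kq iq, of i] that rd
      unfolding b_def by (simp add: times_class)
  qed
  have eq: "y ^ r + (\<Sum>i<r. b i * y ^ i) = 0"
  proof -
    have "inverse (Ks ! r) * (Ks ! r * y ^ r + (\<Sum>i<r. Ks ! i * y ^ i)) = y ^ r + (\<Sum>i<r. b i * y ^ i)"
      using r0 unfolding b_def by (simp add: distrib_left sum_distrib_left mult_ac)
    then show ?thesis using sum' by simp
  qed
  have "\<forall>i. \<exists>N. i < r \<longrightarrow> ?p ^ N * b i \<in> Zp" using Qp_scale_Zp b by blast
  then obtain N where N: "\<And>i. i < r \<Longrightarrow> ?p ^ N i * b i \<in> Zp" by metis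
  \<comment> \<open>The sum serves as a common upper bound of all the exponents
    \<open>N i\<close>.\<close>
  define M where "M = (\<Sum>i<r. N i)"
  have M: "?p ^ M * b i \<in> Zp" if "i < r" for i
  proof -
    have "N i \<le> M" unfolding M_def using that by (intro member_le_sum) auto
    then have "?p ^ M * b i = ?p ^ (M - N i) * (?p ^ N i * b i)"
      by (simp flip: power_add mult.assoc)
    then show ?thesis using Zp_mult[OF Zp_power[OF Zp_of_nat] N[OF that]] by metis
  qed
  have "?p ^ M * y \<in> A"
  proof (rule A_I[where r = r and c = "\<lambda>i. ?p ^ (M * (r - i)) * b i"])
    show "?p ^ (M * (r - i)) * b i \<in> Zp" if "i < r" for i
    proof -
      have "M * (r - i) = M * (r - i - 1) + M" using that by (cases "r - i") auto
      then have "?p ^ (M * (r - i)) * b i = ?p ^ (M * (r - i - 1)) * (?p ^ M * b i)"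
        by (simp add: power_add mult.assoc)
      then show ?thesis using Zp_mult[OF Zp_power[OF Zp_of_nat] M[OF that]] by metis
    qed
    have "(?p ^ M * y) ^ r + (\<Sum>i<r. ?p ^ (M * (r - i)) * b i * (?p ^ M * y) ^ i)
        = ?p ^ (M * r) * (y ^ r + (\<Sum>i<r. b i * y ^ i))"
    proof -
      have "?p ^ (M * (r - i)) * b i * (?p ^ M * y) ^ i = ?p ^ (M * r) * (b i * y ^ i)" if "i < r" for i
      proof -
        have "M * r = M * (r - i) + M * i" using that by (simp flip: distrib_left)
        then show ?thesis by (simp add: power_add power_mult_distrib power_mult mult_ac)
      qed
      then have "(\<Sum>i<r. ?p ^ (M * (r - i)) * b i * (?p ^ M * y) ^ i) = (\<Sum>i<r. ?p ^ (M * r) * (b i * y ^ i))"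
        by (intro sum.cong) auto
      moreover have "(?p ^ M * y) ^ r = ?p ^ (M * r) * y ^ r" by (simp only: power_mult_distrib power_mult)
      ultimately show ?thesis by (simp only: distrib_left sum_distrib_left)
    qed
    then show "(?p ^ M * y) ^ r + (\<Sum>i<r. ?p ^ (M * (r - i)) * b i * (?p ^ M * y) ^ i) = 0"
      using eq by simp
  qed
  then show ?thesis by blast
qed

text \<open>For \<open>x \<noteq> 0\<close> some \<open>p^N / x\<close> is integral. If
  \<open>x\<close> is divisible by \<open>\<pi>^(e (N + 1))\<close>, then it is divisible by
  \<open>p^(N + 1)\<close>, and the product of the two quotients exhibits \<open>1 / p\<close> as
  integral.\<close>

lemma pi_divisible_imp_zero:
  assumes "\<And>i. \<exists>r\<in>A. x = r * \<pi> ^ i"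
  shows "x = 0"
proof (rule ccontr)
  assume x: "x \<noteq> 0"
  let ?p = "of_nat p :: 'k"
  obtain N where N: "?p ^ N * inverse x \<in> A" using p_multiple_integral by blast
  obtain s where s: "s \<in> A" "\<pi> ^ e = s * ?p" using p_pi_assoc by blast
  obtain r where r: "r \<in> A" "x = r * \<pi> ^ (e * Suc N)" using assms by blast
  have "x = r * s ^ Suc N * ?p ^ Suc N"
    using r(2) s(2) by (simp only: power_mult power_mult_distrib mult.assoc)
  then have "r * s ^ Suc N * ?p ^ Suc N * inverse x = x * inverse x" by (simp only:)
  then have "r * s ^ Suc N * ?p ^ Suc N * inverse x = 1" by (simp only: right_inverse[OF x])
  moreover have "?p * (r * s ^ Suc N * (?p ^ N * inverse x)) = r * s ^ Suc N * ?p ^ Suc N * inverse x"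
    by (simp add: mult_ac)
  ultimately have "inverse ?p = r * s ^ Suc N * (?p ^ N * inverse x)"
    by (intro inverse_unique) simp
  moreover have "r * s ^ Suc N * (?p ^ N * inverse x) \<in> A"
    by (intro A_mult r s N A_power)
  ultimately show False using inverse_p_notin by simp
qed

text \<open>The residue field has dimension \<open>f\<close> over the image \<open>F\<close> of the
  p-adic integers. \<open>F\<close> consists of the classes of \<open>0, ..., p - 1\<close>, which
  are distinct, so the residue field has \<open>p ^ f\<close> elements; a choice of one preimage for
  each gives the set.\<close>

lemma residue_representatives:
  "\<exists>S \<subseteq> A. finite S \<and> card S = p ^ f \<and> (\<forall>x\<in>A. \<exists>!s. s \<in> S \<and> (\<exists>r\<in>A. x - s = r * \<pi>))"
proof -
  interpret I: maximalideal "PIdl\<^bsub>R\<^esub> \<pi>" R by (rule maximalideal_pi)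
  define k where "k = residue_field R \<pi>"
  have kdef: "k = R Quot PIdl\<^bsub>R\<^esub> \<pi>" unfolding k_def residue_field_def ..
  have field_k: "field k" unfolding kdef by (rule I.quotient_is_field[OF cring_R])
  interpret k: field k by (rule field_k)
  let ?h = "reduction R \<pi>"
  have h_hom: "?h \<in> Ring.ring_hom R k" unfolding kdef reduction_def by (rule I.rcos_ring_hom)
  have carrier_k: "carrier k = ?h ` A"
    unfolding kdef FactRing_def A_RCOSETS_def' reduction_def by auto
  interpret h: ring_hom_ring R k ?h
    by (rule ring_hom_ringI2[OF ring_R k.ring_axioms h_hom])
  have p0: "p > 0" using p prime_gt_0_nat by simp
  define F where "F = ?h ` Zp"
  have h_eq: "?h x = ?h y \<longleftrightarrow> (\<exists>r\<in>A. x - y = r * \<pi>)" if "x \<in> A" "y \<in> A" for x y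
    by (rule reduction_eq_iff[OF pi_in that])
  have F_eq: "F = (\<lambda>j. ?h (of_nat j)) ` {..<p}"
  proof (intro equalityI subsetI)
    fix a assume "a \<in> F"
    then obtain z where z: "z \<in> Zp" "a = ?h z" unfolding F_def by auto
    obtain j w where j: "j < p" "w \<in> Zp" "z = of_nat j + of_nat p * w" using Zp_residue[OF z(1)] by blast
    obtain r where r: "r \<in> A" "of_nat p = r * \<pi>" using p_pi_multiple by blast
    have "z - of_nat j = (r * w) * \<pi>" using j(3) r(2) by (simp add: algebra_simps)
    then have "?h z = ?h (of_nat j)"
      using h_eq[OF Zp_subset_A[OF z(1)] A_of_nat] A_mult[OF r(1) Zp_subset_A[OF j(2)]] by blast
    then show "a \<in> (\<lambda>j. ?h (of_nat j)) ` {..<p}" using z(2) j(1) by simp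
  next
    fix a assume "a \<in> (\<lambda>j. ?h (of_nat j)) ` {..<p}"
    then show "a \<in> F" unfolding F_def using Zp_of_nat by auto
  qed
  have inj: "inj_on (\<lambda>j. ?h (of_nat j)) {..<p}"
  proof (rule linorder_inj_onI)
    fix i j assume ij: "i < j" "i \<in> {..<p}" "j \<in> {..<p}"
    show "?h (of_nat i) \<noteq> ?h (of_nat j)"
    proof
      assume "?h (of_nat i) = ?h (of_nat j)"
      from iffD1[OF h_eq[OF A_of_nat A_of_nat] this[symmetric]]
      obtain r where r: "r \<in> A" "of_nat j - of_nat i = r * \<pi>" by (elim bexE)
      have "of_nat (j - i) = (of_nat j - of_nat i :: 'k)" using ij(1) by (simp add: of_nat_diff)
      with r(2) have "of_nat (j - i) = r * \<pi>" by (rule trans[rotated])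
      moreover have "0 < j - i" "j - i < p" using ij(1,3) by simp_all
      then have "of_nat (j - i) \<noteq> r * \<pi>" using r(1) by (rule small_nat_not_pi_multiple)
      ultimately show False by contradiction
    qed
  qed (rule linear)
  have cardF: "card F = p" "finite F" unfolding F_eq using card_image[OF inj] by simp_all
  have Fk: "F \<subseteq> carrier k" unfolding F_def carrier_k using Zp_subset_A by (intro image_mono subsetI)
  have F_sub: "subring F k"
  proof (rule k.subringI[OF Fk])
    show "\<one>\<^bsub>k\<^esub> \<in> F" unfolding F_def using h.hom_one[unfolded R_ops, symmetric] Zp_one by (rule image_eqI)
    show "\<ominus>\<^bsub>k\<^esub> a \<in> F" if "a \<in> F" for a
    proof -
      from that[unfolded F_def] obtain z where z: "a = ?h z" "z \<in> Zp" by (rule imageE)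
      have "\<ominus>\<^bsub>k\<^esub> a = ?h (- z)"
        unfolding z(1) h.hom_a_inv[OF Zp_subset_A[OF z(2)], symmetric] R_minus[OF Zp_subset_A[OF z(2)]] ..
      then show ?thesis unfolding F_def using Zp_minus[OF z(2)] by (rule image_eqI)
    qed
    fix a b assume a: "a \<in> F" and b: "b \<in> F"
    from a[unfolded F_def] obtain z where z: "a = ?h z" "z \<in> Zp" by (rule imageE)
    from b[unfolded F_def] obtain w where w: "b = ?h w" "w \<in> Zp" by (rule imageE)
    note zw = Zp_subset_A[OF z(2)] Zp_subset_A[OF w(2)]
    have "a \<otimes>\<^bsub>k\<^esub> b = ?h (z * w)"
      unfolding z(1) w(1) h.hom_mult[OF zw, symmetric] R_ops ..
    then show "a \<otimes>\<^bsub>k\<^esub> b \<in> F" unfolding F_def using Zp_mult[OF z(2) w(2)] by (rule image_eqI)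
    have "a \<oplus>\<^bsub>k\<^esub> b = ?h (z + w)"
      unfolding z(1) w(1) h.hom_add[OF zw, symmetric] R_ops ..
    then show "a \<oplus>\<^bsub>k\<^esub> b \<in> F" unfolding F_def using Zp_add[OF z(2) w(2)] by (rule image_eqI)
  qed
  \<comment> \<open>The dimension count needs scalars forming a subfield; finiteness of
    \<open>F\<close> provides this without computing inverses of p-adic units.\<close>
  have F_field: "subfield F k" by (rule k.finite_subring_is_subfield[OF F_sub cardF(2)])
  have "k.dimension f F (carrier k)"
    unfolding F_def k_def using inert unfolding inertia_degree_def Let_def R_def[symmetric] .
  note card_k = k.card_dimension[OF F_field cardF(2) this, unfolded cardF(1)]
  have "\<forall>c\<in>carrier k. \<exists>x. x \<in> A \<and> ?h x = c" unfolding carrier_k by blast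
  from bchoice[OF this] obtain g where g: "\<And>c. c \<in> carrier k \<Longrightarrow> g c \<in> A \<and> ?h (g c) = c" by blast
  show ?thesis
  proof (intro exI conjI ballI)
    show "g ` carrier k \<subseteq> A" using g by blast
    show "finite (g ` carrier k)" using card_k by (intro finite_imageI) blast
    have "inj_on g (carrier k)" using g by (intro inj_on_inverseI[of _ ?h]) blast
    then show "card (g ` carrier k) = p ^ f" using card_k by (simp add: card_image)
    fix x assume x: "x \<in> A"
    then have hx: "?h x \<in> carrier k" unfolding carrier_k by (rule imageI)
    have iff: "(\<exists>r\<in>A. x - g c = r * \<pi>) \<longleftrightarrow> ?h x = c" if "c \<in> carrier k" for c
      using h_eq[OF x conjunct1[OF g[OF that]]] unfolding conjunct2[OF g[OF that]] by (rule sym)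
    show "\<exists>!s. s \<in> g ` carrier k \<and> (\<exists>r\<in>A. x - s = r * \<pi>)"
    proof (rule ex1I[of _ "g (?h x)"])
      show "g (?h x) \<in> g ` carrier k \<and> (\<exists>r\<in>A. x - g (?h x) = r * \<pi>)" using iff[OF hx] hx by blast
      show "s = g (?h x)" if s: "s \<in> g ` carrier k \<and> (\<exists>r\<in>A. x - s = r * \<pi>)" for s
      proof -
        obtain c where "c \<in> carrier k" "s = g c" using s by blast
        then show ?thesis using iff[of c] s by blast
      qed
    qed
  qed
qed

end

section \<open>Monomial bilinear forms and transvections\<close>

text \<open>Vectors are functions on indices, and \<open>delta j\<close> is the \<open>j\<close>-th
  standard basis vector.\<close>

definition delta :: "nat \<Rightarrow> nat \<Rightarrow> 'k::field" where
  "delta j i = (if i = j then 1 else 0)"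

lemma delta_simps [simp]: "delta j j = 1" "i \<noteq> j \<Longrightarrow> delta j i = 0"
  by (auto simp: delta_def)

lemma sum_delta_mult [simp]:
  "j < n \<Longrightarrow> (\<Sum>i<n. delta j i * g i) = (g j :: 'k::field)"
  "j < n \<Longrightarrow> (\<Sum>i<n. g i * delta j i) = g j"
  "j < n \<Longrightarrow> (\<Sum>i<n. delta i j * g i) = g j"
  "j < n \<Longrightarrow> (\<Sum>i<n. g i * delta i j) = g j"
  by (simp_all add: delta_def if_distrib[of "\<lambda>x. x * _"] if_distrib[of "\<lambda>x. _ * x"] cong: if_cong)

lemma index_mult_mat_sum:
  assumes "x \<in> carrier_mat n n" "y \<in> carrier_mat n n" "i < n" "j < n"
  shows "(x * y) $$ (i, j) = (\<Sum>k<n. x $$ (i, k) * y $$ (k, j))"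
  using assms by (simp add: scalar_prod_def lessThan_atLeast0)

text \<open>The Gram matrices in question are signed permutation matrices: \<open>\<sigma>\<close>
  is the involution, \<open>\<epsilon>\<close> the signs, \<open>\<eta>\<close> is 1 for a symmetric
  and -1 for an alternating form. The indices \<open>a\<close> and \<open>b\<close> span a
  hyperbolic plane; the line of \<open>a\<close> plays the role of the first coordinate line. Fixed
  points of \<open>\<sigma>\<close> are allowed, as they occur for odd orthogonal groups.\<close>

locale monomial_form =
  fixes n :: nat and \<sigma> :: "nat \<Rightarrow> nat" and \<epsilon> :: "nat \<Rightarrow> 'k::field" and \<eta> :: 'k and a b :: nat
  assumes \<sigma>_less: "i < n \<Longrightarrow> \<sigma> i < n"
    and \<sigma>_\<sigma>: "i < n \<Longrightarrow> \<sigma> (\<sigma> i) = i"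
    and \<epsilon>_square: "i < n \<Longrightarrow> \<epsilon> i * \<epsilon> i = 1"
    and \<epsilon>_\<sigma>: "i < n \<Longrightarrow> \<epsilon> (\<sigma> i) = \<eta> * \<epsilon> i"
    and \<eta>_square: "\<eta> * \<eta> = 1"
    and a_less: "a < n" and \<sigma>_a: "\<sigma> a = b" and a_b: "a \<noteq> b" and \<epsilon>_a: "\<epsilon> a = 1"
begin

definition B :: "(nat \<Rightarrow> 'k) \<Rightarrow> (nat \<Rightarrow> 'k) \<Rightarrow> 'k" where
  "B u v = (\<Sum>i<n. \<epsilon> i * u i * v (\<sigma> i))"

definition gram :: "'k mat" where
  "gram = mat n n (\<lambda>(i, j). \<epsilon> i * delta (\<sigma> i) j)"

definition preserves :: "'k mat \<Rightarrow> bool" where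
  "preserves x \<longleftrightarrow> transpose_mat x * gram * x = gram"

lemma b_less: "b < n" and \<sigma>_b: "\<sigma> b = a" and \<epsilon>_b: "\<epsilon> b = \<eta>"
  using \<sigma>_less[OF a_less] \<sigma>_\<sigma>[OF a_less] \<epsilon>_\<sigma>[OF a_less] \<sigma>_a \<epsilon>_a by auto

lemma bij_\<sigma>: "bij_betw \<sigma> {..<n} {..<n}"
  by (rule bij_betw_byWitness[where f' = \<sigma>]) (auto simp: \<sigma>_\<sigma> \<sigma>_less)

lemma \<sigma>_eq_iff: "i < n \<Longrightarrow> j < n \<Longrightarrow> \<sigma> i = j \<longleftrightarrow> i = \<sigma> j"
  using \<sigma>_\<sigma> by metis

lemma B_cong: "(\<And>i. i < n \<Longrightarrow> u i = u' i) \<Longrightarrow> (\<And>i. i < n \<Longrightarrow> v i = v' i) \<Longrightarrow> B u v = B u' v'"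
  unfolding B_def by (intro sum.cong) (auto simp: \<sigma>_less)

lemma B_sym: "B u v = \<eta> * B v u"
proof -
  have "B u v = (\<Sum>i<n. \<epsilon> (\<sigma> i) * u (\<sigma> i) * v (\<sigma> (\<sigma> i)))"
    unfolding B_def by (rule sum.reindex_bij_betw[OF bij_\<sigma>, symmetric])
  also have "\<dots> = (\<Sum>i<n. \<eta> * (\<epsilon> i * v i * u (\<sigma> i)))"
    by (intro sum.cong) (auto simp: \<epsilon>_\<sigma> \<sigma>_\<sigma>)
  finally show ?thesis unfolding B_def by (simp add: sum_distrib_left)
qed

lemma B_lin_right: "B u (\<lambda>i. v i + r * w i) = B u v + r * B u w"
  unfolding B_def by (simp add: algebra_simps sum.distrib sum_distrib_left)

lemma B_lin_left: "B (\<lambda>i. v i + r * w i) u = B v u + r * B w u"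
  unfolding B_def by (simp add: algebra_simps sum.distrib sum_distrib_left)

lemma B_sum_left: "B (\<lambda>i. \<Sum>j<m. r j * v j i) u = (\<Sum>j<m. r j * B (v j) u)"
proof -
  have "B (\<lambda>i. \<Sum>j<m. r j * v j i) u = (\<Sum>i<n. \<Sum>j<m. r j * (\<epsilon> i * v j i * u (\<sigma> i)))"
    unfolding B_def by (simp add: sum_distrib_left sum_distrib_right mult_ac)
  also have "\<dots> = (\<Sum>j<m. \<Sum>i<n. r j * (\<epsilon> i * v j i * u (\<sigma> i)))" by (rule sum.swap)
  finally show ?thesis unfolding B_def by (simp add: sum_distrib_left)
qed

lemma B_sum_right: "B u (\<lambda>i. \<Sum>j<m. r j * v j i) = (\<Sum>j<m. r j * B u (v j))"
  unfolding B_sym[of u] B_sum_left by (simp add: sum_distrib_left mult_ac)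

lemma B_delta_right: "j < n \<Longrightarrow> B u (delta j) = \<epsilon> (\<sigma> j) * u (\<sigma> j)"
proof -
  assume j: "j < n"
  have "B u (delta j) = (\<Sum>i<n. \<epsilon> i * u i * delta (\<sigma> j) i)"
    unfolding B_def using \<sigma>_eq_iff[OF _ j] by (intro sum.cong) (auto simp: delta_def)
  then show ?thesis using \<sigma>_less[OF j] by simp
qed

lemma B_b_right: "B u (delta b) = u a"
  using B_delta_right[OF b_less] \<sigma>_b \<epsilon>_a by simp

lemma B_b_left: "B (delta b) u = \<eta> * u a"
  using B_sym[of "delta b" u] B_b_right by simp

lemma B_a_right: "B u (delta a) = \<eta> * u b"
  using B_delta_right[OF a_less] \<sigma>_a \<epsilon>_b by simp

lemma gram_carrier: "gram \<in> carrier_mat n n"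
  unfolding gram_def by simp

lemma gram_index: "i < n \<Longrightarrow> j < n \<Longrightarrow> gram $$ (i, j) = B (delta i) (delta j)"
  using \<sigma>_eq_iff[of i j] by (auto simp: gram_def B_delta_right delta_def)

lemma preserves_iff:
  assumes x: "x \<in> carrier_mat n n"
  shows "preserves x \<longleftrightarrow>
    (\<forall>i<n. \<forall>j<n. B (\<lambda>k. x $$ (k, i)) (\<lambda>k. x $$ (k, j)) = B (delta i) (delta j))"
proof -
  have c: "transpose_mat x \<in> carrier_mat n n" "transpose_mat x * gram \<in> carrier_mat n n"
    "transpose_mat x * gram * x \<in> carrier_mat n n"
    using x gram_carrier by auto
  have entry: "(transpose_mat x * gram * x) $$ (i, j) = B (\<lambda>k. x $$ (k, i)) (\<lambda>k. x $$ (k, j))"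
    if "i < n" "j < n" for i j
  proof -
    have row: "(transpose_mat x * gram) $$ (i, l) = \<epsilon> (\<sigma> l) * x $$ (\<sigma> l, i)" if "l < n" for l
    proof -
      have "(transpose_mat x * gram) $$ (i, l) = (\<Sum>k<n. x $$ (k, i) * (\<epsilon> k * delta (\<sigma> k) l))"
        using index_mult_mat_sum[OF c(1) gram_carrier \<open>i < n\<close> that] x \<open>i < n\<close> that
        by (simp add: gram_def)
      also have "\<dots> = (\<Sum>k<n. (x $$ (k, i) * \<epsilon> k) * delta (\<sigma> l) k)"
        using \<sigma>_eq_iff[OF _ that] \<sigma>_\<sigma>[OF that] by (intro sum.cong) (auto simp: delta_def)
      finally show ?thesis using \<sigma>_less[OF that] by (simp add: mult.commute)
    qed
    have "(transpose_mat x * gram * x) $$ (i, j) = (\<Sum>l<n. \<epsilon> (\<sigma> l) * x $$ (\<sigma> l, i) * x $$ (l, j))"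
      using index_mult_mat_sum[OF c(2) x that] row by simp
    also have "\<dots> = (\<Sum>l<n. \<epsilon> (\<sigma> l) * x $$ (\<sigma> l, i) * x $$ (\<sigma> (\<sigma> l), j))"
      by (intro sum.cong) (auto simp: \<sigma>_\<sigma>)
    also have "\<dots> = B (\<lambda>k. x $$ (k, i)) (\<lambda>k. x $$ (k, j))"
      unfolding B_def by (rule sum.reindex_bij_betw[OF bij_\<sigma>])
    finally show ?thesis .
  qed
  show ?thesis
  proof
    assume "preserves x"
    then show "\<forall>i<n. \<forall>j<n. B (\<lambda>k. x $$ (k, i)) (\<lambda>k. x $$ (k, j)) = B (delta i) (delta j)"
      unfolding preserves_def using entry gram_index by metis
  next
    assume R: "\<forall>i<n. \<forall>j<n. B (\<lambda>k. x $$ (k, i)) (\<lambda>k. x $$ (k, j)) = B (delta i) (delta j)"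
    show "preserves x"
      unfolding preserves_def
      by (rule eq_matI) (use R entry gram_index gram_carrier c(3) in auto)
  qed
qed

lemma preserves_B:
  assumes x: "x \<in> carrier_mat n n" and "preserves x"
  shows "B (\<lambda>i. \<Sum>j<n. u j * x $$ (i, j)) (\<lambda>i. \<Sum>j<n. v j * x $$ (i, j)) = B u v"
proof -
  have "B (\<lambda>i. \<Sum>j<n. u j * x $$ (i, j)) (\<lambda>i. \<Sum>j<n. v j * x $$ (i, j))
      = (\<Sum>i<n. u i * (\<Sum>j<n. v j * B (\<lambda>k. x $$ (k, i)) (\<lambda>k. x $$ (k, j))))"
    unfolding B_sum_left[where v = "\<lambda>j i. x $$ (i, j)"] B_sum_right[where v = "\<lambda>j i. x $$ (i, j)"] ..
  also have "\<dots> = (\<Sum>i<n. u i * (\<Sum>j<n. v j * B (delta i) (delta j)))"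
    using assms preserves_iff[OF x] by (intro sum.cong refl arg_cong2[where f = "(*)"]) auto
  also have "\<dots> = B (\<lambda>i. \<Sum>j<n. u j * delta j i) (\<lambda>i. \<Sum>j<n. v j * delta j i)"
    unfolding B_sum_left B_sum_right ..
  also have "\<dots> = B u v" by (rule B_cong) auto
  finally show ?thesis .
qed

text \<open>This is the Eichler (or Siegel) transformation along the isotropic vector of
  \<open>b\<close>. For \<open>v\<close> vanishing at \<open>a\<close> and \<open>b\<close> it fixes
  the vector of \<open>b\<close> and sends that of \<open>a\<close> to the sum of it,
  \<open>v\<close> and \<open>c\<close> times the vector of \<open>b\<close>. The matrices form the
  unipotent radical opposite to the stabiliser of the line of \<open>a\<close>.\<close>

definition transvection :: "(nat \<Rightarrow> 'k) \<Rightarrow> 'k \<Rightarrow> (nat \<Rightarrow> 'k) \<Rightarrow> nat \<Rightarrow> 'k" where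
  "transvection v c u i = u i + u a * (v i + c * delta b i) - B v u * delta b i"

lemma B_transvection_right:
  "B w (transvection v c u) = B w u + u a * (B w v + c * w a) - B v u * w a"
proof -
  have eq: "transvection v c u = (\<lambda>i. (u i + u a * v i) + (u a * c - B v u) * delta b i)"
    by (auto simp: transvection_def algebra_simps)
  show ?thesis unfolding eq B_lin_right B_b_right by (simp add: algebra_simps)
qed

lemma transvection_a:
  assumes "v a = 0"
  shows "transvection v c u a = u a"
  using assms a_b by (simp add: transvection_def)

text \<open>After expansion the defect is \<open>u a * w a\<close> times the left side of the
  condition on \<open>c\<close>. That condition says that the image of the isotropic basis vector
  \<open>delta a\<close> is again isotropic.\<close>

lemma transvection_preserves:
  assumes v: "v a = 0" "v b = 0" and c: "c * (1 + \<eta>) + B v v = 0"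
  shows "B (transvection v c u) (transvection v c w) = B u w"
proof -
  have eq: "transvection v c u = (\<lambda>i. (u i + u a * v i) + (u a * c - B v u) * delta b i)" for u
    by (auto simp: transvection_def algebra_simps)
  have "B (transvection v c u) (transvection v c w)
     = B (transvection v c u) w + w a * (B (transvection v c u) v + c * u a) - B v w * u a"
    unfolding B_transvection_right transvection_a[of v, OF v(1)] ..
  also have "B (transvection v c u) w = B u w + u a * B v w + (u a * c - B v u) * (\<eta> * w a)"
    unfolding eq B_lin_left B_b_left ..
  also have "B (transvection v c u) v = \<eta> * B v u + u a * B v v"
    unfolding eq B_lin_left B_b_left using v(1) B_sym[of u v] by simp
  finally have "B (transvection v c u) (transvection v c w)
     = B u w + u a * w a * (c * (1 + \<eta>) + B v v)"
    by (simp add: algebra_simps)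
  then show ?thesis using c by simp
qed

text \<open>The pairs \<open>(v, c)\<close> multiply by a Heisenberg-type law. The cocycle
  \<open>- B v v'\<close> is the source of the corner corrections in all later quotients and
  inverses.\<close>

lemma transvection_comp:
  assumes "v a = 0" "v b = 0" "v' a = 0"
  shows "transvection v c (transvection v' c' u) i
    = transvection (\<lambda>i. v i + v' i) (c + c' - B v v') u i"
proof -
  have "B (\<lambda>i. v i + v' i) u = B v u + B v' u" using B_lin_left[of v 1 v' u] by simp
  moreover have "B v (transvection v' c' u) = B v u + u a * B v v'"
    unfolding B_transvection_right using assms(1) by simp
  ultimately show ?thesis
    unfolding transvection_def[of v] transvection_a[of v', OF assms(3)]
    by (simp add: transvection_def algebra_simps)
qed

definition tmat :: "(nat \<Rightarrow> 'k) \<Rightarrow> 'k \<Rightarrow> 'k mat" where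
  "tmat v c = mat n n (\<lambda>(i, j). transvection v c (delta j) i)"

lemma tmat_carrier [simp]: "tmat v c \<in> carrier_mat n n"
  unfolding tmat_def by simp

lemma tmat_index:
  "i < n \<Longrightarrow> j < n \<Longrightarrow> tmat v c $$ (i, j) = transvection v c (delta j) i"
  unfolding tmat_def by simp

lemma tmat_mult_index:
  assumes x: "x \<in> carrier_mat n n" and i: "i < n" "j < n"
  shows "(tmat v c * x) $$ (i, j) = transvection v c (\<lambda>k. x $$ (k, j)) i"
proof -
  have *: "B v (\<lambda>k. x $$ (k, j)) = (\<Sum>k<n. x $$ (k, j) * B v (delta k))"
  proof -
    have "B v (\<lambda>k. x $$ (k, j)) = B v (\<lambda>i. \<Sum>k<n. x $$ (k, j) * delta k i)"
      by (rule B_cong) auto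
    then show ?thesis unfolding B_sum_right .
  qed
  have "(tmat v c * x) $$ (i, j) = (\<Sum>k<n. transvection v c (delta k) i * x $$ (k, j))"
    using index_mult_mat_sum[OF tmat_carrier x i] i by (simp add: tmat_index)
  also have "\<dots> = (\<Sum>k<n. delta k i * x $$ (k, j)) + (\<Sum>k<n. delta k a * x $$ (k, j)) * (v i + c * delta b i)
      - (\<Sum>k<n. x $$ (k, j) * B v (delta k)) * delta b i"
    unfolding transvection_def sum_distrib_right sum.distrib[symmetric] sum_subtractf[symmetric]
    by (intro sum.cong) (auto simp: algebra_simps)
  also have "\<dots> = transvection v c (\<lambda>k. x $$ (k, j)) i"
    unfolding *[symmetric] using i a_less by (simp add: transvection_def)
  finally show ?thesis .
qed

lemma tmat_mult:
  assumes "v a = 0" "v b = 0" "v' a = 0"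
  shows "tmat v c * tmat v' c' = tmat (\<lambda>i. v i + v' i) (c + c' - B v v')"
proof (rule eq_matI)
  fix i j assume "i < dim_row (tmat (\<lambda>i. v i + v' i) (c + c' - B v v'))"
    "j < dim_col (tmat (\<lambda>i. v i + v' i) (c + c' - B v v'))"
  then have ij: "i < n" "j < n" by (auto simp: tmat_def)
  have "(tmat v c * tmat v' c') $$ (i, j) = transvection v c (\<lambda>k. tmat v' c' $$ (k, j)) i"
    by (rule tmat_mult_index[OF tmat_carrier ij])
  also have "\<dots> = transvection v c (transvection v' c' (delta j)) i"
    using ij a_less B_cong[of v v "\<lambda>k. tmat v' c' $$ (k, j)" "transvection v' c' (delta j)"]
    by (simp add: transvection_def[of v] tmat_index)
  finally show "(tmat v c * tmat v' c') $$ (i, j) = tmat (\<lambda>i. v i + v' i) (c + c' - B v v') $$ (i, j)"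
    using transvection_comp[of v v', OF assms] ij by (simp add: tmat_index)
qed (auto simp: tmat_def)

lemma tmat_zero: "tmat (\<lambda>_. 0) 0 = 1\<^sub>m n"
  by (rule eq_matI) (auto simp: tmat_def transvection_def B_def delta_def)

lemma tmat_preserves:
  assumes "v a = 0" "v b = 0" "c * (1 + \<eta>) + B v v = 0"
  shows "preserves (tmat v c)"
  unfolding preserves_iff[OF tmat_carrier]
proof (intro allI impI)
  fix i j assume ij: "i < n" "j < n"
  have "B (\<lambda>k. tmat v c $$ (k, i)) (\<lambda>k. tmat v c $$ (k, j))
      = B (transvection v c (delta i)) (transvection v c (delta j))"
    using ij by (intro B_cong) (auto simp: tmat_index)
  then show "B (\<lambda>k. tmat v c $$ (k, i)) (\<lambda>k. tmat v c $$ (k, j)) = B (delta i) (delta j)"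
    using transvection_preserves[OF assms] by simp
qed

text \<open>\<open>gram\<close> is a signed permutation matrix, so its product with its transpose is
  1 and its determinant is nonzero; it cancels from the determinant of the isometry
  equation.\<close>

lemma det_preserves:
  assumes x: "x \<in> carrier_mat n n" and "preserves x"
  shows "det x * det x = 1"
proof -
  have "gram * transpose_mat gram = 1\<^sub>m n"
  proof (rule eq_matI)
    fix i j assume "i < dim_row (1\<^sub>m n :: 'k mat)" "j < dim_col (1\<^sub>m n :: 'k mat)"
    then have ij: "i < n" "j < n" by auto
    have "(gram * transpose_mat gram) $$ (i, j) = (\<Sum>k<n. (\<epsilon> i * delta (\<sigma> i) k) * (\<epsilon> j * delta (\<sigma> j) k))"
      using index_mult_mat_sum[OF gram_carrier _ ij, of "transpose_mat gram"] gram_carrier ij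
      by (simp add: gram_def)
    also have "\<dots> = \<epsilon> i * (\<Sum>k<n. delta (\<sigma> i) k * (\<epsilon> j * delta (\<sigma> j) k))"
      by (simp add: sum_distrib_left mult_ac)
    also have "\<dots> = \<epsilon> i * (\<epsilon> j * delta (\<sigma> j) (\<sigma> i))"
      using \<sigma>_less[OF ij(1)] by simp
    also have "\<dots> = 1\<^sub>m n $$ (i, j)"
      using ij \<sigma>_\<sigma>[OF ij(1)] \<sigma>_\<sigma>[OF ij(2)] \<epsilon>_square[OF ij(1)] by (cases "i = j") (auto simp: delta_def)
    finally show "(gram * transpose_mat gram) $$ (i, j) = 1\<^sub>m n $$ (i, j)" .
  qed (use gram_carrier in auto)
  then have "det gram * det gram = 1"
    using det_mult[OF gram_carrier, of "transpose_mat gram"] det_transpose[OF gram_carrier] gram_carrier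
    by simp
  then have nz: "det gram \<noteq> 0" by auto
  have "det (transpose_mat x * gram * x) = det x * det gram * det x"
    using x gram_carrier det_transpose[OF x] by (simp add: det_mult[of _ n])
  then have "det x * det gram * det x = det gram" using assms(2) unfolding preserves_def by simp
  then have "det gram * (det x * det x) = det gram * 1" by (simp add: mult_ac)
  then show ?thesis using nz by (simp only: mult_cancel_left simp_thms)
qed

lemma det_tmat:
  assumes v: "v a = 0" "v b = 0" and two: "(2::'k) \<noteq> 0" and \<eta>: "\<eta> = 1" and c: "c * (1 + \<eta>) + B v v = 0"
  shows "det (tmat v c) = 1"
proof -
  \<comment> \<open>a transvection is the square of an isometry\<close>
  define w where "w = (\<lambda>i. v i / 2)"
  have w: "w a = 0" "w b = 0" unfolding w_def using v by auto
  have Bw: "B w w = B v v / 4"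
    unfolding B_def w_def sum_divide_distrib by (intro sum.cong) auto
  have four: "(4::'k) = 2 * 2" by simp
  have c2: "2 * c = - B v v" using c \<eta> by (simp add: eq_neg_iff_add_eq_0 algebra_simps)
  then have "c = - B v v / 2" using two by (simp add: field_simps)
  then have c4: "B v v = - 2 * c" using c2 by simp
  have "c / 4 * (1 + \<eta>) + B w w = 0" unfolding Bw c4 \<eta> by simp
  then have "det (tmat w (c / 4)) * det (tmat w (c / 4)) = 1"
    using det_preserves[OF tmat_carrier tmat_preserves[OF w]] by blast
  moreover have "tmat w (c / 4) * tmat w (c / 4) = tmat v c"
  proof -
    have "(\<lambda>i. w i + w i) = v" unfolding w_def using two by (auto simp: field_simps)
    moreover have "c / 4 + c / 4 - B w w = c"
    proof -
      have "(4::'k) \<noteq> 0" using two four by (metis mult_eq_0_iff)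
      then have "4 * (c / 4) = c" by simp
      moreover have "d + d - (- 2) * d = 4 * d" for d :: 'k by (simp add: algebra_simps)
      moreover have "B w w = (- 2) * (c / 4)" unfolding Bw c4 by simp
      ultimately show ?thesis by metis
    qed
    ultimately show ?thesis unfolding tmat_mult[of w w, OF w w(1)] by simp
  qed
  ultimately show ?thesis using det_mult[OF tmat_carrier tmat_carrier] by metis
qed

end

section \<open>Congruence subgroups and diagonal conjugation\<close>

text \<open>These are the properties of the ring of integers that the matrix arguments draw on: a
  subring with units \<open>1 + \<pi> A\<close>, no nonzero element divisible by all powers of
  \<open>\<pi>\<close>, and \<open>q\<close> residues modulo \<open>\<pi>\<close>.\<close>

locale pi_adic =
  fixes A :: "'k::field set" and \<pi> :: 'k and q :: nat
  assumes one_in: "1 \<in> A"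
    and add_in: "\<And>x y. x \<in> A \<Longrightarrow> y \<in> A \<Longrightarrow> x + y \<in> A"
    and mult_in: "\<And>x y. x \<in> A \<Longrightarrow> y \<in> A \<Longrightarrow> x * y \<in> A"
    and uminus_in: "\<And>x. x \<in> A \<Longrightarrow> - x \<in> A"
    and pi_in: "\<pi> \<in> A" and pi_nonzero: "\<pi> \<noteq> 0"
    and unit_in: "\<And>x. x \<in> A \<Longrightarrow> 1 + x * \<pi> \<noteq> 0 \<and> inverse (1 + x * \<pi>) \<in> A"
    and separated: "\<And>x. (\<And>i. \<exists>r\<in>A. x = r * \<pi> ^ i) \<Longrightarrow> x = 0"
    and residues: "\<exists>S. S \<subseteq> A \<and> finite S \<and> card S = q \<and> (\<forall>x\<in>A. \<exists>!s. s \<in> S \<and> (\<exists>r\<in>A. x - s = r * \<pi>))"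
begin

definition I :: "nat \<Rightarrow> 'k set" where
  "I m = {r * \<pi> ^ m |r. r \<in> A}"

lemma zero_in: "0 \<in> A"
  using add_in[OF one_in uminus_in[OF one_in]] by simp

lemma diff_in: "x \<in> A \<Longrightarrow> y \<in> A \<Longrightarrow> x - y \<in> A"
  using add_in[of x "- y"] uminus_in[of y] by simp

lemma power_in: "x \<in> A \<Longrightarrow> x ^ i \<in> A"
  by (induction i) (simp_all add: one_in mult_in)

lemma sum_in: "(\<And>i. i \<in> X \<Longrightarrow> f i \<in> A) \<Longrightarrow> sum f X \<in> A"
  by (induction X rule: infinite_finite_induct) (simp_all add: zero_in add_in)

lemma prod_in: "(\<And>i. i \<in> X \<Longrightarrow> f i \<in> A) \<Longrightarrow> prod f X \<in> A"
  by (induction X rule: infinite_finite_induct) (simp_all add: one_in mult_in)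

lemma I_I: "r \<in> A \<Longrightarrow> r * \<pi> ^ m \<in> I m"
  unfolding I_def by blast

lemma I_E: assumes "x \<in> I m" obtains r where "r \<in> A" "x = r * \<pi> ^ m"
  using assms unfolding I_def by blast

lemma I_iff: "x \<in> I m \<longleftrightarrow> x / \<pi> ^ m \<in> A"
proof
  assume "x \<in> I m"
  then obtain r where "r \<in> A" "x = r * \<pi> ^ m" by (rule I_E)
  then show "x / \<pi> ^ m \<in> A" using pi_nonzero by simp
next
  assume "x / \<pi> ^ m \<in> A"
  from I_I[OF this, of m] show "x \<in> I m" using pi_nonzero by simp
qed

lemma I_subset: "x \<in> I m \<Longrightarrow> x \<in> A"
  by (elim I_E) (simp add: mult_in power_in pi_in)

lemma I_0: "I 0 = A" unfolding I_def by simp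

lemma I_zero [simp]: "0 \<in> I m" using I_I[OF zero_in] by simp

lemma I_add: "x \<in> I m \<Longrightarrow> y \<in> I m \<Longrightarrow> x + y \<in> I m"
  by (simp add: I_iff add_divide_distrib add_in)

lemma I_diff: "x \<in> I m \<Longrightarrow> y \<in> I m \<Longrightarrow> x - y \<in> I m"
  by (simp add: I_iff diff_divide_distrib diff_in)

lemma I_uminus: "x \<in> I m \<Longrightarrow> - x \<in> I m"
  using I_diff[OF I_zero] by simp

lemma I_sum: "(\<And>i. i \<in> X \<Longrightarrow> f i \<in> I m) \<Longrightarrow> sum f X \<in> I m"
  by (induction X rule: infinite_finite_induct) (simp_all add: I_add)

lemma I_mult: "x \<in> I i \<Longrightarrow> y \<in> I j \<Longrightarrow> x * y \<in> I (i + j)"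
  using mult_in[of "x / \<pi> ^ i" "y / \<pi> ^ j"] by (simp add: I_iff power_add)

lemma I_mult_left: "r \<in> A \<Longrightarrow> x \<in> I m \<Longrightarrow> r * x \<in> I m"
  using I_mult[of r 0 x m] by (simp add: I_0)

lemma I_mult_right: "r \<in> A \<Longrightarrow> x \<in> I m \<Longrightarrow> x * r \<in> I m"
  using I_mult_left by (simp add: mult.commute)

lemma I_mono:
  assumes "i \<le> j" "x \<in> I j"
  shows "x \<in> I i"
proof -
  obtain r where "r \<in> A" "x = r * \<pi> ^ j" using assms(2) by (rule I_E)
  moreover have "\<pi> ^ j = \<pi> ^ (j - i) * \<pi> ^ i" using assms(1) by (simp flip: power_add)
  ultimately have "x = (r * \<pi> ^ (j - i)) * \<pi> ^ i" "r * \<pi> ^ (j - i) \<in> A"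
    by (simp_all add: mult_in power_in pi_in)
  then show ?thesis using I_I by simp
qed

lemma I_shift: "x * \<pi> ^ j \<in> I (i + j) \<longleftrightarrow> x \<in> I i"
  using pi_nonzero by (simp add: I_iff power_add)

lemma cong_one_unit:
  assumes "m \<ge> 1" "x - 1 \<in> I m"
  shows "x \<noteq> 0" "inverse x \<in> A" "x \<in> A"
proof -
  have "x - 1 \<in> I 1" by (rule I_mono[OF assms])
  then obtain r where r: "r \<in> A" "x - 1 = r * \<pi> ^ 1" by (rule I_E)
  then have x: "x = 1 + r * \<pi>" by (simp add: algebra_simps)
  show "x \<noteq> 0" "inverse x \<in> A" unfolding x using unit_in[OF r(1)] by blast+
  show "x \<in> A" unfolding x by (intro add_in one_in mult_in r pi_in)
qed

text \<open>Digits are added one at a time: if \<open>s\<close> runs through residues modulo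
  \<open>\<pi>^k\<close> and \<open>t\<close> through residues modulo \<open>\<pi>\<close>, then
  \<open>s + t \<pi>^k\<close> runs through residues modulo \<open>\<pi>^(k + 1)\<close>.\<close>

lemma residue_system:
  "\<exists>S. S \<subseteq> A \<and> finite S \<and> card S = q ^ k \<and> (\<forall>x\<in>A. \<exists>!s. s \<in> S \<and> x - s \<in> I k)"
proof (induction k)
  case 0
  have "\<exists>!s. s \<in> {0} \<and> x - s \<in> I 0" if "x \<in> A" for x
    using that by (intro ex1I[of _ 0]) (simp_all add: I_0)
  then show ?case by (intro exI[of _ "{0}"]) (simp add: zero_in)
next
  case (Suc k)
  from Suc obtain S where S: "S \<subseteq> A" "finite S" "card S = q ^ k"
    and "\<forall>x\<in>A. \<exists>!s. s \<in> S \<and> x - s \<in> I k" by (elim exE conjE)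
  note S1 = bspec[OF this(4)]
  from residues obtain T where T: "T \<subseteq> A" "finite T" "card T = q"
    and "\<forall>x\<in>A. \<exists>!s. s \<in> T \<and> (\<exists>r\<in>A. x - s = r * \<pi>)" by (elim exE conjE)
  note T1' = bspec[OF this(4)]
  have I1: "(\<exists>r\<in>A. x = r * \<pi>) \<longleftrightarrow> x \<in> I 1" for x unfolding I_def by auto
  note T1 = T1'[unfolded I1]
  let ?h = "\<lambda>(s, t). s + t * \<pi> ^ k"
  \<comment> \<open>Reduction modulo \<open>\<pi>^k\<close> determines \<open>s\<close>; after
    subtracting \<open>s\<close> and dividing by \<open>\<pi>^k\<close>, reduction modulo
    \<open>\<pi>\<close> determines \<open>t\<close>.\<close>
  have key: "s = s' \<and> t = t'" if s: "s \<in> S" "s' \<in> S" and t: "t \<in> T" "t' \<in> T"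
    and d: "x - (s + t * \<pi> ^ k) \<in> I (Suc k)" "x - (s' + t' * \<pi> ^ k) \<in> I (Suc k)" and x: "x \<in> A" for s s' t t' x
  proof -
    have tA: "t \<in> A" "t' \<in> A" and sA: "s \<in> A" "s' \<in> A" using s t S(1) T(1) by auto
    have "x - s \<in> I k" if "x - (s + t * \<pi> ^ k) \<in> I (Suc k)" "t \<in> A" for s t
      using I_add[OF I_mono[OF _ that(1), of k] I_I[OF that(2), of k]] by simp
    then have "x - s \<in> I k" "x - s' \<in> I k" using d tA by auto
    then have ss: "s = s'" by (intro ex1_unique[OF S1[OF x]] conjI s)
    define z where "z = (x - s) / \<pi> ^ k"
    have zA: "z \<in> A" using \<open>x - s \<in> I k\<close> unfolding z_def I_iff .
    have xz: "x = s + z * \<pi> ^ k" unfolding z_def using pi_nonzero by simp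
    have "z - u \<in> I 1" if "x - (s + u * \<pi> ^ k) \<in> I (Suc k)" for u
    proof -
      have "x - (s + u * \<pi> ^ k) = (z - u) * \<pi> ^ k" unfolding xz by (simp add: algebra_simps)
      then show ?thesis using that I_shift[of "z - u" k 1] by simp
    qed
    then have "z - t \<in> I 1" "z - t' \<in> I 1" using d ss by auto
    then have "t = t'" by (intro ex1_unique[OF T1[OF zA]] conjI t)
    with ss show ?thesis by blast
  qed
  have ex: "\<exists>s\<in>S. \<exists>t\<in>T. x - (s + t * \<pi> ^ k) \<in> I (Suc k)" if x: "x \<in> A" for x
  proof -
    from S1[OF x] obtain s where s: "s \<in> S" "x - s \<in> I k" by (elim ex1E conjE)
    obtain z where z: "z \<in> A" "x - s = z * \<pi> ^ k" using s(2) by (rule I_E)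
    from T1[OF z(1)] obtain t where t: "t \<in> T" "z - t \<in> I 1" by (elim ex1E conjE)
    have "x - (s + t * \<pi> ^ k) = (z - t) * \<pi> ^ k" using z(2) by (simp add: algebra_simps)
    then have "x - (s + t * \<pi> ^ k) \<in> I (Suc k)" using t(2) I_shift[of "z - t" k 1] by simp
    then show ?thesis using s(1) t(1) by blast
  qed
  have inA: "s + t * \<pi> ^ k \<in> A" if "s \<in> S" "t \<in> T" for s t
    using that S(1) T(1) by (intro add_in mult_in power_in pi_in) auto
  have "inj_on ?h (S \<times> T)"
  proof (rule inj_onI, clarify)
    fix s t s' t' assume *: "s \<in> S" "t \<in> T" "s' \<in> S" "t' \<in> T" "s + t * \<pi> ^ k = s' + t' * \<pi> ^ k"
    have "s + t * \<pi> ^ k - (s + t * \<pi> ^ k) \<in> I (Suc k)" "s + t * \<pi> ^ k - (s' + t' * \<pi> ^ k) \<in> I (Suc k)"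
      using *(5) by simp_all
    then show "s = s' \<and> t = t'" by (rule key[OF *(1,3,2,4) _ _ inA[OF *(1,2)]])
  qed
  then have "card (?h ` (S \<times> T)) = q ^ Suc k" using S T by (simp add: card_image card_cartesian_product)
  moreover have "?h ` (S \<times> T) \<subseteq> A" using inA by auto
  moreover have "finite (?h ` (S \<times> T))" using S T by simp
  moreover have "\<exists>!s. s \<in> ?h ` (S \<times> T) \<and> x - s \<in> I (Suc k)" if x: "x \<in> A" for x
  proof -
    obtain s t where st: "s \<in> S" "t \<in> T" "x - (s + t * \<pi> ^ k) \<in> I (Suc k)" using ex[OF x] by blast
    show ?thesis
    proof (rule ex1I[of _ "s + t * \<pi> ^ k"])
      show "s + t * \<pi> ^ k \<in> ?h ` (S \<times> T) \<and> x - (s + t * \<pi> ^ k) \<in> I (Suc k)" using st by auto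
      fix u assume "u \<in> ?h ` (S \<times> T) \<and> x - u \<in> I (Suc k)"
      then obtain s' t' where u: "s' \<in> S" "t' \<in> T" "u = s' + t' * \<pi> ^ k" "x - (s' + t' * \<pi> ^ k) \<in> I (Suc k)" by auto
      show "u = s + t * \<pi> ^ k" using key[OF st(1) u(1) st(2) u(2) st(3) u(4) x] u(3) by simp
    qed
  qed
  ultimately show ?case by (intro exI[of _ "?h ` (S \<times> T)"]) simp
qed

lemma det_in:
  assumes "x \<in> carrier_mat n n" "\<And>i j. i < n \<Longrightarrow> j < n \<Longrightarrow> x $$ (i, j) \<in> A"
  shows "det x \<in> A"
proof -
  have "signof s * (\<Prod>i = 0..<n. x $$ (i, s i)) \<in> A" if "s permutes {0..<n}" for s
  proof (rule mult_in)
    show "signof s \<in> A" by (cases "sign s = (1::int)") (auto simp: sign_def one_in uminus_in)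
    show "(\<Prod>i = 0..<n. x $$ (i, s i)) \<in> A"
      using permutes_in_image[OF that] by (intro prod_in assms(2)) auto
  qed
  then show ?thesis unfolding det_def'[OF assms(1)] by (intro sum_in) simp
qed

lemma adj_mat_in:
  assumes x: "x \<in> carrier_mat n n" and A: "\<And>i j. i < n \<Longrightarrow> j < n \<Longrightarrow> x $$ (i, j) \<in> A"
    and ij: "i < n" "j < n"
  shows "adj_mat x $$ (i, j) \<in> A"
proof -
  have "mat_delete x j i \<in> carrier_mat (n - 1) (n - 1)" using x by (simp add: mat_delete_def)
  moreover have "mat_delete x j i $$ (k, l) \<in> A" if "k < n - 1" "l < n - 1" for k l
    using that x by (auto simp: mat_delete_def intro!: A)
  ultimately have "det (mat_delete x j i) \<in> A" by (rule det_in)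
  then show ?thesis
    using x ij by (simp add: adj_mat_def cofactor_def mult_in power_in uminus_in one_in)
qed

end

text \<open>\<open>C\<close> stands for the defining equations of the group over the field, and
  integrality of the entries is added in \<open>M\<close>. The determinant is only required to have
  square 1, which suffices for integral inverses.\<close>

locale pi_adic_matrix_group = pi_adic A \<pi> q for A :: "'k::field set" and \<pi> q +
  fixes n :: nat and C :: "'k mat \<Rightarrow> bool"
  assumes C_one: "C (1\<^sub>m n)"
    and C_mult: "\<And>x y. x \<in> carrier_mat n n \<Longrightarrow> y \<in> carrier_mat n n \<Longrightarrow> C x \<Longrightarrow> C y \<Longrightarrow> C (x * y)"
    and C_inverse: "\<And>x y. x \<in> carrier_mat n n \<Longrightarrow> y \<in> carrier_mat n n \<Longrightarrow> x * y = 1\<^sub>m n \<Longrightarrow> C x \<Longrightarrow> C y"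
    and C_det: "\<And>x. x \<in> carrier_mat n n \<Longrightarrow> C x \<Longrightarrow> det x * det x = 1"
begin

definition M :: "'k mat set" where
  "M = {x \<in> carrier_mat n n. (\<forall>i<n. \<forall>j<n. x $$ (i, j) \<in> A) \<and> C x}"

definition GL :: "'k mat monoid" where
  "GL = \<lparr>carrier = M, mult = (*), one = 1\<^sub>m n\<rparr>"

definition S :: "nat \<Rightarrow> 'k mat set" where
  "S m = {x \<in> M. \<forall>i<n. \<forall>j<n. x $$ (i, j) - delta i j \<in> I m}"

lemma GL_simps [simp]: "carrier GL = M" "x \<otimes>\<^bsub>GL\<^esub> y = x * y" "\<one>\<^bsub>GL\<^esub> = 1\<^sub>m n"
  by (simp_all add: GL_def)

lemma M_carrier: "x \<in> M \<Longrightarrow> x \<in> carrier_mat n n" and M_C: "x \<in> M \<Longrightarrow> C x"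
  and M_in: "x \<in> M \<Longrightarrow> i < n \<Longrightarrow> j < n \<Longrightarrow> x $$ (i, j) \<in> A"
  unfolding M_def by auto

lemma M_I: "x \<in> carrier_mat n n \<Longrightarrow> C x \<Longrightarrow> (\<And>i j. i < n \<Longrightarrow> j < n \<Longrightarrow> x $$ (i, j) \<in> A) \<Longrightarrow> x \<in> M"
  unfolding M_def by auto

lemma S_M: "x \<in> S m \<Longrightarrow> x \<in> M" and S_I: "x \<in> S m \<Longrightarrow> i < n \<Longrightarrow> j < n \<Longrightarrow> x $$ (i, j) - delta i j \<in> I m"
  unfolding S_def by auto

lemma mem_S_I:
  assumes "x \<in> carrier_mat n n" "C x" "\<And>i j. i < n \<Longrightarrow> j < n \<Longrightarrow> x $$ (i, j) - delta i j \<in> I m"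
  shows "x \<in> S m"
proof -
  have "x $$ (i, j) \<in> A" if "i < n" "j < n" for i j
  proof -
    have "delta i j \<in> A" by (simp add: delta_def one_in zero_in)
    then show ?thesis using add_in[OF I_subset[OF assms(3)[OF that]]] by fastforce
  qed
  then show ?thesis unfolding S_def using M_I[OF assms(1,2)] assms(3) by blast
qed

lemma M_mult: "x \<in> M \<Longrightarrow> y \<in> M \<Longrightarrow> x * y \<in> M"
proof (rule M_I)
  assume x: "x \<in> M" and y: "y \<in> M"
  note c = M_carrier[OF x] M_carrier[OF y]
  show "x * y \<in> carrier_mat n n" using c by simp
  show "C (x * y)" by (rule C_mult[OF c M_C[OF x] M_C[OF y]])
  show "(x * y) $$ (i, j) \<in> A" if "i < n" "j < n" for i j
    unfolding index_mult_mat_sum[OF c that] using that x y by (intro sum_in mult_in M_in) auto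
qed

text \<open>Since \<open>det x\<close> is its own inverse, \<open>det x\<close> times the adjugate
  is the inverse matrix, and its entries are polynomials in the entries of \<open>x\<close>.\<close>

lemma M_inverse:
  assumes x: "x \<in> M"
  obtains y where "y \<in> M" "x * y = 1\<^sub>m n" "y * x = 1\<^sub>m n"
proof -
  note c = M_carrier[OF x]
  define y where "y = det x \<cdot>\<^sub>m adj_mat x"
  have y: "y \<in> carrier_mat n n" unfolding y_def using adj_mat(1)[OF c] by simp
  have d: "det x * det x = 1" by (rule C_det[OF c M_C[OF x]])
  have xy: "x * y = 1\<^sub>m n"
  proof -
    have "x * y = det x \<cdot>\<^sub>m (x * adj_mat x)" unfolding y_def
      by (rule mult_smult_distrib[OF c adj_mat(1)[OF c]])
    also have "\<dots> = 1\<^sub>m n" unfolding adj_mat(2)[OF c]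
      by (rule eq_matI) (simp_all add: d mult.assoc[symmetric])
    finally show ?thesis .
  qed
  have yx: "y * x = 1\<^sub>m n" by (rule mat_mult_left_right_inverse[OF c y xy])
  have "y \<in> M"
  proof (rule M_I[OF y C_inverse[OF c y xy M_C[OF x]]])
    fix i j assume ij: "i < n" "j < n"
    have "y $$ (i, j) = det x * adj_mat x $$ (i, j)" unfolding y_def using adj_mat(1)[OF c] ij by simp
    then show "y $$ (i, j) \<in> A"
      using mult_in[OF det_in[OF c M_in[OF x]] adj_mat_in[OF c M_in[OF x] ij]] by simp
  qed
  then show thesis using that xy yx by blast
qed

lemma one_M: "1\<^sub>m n \<in> M"
  by (rule M_I) (simp_all add: C_one one_in zero_in)

lemma group_GL: "group GL"
proof (rule groupI)
  show "\<exists>y\<in>carrier GL. y \<otimes>\<^bsub>GL\<^esub> x = \<one>\<^bsub>GL\<^esub>" if "x \<in> carrier GL" for x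
    using M_inverse[of x] that by (metis GL_simps)
  show "x \<otimes>\<^bsub>GL\<^esub> y \<otimes>\<^bsub>GL\<^esub> z = x \<otimes>\<^bsub>GL\<^esub> (y \<otimes>\<^bsub>GL\<^esub> z)"
    if "x \<in> carrier GL" "y \<in> carrier GL" "z \<in> carrier GL" for x y z
    using that by (simp add: assoc_mult_mat[OF M_carrier M_carrier M_carrier])
  show "\<one>\<^bsub>GL\<^esub> \<otimes>\<^bsub>GL\<^esub> x = x" if "x \<in> carrier GL" for x
    using M_carrier[of x] that by simp
qed (simp_all add: M_mult one_M)

lemma inv_GL:
  assumes "x \<in> M"
  shows "inv\<^bsub>GL\<^esub> x \<in> M" "x * inv\<^bsub>GL\<^esub> x = 1\<^sub>m n" "inv\<^bsub>GL\<^esub> x * x = 1\<^sub>m n"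
  using group.inv_closed[OF group_GL, of x] group.r_inv[OF group_GL, of x] group.l_inv[OF group_GL, of x] assms
  by simp_all

lemma S_mult:
  assumes x: "x \<in> S m" and y: "y \<in> S m"
  shows "x * y \<in> S m"
proof -
  note xM = S_M[OF x] and yM = S_M[OF y]
  note c = M_carrier[OF xM] M_carrier[OF yM]
  have "(x * y) $$ (i, j) - delta i j \<in> I m" if ij: "i < n" "j < n" for i j
  proof -
    have "(x * y) $$ (i, j) - delta i j
      = (\<Sum>k<n. (x $$ (i, k) - delta i k) * y $$ (k, j)) + (y $$ (i, j) - delta i j)"
      unfolding index_mult_mat_sum[OF c ij] left_diff_distrib sum_subtractf using ij by simp
    also have "\<dots> \<in> I m"
      using x y ij by (intro I_add I_sum I_mult_right S_I M_in[OF yM]) auto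
    finally show ?thesis .
  qed
  then show ?thesis unfolding S_def using M_mult[OF xM yM] by blast
qed

lemma S_cong:
  assumes x: "x \<in> M" and y: "y \<in> M" and xy: "\<And>i j. i < n \<Longrightarrow> j < n \<Longrightarrow> x $$ (i, j) - y $$ (i, j) \<in> I m"
  shows "x * inv\<^bsub>GL\<^esub> y \<in> S m"
proof -
  note z = inv_GL[OF y]
  have "(x * inv\<^bsub>GL\<^esub> y) $$ (i, j) - delta i j \<in> I m" if ij: "i < n" "j < n" for i j
  proof -
    have "delta i j = 1\<^sub>m n $$ (i, j)" using ij by (simp add: delta_def)
    also have "\<dots> = (\<Sum>k<n. y $$ (i, k) * (inv\<^bsub>GL\<^esub> y) $$ (k, j))"
      unfolding z(2)[symmetric] by (rule index_mult_mat_sum[OF M_carrier[OF y] M_carrier[OF z(1)] ij])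
    finally have "(x * inv\<^bsub>GL\<^esub> y) $$ (i, j) - delta i j
      = (\<Sum>k<n. (x $$ (i, k) - y $$ (i, k)) * (inv\<^bsub>GL\<^esub> y) $$ (k, j))"
      unfolding index_mult_mat_sum[OF M_carrier[OF x] M_carrier[OF z(1)] ij]
      by (simp add: left_diff_distrib sum_subtractf)
    also have "\<dots> \<in> I m" using ij by (intro I_sum I_mult_right xy M_in[OF z(1)]) auto
    finally show ?thesis .
  qed
  then show ?thesis unfolding S_def using M_mult[OF x z(1)] by blast
qed

lemma subgroup_S: "subgroup (S m) GL"
proof (rule group.subgroupI[OF group_GL])
  show "S m \<subseteq> carrier GL" using S_M by auto
  have "1\<^sub>m n \<in> S m" unfolding S_def using one_M by (auto simp: delta_def)
  then show "S m \<noteq> {}" by blast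
  show "x \<otimes>\<^bsub>GL\<^esub> y \<in> S m" if "x \<in> S m" "y \<in> S m" for x y using S_mult[OF that] by simp
  show "inv\<^bsub>GL\<^esub> x \<in> S m" if x: "x \<in> S m" for x
  proof -
    have "1\<^sub>m n * inv\<^bsub>GL\<^esub> x \<in> S m"
    proof (rule S_cong[OF one_M S_M[OF x]])
      fix i j assume ij: "i < n" "j < n"
      have "1\<^sub>m n $$ (i, j) - x $$ (i, j) = - (x $$ (i, j) - delta i j)" using ij by (simp add: delta_def)
      then show "1\<^sub>m n $$ (i, j) - x $$ (i, j) \<in> I m" using I_uminus[OF S_I[OF x ij]] by simp
    qed
    then show ?thesis using inv_GL(1)[OF S_M[OF x]] M_carrier by (metis left_mult_one_mat)
  qed
qed

text \<open>The coset of \<open>x\<close> depends only on the residues of its entries modulo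
  \<open>\<pi>^m\<close>, and there are finitely many matrices of residues.\<close>

lemma finite_rcosets_S:
  assumes G: "subgroup G GL" and SG: "S m \<subseteq> G"
  shows "finite (rcosets\<^bsub>GL\<lparr>carrier := G\<rparr>\<^esub> (S m))"
proof -
  from residue_system[of m] obtain R where R: "finite R" "\<forall>x\<in>A. \<exists>!s. s \<in> R \<and> x - s \<in> I m"
    by (elim exE conjE)
  have "\<forall>x\<in>A. \<exists>s. s \<in> R \<and> x - s \<in> I m" using R(2) by (intro ballI ex1_implies_ex) simp
  from bchoice[OF this] obtain \<rho> where \<rho>: "\<forall>x\<in>A. \<rho> x \<in> R \<and> x - \<rho> x \<in> I m" by (elim exE)
  define key where "key x = (\<lambda>(i, j)\<in>{..<n} \<times> {..<n}. \<rho> (x $$ (i, j)))" for x :: "'k mat"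
  have GM: "G \<subseteq> M" using subgroup.subset[OF G] by simp
  have "key ` G \<subseteq> ({..<n} \<times> {..<n}) \<rightarrow>\<^sub>E R"
    unfolding key_def using \<rho> GM M_in by (auto simp: image_subset_iff)
  then have fin: "finite (key ` G)"
    by (rule finite_subset) (intro finite_PiE finite_cartesian_product finite_lessThan R(1))
  have same: "S m #>\<^bsub>GL\<^esub> x = S m #>\<^bsub>GL\<^esub> y" if x: "x \<in> G" and y: "y \<in> G" and k: "key x = key y" for x y
  proof -
    have M: "x \<in> M" "y \<in> M" using x y GM by auto
    have "x * inv\<^bsub>GL\<^esub> y \<in> S m"
    proof (rule S_cong[OF M])
      fix i j assume ij: "i < n" "j < n"
      have "key x (i, j) = key y (i, j)" using k by simp
      then have eq: "\<rho> (x $$ (i, j)) = \<rho> (y $$ (i, j))" using ij by (simp add: key_def)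
      have "x $$ (i, j) - y $$ (i, j) = (x $$ (i, j) - \<rho> (x $$ (i, j))) - (y $$ (i, j) - \<rho> (y $$ (i, j)))"
        unfolding eq by simp
      then show "x $$ (i, j) - y $$ (i, j) \<in> I m"
        using I_diff \<rho> M_in[OF M(1) ij] M_in[OF M(2) ij] by metis
    qed
    moreover have "x = (x * inv\<^bsub>GL\<^esub> y) * y"
      using M_carrier[OF M(1)] M_carrier[OF M(2)] M_carrier[OF inv_GL(1)[OF M(2)]] inv_GL(3)[OF M(2)]
      by (simp add: assoc_mult_mat[of _ n n _ n _ n])
    ultimately have "x \<in> S m #>\<^bsub>GL\<^esub> y" unfolding r_coset_def by auto
    then show ?thesis
      using group.repr_independence[OF group_GL, of x "S m" y] M(2) subgroup_S by simp
  qed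
  define \<psi> where "\<psi> z = S m #>\<^bsub>GL\<^esub> (SOME x. x \<in> G \<and> key x = z)" for z
  have "S m #>\<^bsub>GL\<^esub> x = \<psi> (key x)" if x: "x \<in> G" for x
  proof -
    have "\<exists>y. y \<in> G \<and> key y = key x" using x by blast
    from someI_ex[OF this] show ?thesis unfolding \<psi>_def by (intro same x) auto
  qed
  then have "(\<lambda>x. S m #>\<^bsub>GL\<^esub> x) ` G = \<psi> ` key ` G" unfolding image_image by (intro image_cong) auto
  moreover have "rcosets\<^bsub>GL\<lparr>carrier := G\<rparr>\<^esub> (S m) = (\<lambda>x. S m #>\<^bsub>GL\<^esub> x) ` G"
    unfolding RCOSETS_def r_coset_def by auto
  ultimately show ?thesis using fin by simp
qed

end

section \<open>Conjugation by a diagonal matrix and the subgroup it maps back\<close>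

definition diag_conj :: "nat \<Rightarrow> (nat \<Rightarrow> 'k::field) \<Rightarrow> 'k mat \<Rightarrow> 'k mat" where
  "diag_conj n w x = mat n n (\<lambda>(i, j). w i * x $$ (i, j) / w j)"

lemma diag_conj_carrier [simp]: "diag_conj n w x \<in> carrier_mat n n"
  by (simp add: diag_conj_def)

lemma diag_conj_index: "i < n \<Longrightarrow> j < n \<Longrightarrow> diag_conj n w x $$ (i, j) = w i * x $$ (i, j) / w j"
  by (simp add: diag_conj_def)

lemma diag_conj_mult:
  fixes w :: "nat \<Rightarrow> 'k::field"
  assumes w: "\<And>i. i < n \<Longrightarrow> w i \<noteq> 0" and x: "x \<in> carrier_mat n n" and y: "y \<in> carrier_mat n n"
  shows "diag_conj n w (x * y) = diag_conj n w x * diag_conj n w y"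
proof (rule eq_matI)
  fix i j assume "i < dim_row (diag_conj n w x * diag_conj n w y)" "j < dim_col (diag_conj n w x * diag_conj n w y)"
  then have ij: "i < n" "j < n" by (auto simp: diag_conj_def)
  have "diag_conj n w (x * y) $$ (i, j) = (\<Sum>k<n. w i * (x $$ (i, k) * y $$ (k, j)) / w j)"
    unfolding diag_conj_index[OF ij] index_mult_mat_sum[OF x y ij]
    by (simp add: sum_distrib_left sum_divide_distrib)
  also have "\<dots> = (\<Sum>k<n. diag_conj n w x $$ (i, k) * diag_conj n w y $$ (k, j))"
    using ij w by (intro sum.cong refl) (simp add: diag_conj_index)
  also have "\<dots> = (diag_conj n w x * diag_conj n w y) $$ (i, j)"
    by (rule index_mult_mat_sum[OF diag_conj_carrier diag_conj_carrier ij, symmetric])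
  finally show "diag_conj n w (x * y) $$ (i, j) = (diag_conj n w x * diag_conj n w y) $$ (i, j)" .
qed (auto simp: diag_conj_def)

lemma diag_conj_one:
  assumes w: "\<And>i. i < n \<Longrightarrow> w i \<noteq> 0"
  shows "diag_conj n w (1\<^sub>m n) = 1\<^sub>m n"
  by (rule eq_matI) (simp_all add: diag_conj_def w)

text \<open>In each Leibniz term the factors \<open>w i\<close> and \<open>1 / w (s i)\<close>
  cancel, because \<open>s\<close> permutes the indices.\<close>

lemma det_diag_conj:
  fixes w :: "nat \<Rightarrow> 'k::field"
  assumes w: "\<And>i. i < n \<Longrightarrow> w i \<noteq> 0" and x: "x \<in> carrier_mat n n"
  shows "det (diag_conj n w x) = det x"
  unfolding det_def'[OF x] det_def'[OF diag_conj_carrier]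
proof (rule sum.cong[OF refl])
  fix s assume "s \<in> {s. s permutes {0..<n}}"
  then have s: "s permutes {0..<n}" by simp
  have "(\<Prod>i = 0..<n. diag_conj n w x $$ (i, s i)) = (\<Prod>i = 0..<n. w i * x $$ (i, s i) / w (s i))"
    using permutes_in_image[OF s] by (intro prod.cong) (auto simp: diag_conj_index)
  also have "\<dots> = (\<Prod>i = 0..<n. w i) * (\<Prod>i = 0..<n. x $$ (i, s i)) / (\<Prod>i = 0..<n. w (s i))"
    by (simp add: prod.distrib prod_dividef)
  also have "(\<Prod>i = 0..<n. w (s i)) = (\<Prod>i = 0..<n. w i)"
    by (rule prod.permute[OF s, unfolded comp_def, symmetric])
  also have "(\<Prod>i = 0..<n. w i) * (\<Prod>i = 0..<n. x $$ (i, s i)) / (\<Prod>i = 0..<n. w i) = (\<Prod>i = 0..<n. x $$ (i, s i))"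
    using w by simp
  finally show "signof s * (\<Prod>i = 0..<n. diag_conj n w x $$ (i, s i)) = signof s * (\<Prod>i = 0..<n. x $$ (i, s i))"
    by simp
qed

text \<open>By \<open>contracting\<close>, the weight at \<open>a\<close> is more divisible by
  \<open>\<pi>\<close> than every other weight, so conjugation divides each off-diagonal entry of
  column \<open>a\<close> by a positive power of \<open>\<pi>\<close>.\<close>

locale pi_adic_conjugation = pi_adic_matrix_group A \<pi> q n C
  for A :: "'k::field set" and \<pi> q n C +
  fixes m :: nat and w :: "nat \<Rightarrow> 'k" and a :: nat
  assumes m_pos: "m \<ge> 1"
    and w_nonzero: "\<And>i. i < n \<Longrightarrow> w i \<noteq> 0"
    and C_conj: "\<And>x. x \<in> carrier_mat n n \<Longrightarrow> C x \<Longrightarrow> C (diag_conj n w x)"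
    and a_less_n: "a < n"
    and contracting: "\<And>i. i < n \<Longrightarrow> i \<noteq> a \<Longrightarrow> \<exists>l\<ge>1. w a = w i * \<pi> ^ l"
begin

abbreviation conj :: "'k mat \<Rightarrow> 'k mat" where "conj \<equiv> diag_conj n w"

text \<open>The image is required to lie in \<open>S m\<close> and not merely in the ambient group.
  So \<open>D\<close> and its index in \<open>S m\<close> are the same for every group above
  \<open>S m\<close>.\<close>

definition D :: "'k mat set" where
  "D = {x \<in> S m. conj x \<in> S m}"

lemma D_S: "x \<in> D \<Longrightarrow> x \<in> S m" and D_conj: "x \<in> D \<Longrightarrow> conj x \<in> S m"
  unfolding D_def by auto

lemma D_I:
  assumes "x \<in> S m" "\<And>i j. i < n \<Longrightarrow> j < n \<Longrightarrow> i \<noteq> j \<Longrightarrow> w i * x $$ (i, j) / w j \<in> I m"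
  shows "x \<in> D"
proof -
  note xM = S_M[OF assms(1)]
  have "conj x \<in> S m"
  proof (rule mem_S_I[OF diag_conj_carrier C_conj[OF M_carrier[OF xM] M_C[OF xM]]])
    fix i j assume ij: "i < n" "j < n"
    show "conj x $$ (i, j) - delta i j \<in> I m"
    proof (cases "i = j")
      case True
      then show ?thesis using S_I[OF assms(1) ij] w_nonzero[OF ij(1)] ij by (simp add: diag_conj_index)
    next
      case False
      then show ?thesis using assms(2)[OF ij] ij by (simp add: diag_conj_index)
    qed
  qed
  then show ?thesis unfolding D_def using assms(1) by simp
qed

lemma D_E:
  assumes "x \<in> D" "i < n" "j < n" "i \<noteq> j"
  shows "w i * x $$ (i, j) / w j \<in> I m"
  using S_I[OF D_conj[OF assms(1)] assms(2,3)] assms(2-4) by (simp add: diag_conj_index)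

lemma subgroup_D: "subgroup D GL"
proof (rule group.subgroupI[OF group_GL])
  show "D \<subseteq> carrier GL" using D_S S_M by auto
  have one: "1\<^sub>m n \<in> S m" using subgroup.one_closed[OF subgroup_S] by simp
  then show "D \<noteq> {}" unfolding D_def using diag_conj_one[of n w, OF w_nonzero] by force
  show "x \<otimes>\<^bsub>GL\<^esub> y \<in> D" if x: "x \<in> D" and y: "y \<in> D" for x y
    using S_mult[OF D_S[OF x] D_S[OF y]] S_mult[OF D_conj[OF x] D_conj[OF y]]
      diag_conj_mult[of n w, OF w_nonzero M_carrier[OF S_M[OF D_S[OF x]]] M_carrier[OF S_M[OF D_S[OF y]]]]
    unfolding D_def by simp
  show "inv\<^bsub>GL\<^esub> x \<in> D" if x: "x \<in> D" for x
  proof -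
    note xM = S_M[OF D_S[OF x]] and cM = S_M[OF D_conj[OF x]]
    have y: "inv\<^bsub>GL\<^esub> x \<in> S m" by (rule subgroup.m_inv_closed[OF subgroup_S D_S[OF x]])
    note yM = S_M[OF y]
    have z: "inv\<^bsub>GL\<^esub> (conj x) \<in> S m" by (rule subgroup.m_inv_closed[OF subgroup_S D_conj[OF x]])
    have "conj x * conj (inv\<^bsub>GL\<^esub> x) = 1\<^sub>m n"
      using diag_conj_mult[of n w, OF w_nonzero M_carrier[OF xM] M_carrier[OF yM]] inv_GL(2)[OF xM]
        diag_conj_one[of n w, OF w_nonzero] by simp
    then have "inv\<^bsub>GL\<^esub> (conj x) * (conj x * conj (inv\<^bsub>GL\<^esub> x)) = inv\<^bsub>GL\<^esub> (conj x)"
      using M_carrier[OF S_M[OF z]] by simp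
    moreover have "inv\<^bsub>GL\<^esub> (conj x) * (conj x * conj (inv\<^bsub>GL\<^esub> x)) = conj (inv\<^bsub>GL\<^esub> x)"
      unfolding assoc_mult_mat[OF M_carrier[OF S_M[OF z]] M_carrier[OF cM] diag_conj_carrier, symmetric]
        inv_GL(3)[OF cM] by (rule left_mult_one_mat[OF diag_conj_carrier])
    ultimately show ?thesis using y z unfolding D_def by simp
  qed
qed

text \<open>All iterates of \<open>conj\<close> stay in \<open>N\<close>, so they have integral
  entries, while the \<open>r\<close>-th iterate divides the entry by \<open>\<pi>^(l r)\<close>. An
  entry that survives every division is zero by separatedness.\<close>

lemma column_vanishes:
  assumes N: "N \<subseteq> D" "conj ` N \<subseteq> N" and x: "x \<in> N" and i: "i < n" "i \<noteq> a"
  shows "x $$ (i, a) = 0"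
proof (rule separated)
  fix r
  obtain l where l: "l \<ge> 1" "w a = w i * \<pi> ^ l" using contracting[OF i] by blast
  have it: "(conj ^^ r) x \<in> N" for r by (induction r) (use x N(2) in auto)
  have "(conj ^^ r) x $$ (i, a) = x $$ (i, a) / \<pi> ^ (l * r)"
  proof (induction r)
    case (Suc r)
    have "(conj ^^ Suc r) x $$ (i, a) = w i * (conj ^^ r) x $$ (i, a) / w a"
      using diag_conj_index[OF i(1) a_less_n] by simp
    also have "\<dots> = x $$ (i, a) / \<pi> ^ (l * Suc r)"
      unfolding Suc.IH l(2) using w_nonzero[OF i(1)] pi_nonzero by (simp add: power_add)
    finally show ?case .
  qed simp
  moreover have "(conj ^^ r) x $$ (i, a) \<in> A"
    using it[of r] N(1) D_S S_M M_in[OF _ i(1) a_less_n] by blast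
  ultimately have "x $$ (i, a) / \<pi> ^ (l * r) \<in> A" by simp
  then have "x $$ (i, a) \<in> I (l * r)" unfolding I_iff .
  then have "x $$ (i, a) \<in> I r" using l(1) by (intro I_mono[of r "l * r"]) auto
  then show "\<exists>s\<in>A. x $$ (i, a) = s * \<pi> ^ r" unfolding I_def by auto
qed

text \<open>Since \<open>x\<close> and the unipotent factor \<open>\<tau> u\<close> lie in the same
  left coset of \<open>D\<close>, a set of representatives for the unipotent parameters represents
  all cosets. Here \<open>Q\<close> singles out the admissible parameters and \<open>h\<close> sends
  an index in the finite set \<open>P\<close> to its parameter.\<close>

lemma coset_transversal:
  assumes dec: "\<And>x. x \<in> S m \<Longrightarrow> \<exists>u. Q u \<and> (\<exists>y\<in>D. x = \<tau> u * y)"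
    and \<tau>: "\<And>u. Q u \<Longrightarrow> \<tau> u \<in> S m" and P: "\<And>t. t \<in> P \<Longrightarrow> Q (h t)"
    and ex1: "\<And>u. Q u \<Longrightarrow> \<exists>!t. t \<in> P \<and> (\<exists>y\<in>D. \<tau> u = \<tau> (h t) * y)"
    and x: "x \<in> S m"
  shows "\<exists>!t. t \<in> P \<and> (\<exists>y\<in>D. x = \<tau> (h t) * y)"
proof -
  from dec[OF x] obtain u y where u: "Q u" and y: "y \<in> D" "x = \<tau> u * y"
    by (elim exE conjE bexE)
  note yM = S_M[OF D_S[OF y(1)]]
  note yc = M_carrier[OF yM] and uc = M_carrier[OF S_M[OF \<tau>[OF u]]]
  have key: "(\<exists>y\<in>D. x = \<tau> (h t) * y) \<longleftrightarrow> (\<exists>y\<in>D. \<tau> u = \<tau> (h t) * y)" if t: "t \<in> P" for t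
  proof
    note tc = M_carrier[OF S_M[OF \<tau>[OF P[OF t]]]]
    assume "\<exists>y\<in>D. x = \<tau> (h t) * y"
    then obtain z where z: "z \<in> D" "x = \<tau> (h t) * z" by (elim bexE)
    note zc = M_carrier[OF S_M[OF D_S[OF z(1)]]]
    have yi: "inv\<^bsub>GL\<^esub> y \<in> D" by (rule subgroup.m_inv_closed[OF subgroup_D y(1)])
    note ic = M_carrier[OF inv_GL(1)[OF yM]]
    have "\<tau> u = \<tau> u * (y * inv\<^bsub>GL\<^esub> y)"
      unfolding inv_GL(2)[OF yM] by (rule right_mult_one_mat[OF uc, symmetric])
    also have "\<dots> = x * inv\<^bsub>GL\<^esub> y" unfolding y(2) by (rule assoc_mult_mat[OF uc yc ic, symmetric])
    also have "\<dots> = \<tau> (h t) * (z * inv\<^bsub>GL\<^esub> y)"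
      unfolding z(2) by (rule assoc_mult_mat[OF tc zc ic])
    finally show "\<exists>y\<in>D. \<tau> u = \<tau> (h t) * y"
      using subgroup.m_closed[OF subgroup_D z(1) yi] by (intro bexI[of _ "z * inv\<^bsub>GL\<^esub> y"]) simp_all
  next
    note tc = M_carrier[OF S_M[OF \<tau>[OF P[OF t]]]]
    assume "\<exists>y\<in>D. \<tau> u = \<tau> (h t) * y"
    then obtain z where z: "z \<in> D" "\<tau> u = \<tau> (h t) * z" by (elim bexE)
    note zc = M_carrier[OF S_M[OF D_S[OF z(1)]]]
    have "x = \<tau> (h t) * (z * y)"
      unfolding y(2) z(2) by (rule assoc_mult_mat[OF tc zc yc])
    then show "\<exists>y\<in>D. x = \<tau> (h t) * y"
      using subgroup.m_closed[OF subgroup_D z(1) y(1)] by (intro bexI[of _ "z * y"]) simp_all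
  qed
  show ?thesis
  proof (rule ex1_iff_cong[OF _ ex1[OF u]])
    fix t show "t \<in> P \<and> (\<exists>y\<in>D. x = \<tau> (h t) * y) \<longleftrightarrow> t \<in> P \<and> (\<exists>y\<in>D. \<tau> u = \<tau> (h t) * y)"
      by (intro conj_cong refl key)
  qed
qed

text \<open>Simplicity is reduced to the hypothesis \<open>rigid\<close>. For \<open>x\<close> in a
  stable normal subgroup and \<open>g \<in> S m\<close>, the conjugate \<open>y\<close> of
  \<open>x\<close> by \<open>g\<close> has column \<open>a\<close> supported at \<open>a\<close>.
  Comparing column \<open>a\<close> in \<open>g * y = x * g\<close> shows that column
  \<open>a\<close> of \<open>g\<close> is an eigenvector of \<open>x\<close>, with eigenvalue
  \<open>y $$ (a, a)\<close> congruent to 1.\<close>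

theorem self_similar_index:
  assumes G: "subgroup G GL" and SG: "S m \<subseteq> G"
    and P: "finite P" and \<tau>: "\<And>t. t \<in> P \<Longrightarrow> \<tau> t \<in> S m"
    and transversal: "\<And>x. x \<in> S m \<Longrightarrow> \<exists>!t. t \<in> P \<and> (\<exists>y\<in>D. x = \<tau> t * y)"
    and rigid: "\<And>x. x \<in> S m \<Longrightarrow>
      (\<And>g. g \<in> S m \<Longrightarrow> \<exists>r. r - 1 \<in> I m \<and> (\<forall>i<n. (\<Sum>j<n. g $$ (j, a) * x $$ (i, j)) = r * g $$ (i, a))) \<Longrightarrow>
      x = 1\<^sub>m n"
  shows "self_similar_of_index (GL\<lparr>carrier := G\<rparr>)
    (card (rcosets\<^bsub>GL\<lparr>carrier := G\<rparr>\<^esub> (S m)) * card P)"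
proof -
  let ?G = "GL\<lparr>carrier := G\<rparr>"
  interpret GL: group GL by (rule group_GL)
  have grp: "group ?G" by (rule subgroup.subgroup_is_group[OF G group_GL])
  have SG': "subgroup (S m) ?G" by (rule GL.subgroup_incl[OF subgroup_S G SG])
  have DG: "D \<subseteq> G" using D_S SG by blast
  have DG': "subgroup D ?G" by (rule GL.subgroup_incl[OF subgroup_D G DG])
  have inv_eq: "inv\<^bsub>?G\<^esub> x = inv\<^bsub>GL\<^esub> x" if "x \<in> G" for x
    by (rule GL.m_inv_consistent[OF G that])
  have one_D: "1\<^sub>m n \<in> D" using subgroup.one_closed[OF subgroup_D] by simp
  have D_iff: "inv\<^bsub>?G\<^esub> t \<otimes>\<^bsub>?G\<^esub> x \<in> D \<longleftrightarrow> (\<exists>y\<in>D. x = t * y)" if t: "t \<in> S m" and x: "x \<in> S m" for t x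
  proof -
    note tM = S_M[OF t] and xM = S_M[OF x]
    note c = M_carrier[OF tM] M_carrier[OF xM] M_carrier[OF inv_GL(1)[OF tM]]
    have i: "inv\<^bsub>?G\<^esub> t \<otimes>\<^bsub>?G\<^esub> x = inv\<^bsub>GL\<^esub> t * x" using inv_eq t SG by auto
    have 1: "t * (inv\<^bsub>GL\<^esub> t * x) = x"
      using assoc_mult_mat[OF c(1,3,2)] inv_GL(2)[OF tM] c by simp
    have 2: "inv\<^bsub>GL\<^esub> t * (t * y) = y" if "y \<in> D" for y
      using assoc_mult_mat[OF c(3,1) M_carrier[OF S_M[OF D_S[OF that]]]] inv_GL(3)[OF tM]
        M_carrier[OF S_M[OF D_S[OF that]]] by simp
    show ?thesis unfolding i
    proof
      assume "inv\<^bsub>GL\<^esub> t * x \<in> D"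
      then show "\<exists>y\<in>D. x = t * y" by (rule bexI[of "\<lambda>y. x = t * y", OF 1[symmetric]])
    next
      assume "\<exists>y\<in>D. x = t * y"
      then obtain y where "y \<in> D" "x = t * y" by (elim bexE)
      then show "inv\<^bsub>GL\<^esub> t * x \<in> D" using 2 by simp
    qed
  qed
  \<comment> \<open>The index is counted on the set of representatives. As
    \<open>1\<^sub>m n\<close> lies in \<open>D\<close>, indices with equal representatives
    represent the same coset and so agree.\<close>
  have inj: "inj_on \<tau> P"
  proof (rule inj_onI)
    fix t u assume tu: "t \<in> P" "u \<in> P" "\<tau> t = \<tau> u"
    have c: "\<tau> t = \<tau> t * 1\<^sub>m n" using M_carrier[OF S_M[OF \<tau>[OF tu(1)]]] by simp
    have "\<exists>y\<in>D. \<tau> t = \<tau> t * y" by (rule bexI[of "\<lambda>y. \<tau> t = \<tau> t * y", OF c one_D])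
    moreover have "\<exists>y\<in>D. \<tau> t = \<tau> u * y" unfolding tu(3)[symmetric] by (rule bexI[of "\<lambda>y. \<tau> t = \<tau> t * y", OF c one_D])
    ultimately show "t = u"
      by (intro ex1_unique[OF transversal[OF \<tau>[OF tu(1)]]] conjI tu(1,2))
  qed
  have "self_similar_of_index ?G (card (rcosets\<^bsub>?G\<^esub> (S m)) * card (\<tau> ` P))"
  proof (rule group.self_similar_of_subgroup_endomorphism[OF grp SG' finite_rcosets_S[OF G SG] DG' _ _ _ finite_imageI[OF P]])
    show "D \<subseteq> S m" using D_S by blast
    show "conj x \<in> carrier ?G" if "x \<in> D" for x using D_conj[OF that] SG by auto
    show "conj (x \<otimes>\<^bsub>?G\<^esub> y) = conj x \<otimes>\<^bsub>?G\<^esub> conj y" if "x \<in> D" "y \<in> D" for x y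
      using diag_conj_mult[of n w, OF w_nonzero M_carrier[OF S_M[OF D_S[OF that(1)]]] M_carrier[OF S_M[OF D_S[OF that(2)]]]]
      by simp
    show "\<tau> ` P \<subseteq> S m" using \<tau> by blast
    show "\<exists>!t. t \<in> \<tau> ` P \<and> inv\<^bsub>?G\<^esub> t \<otimes>\<^bsub>?G\<^esub> x \<in> D" if x: "x \<in> S m" for x
    proof -
      from transversal[OF x] obtain t where t: "t \<in> P" "\<exists>y\<in>D. x = \<tau> t * y" by (elim ex1E conjE)
      show ?thesis
      proof (rule ex1I[of _ "\<tau> t"])
        show "\<tau> t \<in> \<tau> ` P \<and> inv\<^bsub>?G\<^esub> \<tau> t \<otimes>\<^bsub>?G\<^esub> x \<in> D"
          unfolding D_iff[OF \<tau>[OF t(1)] x] by (intro conjI imageI t)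
        fix z assume z: "z \<in> \<tau> ` P \<and> inv\<^bsub>?G\<^esub> z \<otimes>\<^bsub>?G\<^esub> x \<in> D"
        then obtain u where u: "z = \<tau> u" "u \<in> P" by (elim conjE imageE)
        have "\<exists>y\<in>D. x = \<tau> u * y" using z unfolding u(1) D_iff[OF \<tau>[OF u(2)] x] by (rule conjunct2)
        then have "u = t" by (intro ex1_unique[OF transversal[OF x]] conjI t u(2))
        then show "z = \<tau> t" using u(1) by simp
      qed
    qed
    fix N assume N: "N \<lhd> ?G" "N \<subseteq> D" "conj ` N \<subseteq> N"
    show "N \<subseteq> {\<one>\<^bsub>?G\<^esub>}"
    proof
      fix x assume x: "x \<in> N"
      have xS: "x \<in> S m" using x N(2) D_S by blast
      note xM = S_M[OF xS]
      have "x = 1\<^sub>m n"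
      proof (rule rigid[OF xS])
        fix g assume g: "g \<in> S m"
        note gM = S_M[OF g] and gG = subsetD[OF SG g]
        define y where "y = inv\<^bsub>GL\<^esub> g * x * g"
        have yN: "y \<in> N"
          using normal.inv_op_closed1[OF N(1), of g x] gG x inv_eq[OF gG] unfolding y_def by simp
        have yS: "y \<in> S m" using yN N(2) D_S by blast
        note yc = M_carrier[OF S_M[OF yS]]
        note c = M_carrier[OF gM] M_carrier[OF xM] M_carrier[OF inv_GL(1)[OF gM]]
        have "g * y = g * inv\<^bsub>GL\<^esub> g * x * g" unfolding y_def using c by (simp add: assoc_mult_mat[of _ n n _ n _ n])
        then have gy: "g * y = x * g" using inv_GL(2)[OF gM] c by simp
        have "(\<Sum>j<n. g $$ (j, a) * x $$ (i, j)) = y $$ (a, a) * g $$ (i, a)" if i: "i < n" for i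
        proof -
          have "(\<Sum>j<n. g $$ (j, a) * x $$ (i, j)) = (x * g) $$ (i, a)"
            unfolding index_mult_mat_sum[OF c(2,1) i a_less_n] by (simp add: mult.commute)
          also have "\<dots> = (\<Sum>j<n. g $$ (i, j) * y $$ (j, a))"
            unfolding gy[symmetric] by (rule index_mult_mat_sum[OF c(1) yc i a_less_n])
          also have "\<dots> = (\<Sum>j<n. (g $$ (i, j) * y $$ (a, a)) * delta j a)"
            using column_vanishes[OF N(2,3) yN] by (intro sum.cong) (auto simp: delta_def)
          also have "\<dots> = g $$ (i, a) * y $$ (a, a)" using a_less_n by (rule sum_delta_mult)
          finally show ?thesis by (simp add: mult.commute)
        qed
        moreover have "y $$ (a, a) - 1 \<in> I m" using S_I[OF yS a_less_n a_less_n] by simp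
        ultimately show "\<exists>r. r - 1 \<in> I m \<and> (\<forall>i<n. (\<Sum>j<n. g $$ (j, a) * x $$ (i, j)) = r * g $$ (i, a))"
          by (intro exI[of _ "y $$ (a, a)"]) simp
      qed
      then show "x \<in> {\<one>\<^bsub>?G\<^esub>}" by simp
    qed
  qed
  then show ?thesis unfolding card_image[OF inj] .
qed

end

section \<open>Isometry groups\<close>

definition mat_app :: "nat \<Rightarrow> 'k::field mat \<Rightarrow> (nat \<Rightarrow> 'k) \<Rightarrow> nat \<Rightarrow> 'k" where
  "mat_app n x u i = (\<Sum>j<n. u j * x $$ (i, j))"

lemma mat_app_lin: "mat_app n x (\<lambda>i. u i + r * v i) i = mat_app n x u i + r * mat_app n x v i"
  unfolding mat_app_def by (simp add: algebra_simps sum.distrib sum_distrib_left)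

lemma mat_app_delta: "j < n \<Longrightarrow> mat_app n x (delta j) i = x $$ (i, j)"
  unfolding mat_app_def by simp

context pi_adic
begin

text \<open>Coordinatewise, \<open>v i / \<pi>^m\<close> is reduced modulo \<open>\<pi>^k\<close>.
  Extensional functions make the representative unique and let \<open>card_PiE\<close> count
  them.\<close>

lemma residue_vectors:
  assumes W: "finite W" and Sk: "\<forall>x\<in>A. \<exists>!s. s \<in> Sk \<and> x - s \<in> I k" and v: "\<And>i. i \<in> W \<Longrightarrow> v i \<in> I m"
  shows "\<exists>!g. g \<in> W \<rightarrow>\<^sub>E Sk \<and> (\<forall>i\<in>W. v i - g i * \<pi> ^ m \<in> I (m + k))"
proof -
  have ex: "\<exists>!s. s \<in> Sk \<and> v i - s * \<pi> ^ m \<in> I (m + k)" if i: "i \<in> W" for i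
  proof -
    have "v i - s * \<pi> ^ m = (v i / \<pi> ^ m - s) * \<pi> ^ m" for s using pi_nonzero by (simp add: algebra_simps)
    then have "v i - s * \<pi> ^ m \<in> I (m + k) \<longleftrightarrow> v i / \<pi> ^ m - s \<in> I k" for s
      using I_shift[of "v i / \<pi> ^ m - s" m k] by (simp add: add.commute)
    moreover have "v i / \<pi> ^ m \<in> A" using v[OF i] unfolding I_iff .
    ultimately show ?thesis using Sk by simp
  qed
  have "\<forall>i\<in>W. \<exists>s. s \<in> Sk \<and> v i - s * \<pi> ^ m \<in> I (m + k)" by (intro ballI ex1_implies_ex ex)
  from bchoice[OF this] obtain g where g: "\<forall>i\<in>W. g i \<in> Sk \<and> v i - g i * \<pi> ^ m \<in> I (m + k)" by (elim exE)
  show ?thesis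
  proof (rule ex1I[of _ "restrict g W"])
    show "restrict g W \<in> W \<rightarrow>\<^sub>E Sk \<and> (\<forall>i\<in>W. v i - restrict g W i * \<pi> ^ m \<in> I (m + k))" using g by auto
    fix h assume h: "h \<in> W \<rightarrow>\<^sub>E Sk \<and> (\<forall>i\<in>W. v i - h i * \<pi> ^ m \<in> I (m + k))"
    show "h = restrict g W"
    proof (rule extensionalityI[of _ W])
      show "h \<in> extensional W" using h by (auto simp: PiE_def)
      show "restrict g W \<in> extensional W" by simp
      fix i assume i: "i \<in> W"
      have "h i = g i" by (rule ex1_unique[OF ex[OF i]]) (use h g i in auto)
      then show "h i = restrict g W i" using i by simp
    qed
  qed
qed

text \<open>The other root \<open>r = -1\<close> would make \<open>-2\<close> a multiple of
  \<open>\<pi>\<close>, although 2 is a unit.\<close>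

lemma square_one_cong_one: "inverse 2 \<in> A \<Longrightarrow> (2::'k) \<noteq> 0 \<Longrightarrow> r - 1 \<in> I m \<Longrightarrow> m \<ge> 1 \<Longrightarrow> r * r = 1 \<Longrightarrow> r = 1"
proof -
  assume h: "inverse 2 \<in> A" "(2::'k) \<noteq> 0" and r: "r - 1 \<in> I m" "m \<ge> 1" "r * r = 1"
  have "(r - 1) * (r + 1) = 0" using r(3) by (simp add: algebra_simps)
  moreover have "r + 1 \<noteq> 0"
  proof
    assume "r + 1 = 0"
    then have r1: "r = - 1" by (simp add: eq_neg_iff_add_eq_0)
    have "- (r - 1) * inverse 2 = 1" unfolding r1 using h(2) by simp
    moreover have "- (r - 1) * inverse 2 \<in> I 1"
      using I_mono[OF r(2,1)] by (intro I_mult_right[OF h(1)] I_uminus)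
    ultimately have "1 \<in> I 1" by (simp only:)
    then obtain s where s: "s \<in> A" "1 = s * \<pi> ^ 1" by (rule I_E)
    have "1 + (- s) * \<pi> = 0" using s(2) by simp
    then show False using unit_in[OF uminus_in[OF s(1)]] by blast
  qed
  ultimately show "r = 1" by simp
qed

end

text \<open>The flag \<open>special\<close> chooses between the symmetric form with the determinant
  condition and the alternating form, so that \<open>Sp\<close> and \<open>SO\<close> share
  everything up to the choice of transversal and the rigidity argument.\<close>

locale pi_adic_form = pi_adic A \<pi> q + monomial_form n \<sigma> \<epsilon> \<eta> a b
  for A :: "'k::field set" and \<pi> q n \<sigma> and \<epsilon> :: "nat \<Rightarrow> 'k" and \<eta> a b +
  fixes special :: bool and m k :: nat
  assumes \<eta>_eq: "\<eta> = (if special then 1 else - 1)"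
    and two_nonzero: "(2::'k) \<noteq> 0" and half_in: "inverse 2 \<in> A"
    and m1: "m \<ge> 1" and k1: "k \<ge> 1"
begin

definition isometry :: "'k mat \<Rightarrow> bool" where
  "isometry x \<longleftrightarrow> preserves x \<and> (special \<longrightarrow> det x = 1)"

definition weight :: "nat \<Rightarrow> 'k" where
  "weight i = (if i = a then \<pi> ^ k else if i = b then 1 / \<pi> ^ k else 1)"

lemma weight_nonzero: "weight i \<noteq> 0"
  using pi_nonzero by (simp add: weight_def)

lemma weight_\<sigma>: "i < n \<Longrightarrow> weight i * weight (\<sigma> i) = 1"
  using \<sigma>_eq_iff[OF _ a_less, of i] \<sigma>_eq_iff[OF _ b_less, of i] \<sigma>_a \<sigma>_b a_b pi_nonzero
  by (auto simp: weight_def)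

lemma preserves_one: "preserves (1\<^sub>m n)"
  unfolding preserves_def using gram_carrier by simp

lemma preserves_mult:
  assumes x: "x \<in> carrier_mat n n" and y: "y \<in> carrier_mat n n" and "preserves x" "preserves y"
  shows "preserves (x * y)"
proof -
  have "transpose_mat (x * y) * gram * (x * y) = transpose_mat y * (transpose_mat x * gram * x) * y"
    using x y gram_carrier by (simp add: transpose_mult[OF x y] assoc_mult_mat[of _ n n _ n _ n])
  then show ?thesis using assms(3,4) unfolding preserves_def by simp
qed

lemma preserves_inverse:
  assumes x: "x \<in> carrier_mat n n" and y: "y \<in> carrier_mat n n" and xy: "x * y = 1\<^sub>m n" and "preserves x"
  shows "preserves y"
proof -
  have "transpose_mat y * gram * y = transpose_mat y * (transpose_mat x * gram * x) * y"
    using assms(4) unfolding preserves_def by simp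
  also have "\<dots> = transpose_mat (x * y) * gram * (x * y)"
    using x y gram_carrier by (simp add: transpose_mult[OF x y] assoc_mult_mat[of _ n n _ n _ n])
  also have "\<dots> = gram" unfolding xy using gram_carrier by simp
  finally show ?thesis unfolding preserves_def .
qed

lemma preserves_diag_conj:
  assumes x: "x \<in> carrier_mat n n" and "preserves x"
  shows "preserves (diag_conj n weight x)"
  unfolding preserves_iff[OF diag_conj_carrier]
proof (intro allI impI)
  fix i j assume ij: "i < n" "j < n"
  let ?c = "diag_conj n weight x"
  have "B (\<lambda>l. ?c $$ (l, i)) (\<lambda>l. ?c $$ (l, j))
      = (\<Sum>l<n. (weight l * weight (\<sigma> l)) * (\<epsilon> l * x $$ (l, i) * x $$ (\<sigma> l, j)) / (weight i * weight j))"
    unfolding B_def using ij \<sigma>_less by (intro sum.cong) (auto simp: diag_conj_index)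
  also have "\<dots> = B (\<lambda>l. x $$ (l, i)) (\<lambda>l. x $$ (l, j)) / (weight i * weight j)"
    unfolding B_def sum_divide_distrib by (intro sum.cong) (auto simp: weight_\<sigma>)
  also have "\<dots> = B (delta i) (delta j) / (weight i * weight j)"
    using assms(2) ij unfolding preserves_iff[OF x] by simp
  also have "\<dots> = B (delta i) (delta j)"
  proof (cases "\<sigma> j = i")
    case True
    then have "weight i * weight j = 1" using weight_\<sigma>[OF ij(2)] by (simp add: mult.commute)
    then show ?thesis by simp
  next
    case False
    then show ?thesis using ij by (simp add: B_delta_right delta_def)
  qed
  finally show "B (\<lambda>l. ?c $$ (l, i)) (\<lambda>l. ?c $$ (l, j)) = B (delta i) (delta j)" .
qed

sublocale pi_adic_matrix_group A \<pi> q n isometry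
proof
  show "isometry (1\<^sub>m n)" unfolding isometry_def using preserves_one by simp
  show "isometry (x * y)" if "x \<in> carrier_mat n n" "y \<in> carrier_mat n n" "isometry x" "isometry y" for x y
    using preserves_mult[OF that(1,2)] det_mult[OF that(1,2)] that(3,4) unfolding isometry_def by simp
  show "isometry y" if x: "x \<in> carrier_mat n n" and y: "y \<in> carrier_mat n n" and xy: "x * y = 1\<^sub>m n" and "isometry x" for x y
  proof -
    have "det x * det y = 1" using det_mult[OF x y] unfolding xy by simp
    then show ?thesis using preserves_inverse[OF x y xy] \<open>isometry x\<close> unfolding isometry_def by auto
  qed
  show "det x * det x = 1" if "x \<in> carrier_mat n n" "isometry x" for x
    using det_preserves[OF that(1)] that(2) unfolding isometry_def by blast
qed

sublocale pi_adic_conjugation A \<pi> q n isometry m weight a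
proof
  show "isometry (diag_conj n weight x)" if "x \<in> carrier_mat n n" "isometry x" for x
    using preserves_diag_conj[OF that(1)] det_diag_conj[of n weight, OF weight_nonzero that(1)] that(2)
    unfolding isometry_def by simp
  show "\<exists>l\<ge>1. weight a = weight i * \<pi> ^ l" if "i < n" "i \<noteq> a" for i
  proof (cases "i = b")
    case True
    have "\<pi> ^ (2 * k) = \<pi> ^ k * \<pi> ^ k" by (simp add: mult_2 power_add)
    then have "weight a = weight i * \<pi> ^ (2 * k)"
      using True a_b pi_nonzero by (simp add: weight_def)
    then show ?thesis using k1 by (intro exI[of _ "2 * k"]) simp
  next
    case False
    then have "weight a = weight i * \<pi> ^ k" using that by (simp add: weight_def)
    then show ?thesis using k1 by (intro exI[of _ k]) simp
  qed
qed (use m1 a_less weight_nonzero in simp_all)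

text \<open>These parameters give the opposite unipotent elements of \<open>S m\<close>. The last
  clause is the isotropy condition: it holds automatically for an alternating form and reads
  \<open>2 * c = - B v v\<close> for a symmetric one.\<close>

definition valid :: "(nat \<Rightarrow> 'k) \<Rightarrow> 'k \<Rightarrow> bool" where
  "valid v c \<longleftrightarrow> v a = 0 \<and> v b = 0 \<and> (\<forall>i<n. v i \<in> I m) \<and> c \<in> I m \<and> c * (1 + \<eta>) + B v v = 0"

lemma validD:
  assumes "valid v c"
  shows "v a = 0" "v b = 0" "i < n \<Longrightarrow> v i \<in> I m" "c \<in> I m" "c * (1 + \<eta>) + B v v = 0"
  using assms unfolding valid_def by auto

lemma sign_in: "i < n \<Longrightarrow> \<epsilon> i \<in> A"
proof -
  assume "i < n"
  then have "(\<epsilon> i - 1) * (\<epsilon> i + 1) = 0" using \<epsilon>_square by (simp add: algebra_simps)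
  then have "\<epsilon> i = 1 \<or> \<epsilon> i = - 1" by (simp add: eq_neg_iff_add_eq_0)
  then show ?thesis using one_in uminus_in[OF one_in] by auto
qed

lemma B_in_I:
  assumes "\<And>i. i < n \<Longrightarrow> u i \<in> I r" "\<And>i. i < n \<Longrightarrow> v i \<in> I s"
  shows "B u v \<in> I (r + s)"
  unfolding B_def using assms \<sigma>_less sign_in
  by (intro I_sum I_mult I_mult_left) auto

lemma transvection_delta_a:
  assumes "v b = 0"
  shows "transvection v c (delta a) i = delta a i + v i + c * delta b i"
proof -
  have "B v (delta a) = 0" using assms B_a_right by simp
  then show ?thesis by (simp add: transvection_def)
qed

lemma transvection_delta:
  assumes "j < n" "j \<noteq> a"
  shows "transvection v c (delta j) i = delta j i - \<epsilon> (\<sigma> j) * v (\<sigma> j) * delta b i"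
proof -
  have "delta j a = (0::'k)" using assms by (simp add: delta_def)
  then show ?thesis using B_delta_right[OF assms(1)] by (simp add: transvection_def)
qed

lemma tmat_S:
  assumes "valid v c"
  shows "tmat v c \<in> S m"
proof (rule mem_S_I[OF tmat_carrier])
  note v = validD[OF assms]
  show "isometry (tmat v c)"
    unfolding isometry_def using tmat_preserves[OF v(1,2,5)] det_tmat[OF v(1,2) two_nonzero _ v(5)] \<eta>_eq by simp
  fix i j assume ij: "i < n" "j < n"
  have d: "x * delta b i \<in> I m" if "x \<in> I m" for x using that by (simp add: delta_def)
  show "tmat v c $$ (i, j) - delta i j \<in> I m"
  proof (cases "j = a")
    case True
    have "tmat v c $$ (i, j) - delta i j = v i + c * delta b i"
      using ij True transvection_delta_a[of v, OF v(2)] by (simp add: tmat_index delta_def)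
    then show ?thesis using I_add[OF v(3)[OF ij(1)] d[OF v(4)]] by simp
  next
    case False
    have "tmat v c $$ (i, j) - delta i j = - (\<epsilon> (\<sigma> j) * v (\<sigma> j) * delta b i)"
      using ij False transvection_delta[OF ij(2) False] by (simp add: tmat_index delta_def)
    moreover have "\<epsilon> (\<sigma> j) * v (\<sigma> j) \<in> I m"
      using \<sigma>_less[OF ij(2)] by (intro I_mult_left sign_in v(3))
    ultimately show ?thesis using I_uminus[OF d] by simp
  qed
qed

lemma B_minus: "B (\<lambda>i. - u i) (\<lambda>i. - u i) = B u u" "B u (\<lambda>i. - v i) = - B u v" "B (\<lambda>i. - u i) v = - B u v"
  unfolding B_def by (simp_all add: sum_negf)

text \<open>The parameter comes from the composition law: \<open>c + c' - B v (- v) = 0\<close>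
  gives \<open>c' = - c - B v v\<close>.\<close>

lemma valid_inverse:
  assumes "valid v c"
  shows "valid (\<lambda>i. - v i) (- c - B v v)"
proof -
  note v = validD[OF assms]
  have "B v v \<in> I m" by (rule I_mono[OF le_add1 B_in_I[OF v(3) v(3)]])
  moreover have "\<eta> * B v v = B v v" using B_sym[of v v] by simp
  then have "(- c - B v v) * (1 + \<eta>) + B v v = - (c * (1 + \<eta>) + B v v)" by (simp add: algebra_simps)
  ultimately show ?thesis
    unfolding valid_def B_minus using v by (simp add: I_diff I_uminus)
qed

lemma tmat_inverse:
  assumes "v a = 0" "v b = 0"
  shows "tmat v c * tmat (\<lambda>i. - v i) (- c - B v v) = 1\<^sub>m n"
  using tmat_mult[of v "\<lambda>i. - v i" c "- c - B v v"] assms tmat_zero by (simp add: B_minus)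

lemma tmat_cancel:
  assumes v: "v a = 0" "v b = 0" and x: "x \<in> carrier_mat n n"
  shows "tmat v c * (tmat (\<lambda>i. - v i) (- c - B v v) * x) = x"
  unfolding assoc_mult_mat[OF tmat_carrier tmat_carrier x, symmetric] tmat_inverse[OF v]
  by (rule left_mult_one_mat[OF x])

text \<open>Conjugation can divide by powers of \<open>\<pi>\<close> only in column \<open>a\<close>
  and row \<open>b\<close>. Off the diagonal, column \<open>a\<close> vanishes by hypothesis, and
  row \<open>b\<close> vanishes because the remaining columns must pair with \<open>r\<close> times
  the vector of \<open>a\<close> as the basis vectors do.\<close>

lemma column_in_D:
  assumes y: "y \<in> S m" and r: "r \<noteq> 0" and col: "\<And>i. i < n \<Longrightarrow> y $$ (i, a) = r * delta a i"
  shows "y \<in> D"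
proof (rule D_I[OF y])
  note yM = S_M[OF y] and yc = M_carrier[OF S_M[OF y]]
  have pres: "preserves y" using M_C[OF yM] unfolding isometry_def by blast
  fix i j assume ij: "i < n" "j < n" "i \<noteq> j"
  consider "j = a" | "j \<noteq> a" "i = b" | "j \<noteq> a" "i \<noteq> b" by blast
  then show "weight i * y $$ (i, j) / weight j \<in> I m"
  proof cases
    case 1
    then show ?thesis using col[OF ij(1)] ij(3) by (simp add: delta_def)
  next
    case 2
    have "B (\<lambda>l. y $$ (l, a)) (\<lambda>l. y $$ (l, j)) = B (delta a) (delta j)"
      using pres[unfolded preserves_iff[OF yc]] a_less ij(2) by blast
    moreover have "B (\<lambda>l. y $$ (l, a)) (\<lambda>l. y $$ (l, j)) = B (\<lambda>l. 0 + r * delta a l) (\<lambda>l. y $$ (l, j))"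
      by (rule B_cong) (simp_all add: col)
    moreover have "B (\<lambda>l. 0 + r * delta a l) (\<lambda>l. y $$ (l, j)) = r * B (delta a) (\<lambda>l. y $$ (l, j))"
      unfolding B_lin_left by (simp add: B_def)
    moreover have "B (delta a) u = u b" for u
      using B_sym[of "delta a" u] B_a_right[of u] \<eta>_square by (simp add: mult.assoc[symmetric])
    ultimately have "r * y $$ (b, j) = delta j b" by simp
    then have "y $$ (i, j) = 0" using 2 ij(3) r by (simp add: delta_def split: if_splits)
    then show ?thesis by simp
  next
    case 3
    have "weight i \<in> A" using 3 by (simp add: weight_def one_in power_in pi_in)
    moreover have "1 / weight j \<in> A" using 3 a_b by (simp add: weight_def one_in power_in pi_in)
    moreover have "y $$ (i, j) \<in> I m" using S_I[OF y ij(1,2)] ij(3) by (simp add: delta_def)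
    ultimately have "weight i * (1 / weight j) * y $$ (i, j) \<in> I m" by (intro I_mult_left mult_in)
    then show ?thesis by simp
  qed
qed

text \<open>For equal parameters this is the isotropy condition on the image of the basis vector of
  \<open>a\<close>; for different ones it tests whether two lines of the orbit are
  orthogonal.\<close>

lemma B_transvected:
  assumes v: "v a = 0" "v b = 0" and v': "v' a = 0" "v' b = 0"
  shows "B (transvection v c (delta a)) (transvection v' c' (delta a)) = \<eta> * c + c' + B v v'"
proof -
  let ?h = "transvection v c (delta a)"
  have h: "?h a = 1" "?h b = c" using v a_b by (simp_all add: transvection_delta_a delta_def)
  have "B v' ?h = B v' v"
    unfolding B_transvection_right using v' B_a_right[of v'] B_a_right[of v] v by simp
  then have "B ?h v' = B v v'" using B_sym[of ?h v'] B_sym[of v v'] by simp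
  then show ?thesis
    unfolding B_transvection_right[of ?h] B_a_right using h v' by simp
qed

lemma transvection_scale: "transvection v c (\<lambda>i. r * u i) i = r * transvection v c u i"
proof -
  have "B v (\<lambda>i. r * u i) = r * B v u" using B_lin_right[of v "\<lambda>_. 0" r u] by (simp add: B_def)
  then show ?thesis by (simp add: transvection_def algebra_simps)
qed

lemma transvection_cong: "(\<And>i. i < n \<Longrightarrow> u i = u' i) \<Longrightarrow> i < n \<Longrightarrow> transvection v c u i = transvection v c u' i"
  using B_cong[of v v u u'] a_less by (simp add: transvection_def)

text \<open>Column \<open>a\<close> of \<open>x\<close>, divided by its unit entry \<open>r\<close>,
  is the image of the basis vector of \<open>a\<close> under a unique candidate
  \<open>tmat v c\<close>. Isotropy of the column is exactly validity of \<open>(v, c)\<close>.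
  Undoing this transvection leaves column \<open>a\<close> equal to \<open>r\<close> times a basis
  vector.\<close>

lemma decompose:
  assumes x: "x \<in> S m"
  shows "\<exists>v c. valid v c \<and> (\<exists>y\<in>D. x = tmat v c * y)"
proof -
  note xM = S_M[OF x]
  note xc = M_carrier[OF xM]
  have pres: "preserves x" using M_C[OF xM] unfolding isometry_def by blast
  define r where "r = x $$ (a, a)"
  have "r - 1 \<in> I m" using S_I[OF x a_less a_less] by (simp add: r_def)
  note r = cong_one_unit[OF m1 this]
  define v where "v i = (if i < n \<and> i \<noteq> a \<and> i \<noteq> b then x $$ (i, a) * inverse r else 0)" for i
  define c where "c = x $$ (b, a) * inverse r"
  have v0: "v a = 0" "v b = 0" unfolding v_def by simp_all
  have vI: "v i \<in> I m" if "i < n" for i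
    using S_I[OF x that a_less] r(2) unfolding v_def by (auto simp: I_mult_right delta_def)
  have cI: "c \<in> I m" using S_I[OF x b_less a_less] r(2) a_b unfolding c_def by (simp add: I_mult_right delta_def)
  let ?h = "transvection v c (delta a)"
  have col: "x $$ (i, a) = r * ?h i" if "i < n" for i
    using that r(1) a_b unfolding transvection_delta_a[of v, OF v0(2)] v_def c_def by (auto simp: delta_def r_def)
  have "B ?h ?h = 0"
  proof -
    have "B (\<lambda>l. x $$ (l, a)) (\<lambda>l. x $$ (l, a)) = B (delta a) (delta a)"
      using pres[unfolded preserves_iff[OF xc]] a_less by blast
    also have "\<dots> = 0" using B_a_right a_b by (simp add: delta_def)
    also have "B (\<lambda>l. x $$ (l, a)) (\<lambda>l. x $$ (l, a)) = B (\<lambda>l. 0 + r * ?h l) (\<lambda>l. 0 + r * ?h l)"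
      by (rule B_cong) (simp_all add: col)
    also have "\<dots> = r * (r * B ?h ?h)"
      unfolding B_lin_left B_lin_right by (simp add: B_def)
    finally show ?thesis using r(1) by simp
  qed
  then have "\<eta> * c + c + B v v = 0" using B_transvected[OF v0 v0] by simp
  then have "c * (1 + \<eta>) + B v v = 0" by (simp add: algebra_simps)
  then have valid: "valid v c" unfolding valid_def using v0 vI cI by blast
  define u where "u = tmat (\<lambda>i. - v i) (- c - B v v)"
  have uS: "u \<in> S m" unfolding u_def by (rule tmat_S[OF valid_inverse[OF valid]])
  have "u * x \<in> D"
  proof (rule column_in_D[OF S_mult[OF uS x] r(1)])
    fix i assume i: "i < n"
    have "(u * x) $$ (i, a) = transvection (\<lambda>i. - v i) (- c - B v v) (\<lambda>l. x $$ (l, a)) i"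
      unfolding u_def by (rule tmat_mult_index[OF xc i a_less])
    also have "\<dots> = transvection (\<lambda>i. - v i) (- c - B v v) (\<lambda>l. r * ?h l) i"
      by (rule transvection_cong[OF col i])
    also have "\<dots> = r * transvection (\<lambda>i. - v i) (- c - B v v) ?h i" by (rule transvection_scale)
    also have "transvection (\<lambda>i. - v i) (- c - B v v) ?h i = transvection (\<lambda>_. 0) 0 (delta a) i"
      using transvection_comp[of "\<lambda>i. - v i" v "- c - B v v" c "delta a" i] v0 by (simp add: B_minus)
    also have "\<dots> = delta a i" by (simp add: transvection_def B_def)
    finally show "(u * x) $$ (i, a) = r * delta a i" .
  qed
  moreover have "x = tmat v c * (u * x)" unfolding u_def by (rule tmat_cancel[OF v0 xc, symmetric])
  ultimately show ?thesis using valid by blast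
qed

text \<open>This is the corner parameter of the inverse of \<open>tmat v c\<close> times
  \<open>tmat v' c'\<close>, computed from the composition law.\<close>

definition shift_coeff :: "(nat \<Rightarrow> 'k) \<Rightarrow> 'k \<Rightarrow> (nat \<Rightarrow> 'k) \<Rightarrow> 'k \<Rightarrow> 'k" where
  "shift_coeff v c v' c' = c' - c + B v (\<lambda>i. v' i - v i)"

text \<open>The exponents reflect the weights: entries between \<open>a\<close> or \<open>b\<close>
  and the other coordinates are divided by \<open>\<pi>^k\<close>, and the corner entry in row
  \<open>b\<close> and column \<open>a\<close> by \<open>\<pi>^(2k)\<close>.\<close>

definition equivalent :: "(nat \<Rightarrow> 'k) \<Rightarrow> 'k \<Rightarrow> (nat \<Rightarrow> 'k) \<Rightarrow> 'k \<Rightarrow> bool" where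
  "equivalent v c v' c' \<longleftrightarrow> (\<forall>i<n. v' i - v i \<in> I (m + k)) \<and> shift_coeff v c v' c' \<in> I (m + 2 * k)"

lemma tmat_quotient:
  assumes "valid v c" "valid v' c'"
  shows "tmat (\<lambda>i. - v i) (- c - B v v) * tmat v' c' = tmat (\<lambda>i. v' i - v i) (shift_coeff v c v' c')"
proof -
  note v = validD[OF assms(1)] and v' = validD[OF assms(2)]
  have "B v (\<lambda>i. v' i - v i) = B v v' - B v v"
    using B_lin_right[of v v' "-1" v] by simp
  then have "- c - B v v + c' - B (\<lambda>i. - v i) v' = shift_coeff v c v' c'"
    unfolding shift_coeff_def B_minus by (simp add: algebra_simps)
  moreover have "(\<lambda>i. - v i + v' i) = (\<lambda>i. v' i - v i)" by auto
  ultimately show ?thesis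
    using tmat_mult[of "\<lambda>i. - v i" v' "- c - B v v" c'] v v' by simp
qed

text \<open>Off the diagonal only column \<open>a\<close> and row \<open>b\<close> are nonzero. Row
  \<open>b\<close> repeats the entries \<open>z\<close> up to sign and permutation by
  \<open>\<sigma>\<close>, and is divided by the same \<open>\<pi>^k\<close>, so it imposes no
  further condition.\<close>

lemma tmat_D_iff:
  assumes z: "z a = 0" "z b = 0" and S: "tmat z g \<in> S m"
  shows "tmat z g \<in> D \<longleftrightarrow> (\<forall>i<n. z i \<in> I (m + k)) \<and> g \<in> I (m + 2 * k)"
proof -
  have kk: "\<pi> ^ (2 * k) = \<pi> ^ k * \<pi> ^ k" by (simp add: mult_2 power_add)
  have Ik: "x / \<pi> ^ k \<in> I m \<longleftrightarrow> x \<in> I (m + k)" for x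
    using I_shift[of "x / \<pi> ^ k" k m] pi_nonzero by simp
  have I2k: "x / (\<pi> ^ k * \<pi> ^ k) \<in> I m \<longleftrightarrow> x \<in> I (m + 2 * k)" for x
    using I_shift[of "x / (\<pi> ^ k * \<pi> ^ k)" "2 * k" m] pi_nonzero kk by simp
  have ea: "tmat z g $$ (i, a) = z i" if "i < n" "i \<noteq> a" "i \<noteq> b" for i
    using that a_less transvection_delta_a[of z, OF z(2)] by (simp add: tmat_index delta_def)
  have eb: "tmat z g $$ (b, a) = g"
    using a_less b_less a_b z transvection_delta_a[of z, OF z(2)] by (simp add: tmat_index delta_def)
  show ?thesis
  proof
    assume D: "tmat z g \<in> D"
    have "z i \<in> I (m + k)" if i: "i < n" for i
    proof (cases "i = a \<or> i = b")
      case False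
      then have "z i / \<pi> ^ k \<in> I m"
        using D_E[OF D i a_less] ea[OF i] by (simp add: weight_def)
      then show ?thesis using Ik by blast
    qed (use z in auto)
    moreover have "g / (\<pi> ^ k * \<pi> ^ k) \<in> I m"
      using D_E[OF D b_less a_less] a_b eb by (simp add: weight_def)
    ultimately show "(\<forall>i<n. z i \<in> I (m + k)) \<and> g \<in> I (m + 2 * k)" using I2k by blast
  next
    assume H: "(\<forall>i<n. z i \<in> I (m + k)) \<and> g \<in> I (m + 2 * k)"
    show "tmat z g \<in> D"
    proof (rule D_I[OF S])
      fix i j assume ij: "i < n" "j < n" "i \<noteq> j"
      consider "j = a" "i = b" | "j = a" "i \<noteq> b" | "j \<noteq> a" "i \<noteq> b" | "j \<noteq> a" "i = b" by blast
      then show "weight i * tmat z g $$ (i, j) / weight j \<in> I m"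
      proof cases
        case 1
        then show ?thesis using eb H I2k[of g] a_b by (simp add: weight_def)
      next
        case 2
        then show ?thesis using ea[OF ij(1)] ij H Ik[of "z i"] by (simp add: weight_def)
      next
        case 3
        then have "tmat z g $$ (i, j) = 0"
          using ij transvection_delta[OF ij(2)] by (simp add: tmat_index delta_def)
        then show ?thesis by simp
      next
        case 4
        have e: "tmat z g $$ (b, j) = - (\<epsilon> (\<sigma> j) * z (\<sigma> j))"
          using ij 4 b_less transvection_delta[OF ij(2)] by (simp add: tmat_index delta_def)
        have "z (\<sigma> j) / \<pi> ^ k \<in> I m" using H \<sigma>_less[OF ij(2)] Ik by blast
        then have "- (\<epsilon> (\<sigma> j) * (z (\<sigma> j) / \<pi> ^ k)) \<in> I m"
          by (intro I_uminus I_mult_left sign_in \<sigma>_less ij(2))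
        moreover have "weight b = 1 / \<pi> ^ k" "weight j = 1" using ij 4 a_b by (auto simp: weight_def)
        ultimately show ?thesis using 4(2) e by simp
      qed
    qed
  qed
qed

lemma equivalent_iff:
  assumes "valid v c" "valid v' c'"
  shows "(\<exists>y\<in>D. tmat v' c' = tmat v c * y) \<longleftrightarrow> equivalent v c v' c'"
proof -
  note v = validD[OF assms(1)] and v' = validD[OF assms(2)]
  let ?u = "tmat (\<lambda>i. - v i) (- c - B v v)" and ?z = "tmat (\<lambda>i. v' i - v i) (shift_coeff v c v' c')"
  note uS = tmat_S[OF valid_inverse[OF assms(1)]]
  have zS: "?z \<in> S m" using S_mult[OF uS tmat_S[OF assms(2)]] unfolding tmat_quotient[OF assms] .
  have "?z \<in> D \<longleftrightarrow> equivalent v c v' c'"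
    unfolding equivalent_def using v v' by (intro tmat_D_iff zS) auto
  moreover have "(\<exists>y\<in>D. tmat v' c' = tmat v c * y) \<longleftrightarrow> ?z \<in> D"
  proof
    assume "?z \<in> D"
    moreover have "tmat v' c' = tmat v c * ?z"
      unfolding tmat_quotient[OF assms, symmetric] by (rule tmat_cancel[OF v(1,2) tmat_carrier, symmetric])
    ultimately show "\<exists>y\<in>D. tmat v' c' = tmat v c * y" by blast
  next
    assume "\<exists>y\<in>D. tmat v' c' = tmat v c * y"
    then obtain y where y: "y \<in> D" "tmat v' c' = tmat v c * y" by (elim bexE)
    note yc = M_carrier[OF S_M[OF D_S[OF y(1)]]]
    have ut: "?u * tmat v c = 1\<^sub>m n"
      by (rule mat_mult_left_right_inverse[OF tmat_carrier tmat_carrier tmat_inverse[OF v(1,2)]])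
    have "?z = ?u * (tmat v c * y)" unfolding y(2)[symmetric] by (rule tmat_quotient[OF assms, symmetric])
    also have "\<dots> = y" unfolding assoc_mult_mat[OF tmat_carrier tmat_carrier yc, symmetric] ut
      by (rule left_mult_one_mat[OF yc])
    finally show "?z \<in> D" using y(1) by simp
  qed
  ultimately show ?thesis by blast
qed

lemma transversal_D:
  assumes P: "\<And>t. t \<in> P \<Longrightarrow> valid (V t) (Cf t)"
    and ex1: "\<And>v c. valid v c \<Longrightarrow> \<exists>!t. t \<in> P \<and> equivalent (V t) (Cf t) v c"
    and x: "x \<in> S m"
  shows "\<exists>!t. t \<in> P \<and> (\<exists>y\<in>D. x = tmat (V t) (Cf t) * y)"
proof -
  let ?Q = "\<lambda>u. valid (fst u) (snd u)" and ?\<tau> = "\<lambda>u. tmat (fst u) (snd u)" and ?h = "\<lambda>t. (V t, Cf t)"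
  have "\<exists>!t. t \<in> P \<and> (\<exists>y\<in>D. x = ?\<tau> (?h t) * y)"
  proof (rule coset_transversal[where Q = ?Q, OF _ _ _ _ x])
    fix z assume "z \<in> S m"
    from decompose[OF this] obtain v c where "valid v c \<and> (\<exists>y\<in>D. z = tmat v c * y)" by (elim exE)
    then show "\<exists>u. ?Q u \<and> (\<exists>y\<in>D. z = ?\<tau> u * y)" by (intro exI[of _ "(v, c)"]) simp
  next
    fix u assume u: "?Q u"
    show "?\<tau> u \<in> S m" by (rule tmat_S[OF u])
    show "\<exists>!t. t \<in> P \<and> (\<exists>y\<in>D. ?\<tau> u = ?\<tau> (?h t) * y)"
    proof (rule ex1_iff_cong[OF _ ex1[OF u]])
      show "t \<in> P \<and> (\<exists>y\<in>D. ?\<tau> u = ?\<tau> (?h t) * y) \<longleftrightarrow> t \<in> P \<and> equivalent (V t) (Cf t) (fst u) (snd u)" for t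
        using equivalent_iff[OF P u, of t] by (intro conj_cong refl) simp
    qed
  next
    show "?Q (?h t)" if "t \<in> P" for t using P[OF that] by simp
  qed
  then show ?thesis by simp
qed

end

section \<open>Rigidity and coset representatives for isometry groups\<close>

context pi_adic_form
begin

definition W :: "nat set" where "W = {..<n} - {a, b}"

lemma finite_W: "finite W" and card_W: "card W = n - 2"
  unfolding W_def using a_less b_less a_b by (simp_all add: card_Diff_subset)

lemma W_iff: "i \<in> W \<longleftrightarrow> i < n \<and> i \<noteq> a \<and> i \<noteq> b"
  unfolding W_def by auto

lemma n_ge_2: "n \<ge> 2"
  using a_less b_less a_b by linarith

definition vec_of :: "(nat \<Rightarrow> 'k) \<Rightarrow> nat \<Rightarrow> 'k" where
  "vec_of g i = (if i \<in> W then g i * \<pi> ^ m else 0)"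

lemma vec_of_valid:
  assumes "\<And>i. i \<in> W \<Longrightarrow> g i \<in> A"
  shows "vec_of g a = 0" "vec_of g b = 0" "vec_of g i \<in> I m"
  using assms I_I by (auto simp: vec_of_def W_iff)

lemma vec_of_diff:
  assumes "v a = 0" "v b = 0"
  shows "(\<forall>i<n. v i - vec_of g i \<in> I r) \<longleftrightarrow> (\<forall>i\<in>W. v i - g i * \<pi> ^ m \<in> I r)"
  using assms by (auto simp: vec_of_def W_iff)

lemma B_scale: "B (\<lambda>l. r * u l) v = r * B u v" "B v (\<lambda>l. r * u l) = r * B v u"
  using B_lin_left[of "\<lambda>_. 0" r u v] B_lin_right[of v "\<lambda>_. 0" r u] by (simp_all add: B_def)

lemma B_zero: "B (\<lambda>_. 0) u = 0" "B u (\<lambda>_. 0) = 0"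
  by (simp_all add: B_def)

definition fixed :: "'k mat \<Rightarrow> (nat \<Rightarrow> 'k) \<Rightarrow> bool" where
  "fixed x u \<longleftrightarrow> (\<forall>i<n. mat_app n x u i = u i)"

lemma fixed_lin: "fixed x u \<Longrightarrow> fixed x v \<Longrightarrow> fixed x (\<lambda>i. u i + r * v i)"
  unfolding fixed_def mat_app_lin by simp

lemma fixed_scale:
  assumes "fixed x (\<lambda>i. r * u i)" "r \<noteq> 0"
  shows "fixed x u"
proof -
  have "mat_app n x (\<lambda>i. r * u i) i = r * mat_app n x u i" for i
    using mat_app_lin[of n x "\<lambda>_. 0" r u i] by (simp add: mat_app_def)
  then show ?thesis using assms unfolding fixed_def by simp
qed

lemma fixed_imp_one:
  assumes x: "x \<in> carrier_mat n n" and "\<And>j. j < n \<Longrightarrow> fixed x (delta j)"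
  shows "x = 1\<^sub>m n"
proof (rule eq_matI)
  fix i j assume "i < dim_row (1\<^sub>m n :: 'k mat)" "j < dim_col (1\<^sub>m n :: 'k mat)"
  then show "x $$ (i, j) = 1\<^sub>m n $$ (i, j)"
    using assms(2)[of j] mat_app_delta[of j n x i] by (simp add: fixed_def delta_def)
qed (use x in auto)

abbreviation hvec :: "(nat \<Rightarrow> 'k) \<Rightarrow> 'k \<Rightarrow> nat \<Rightarrow> 'k" where
  "hvec v c \<equiv> transvection v c (delta a)"

lemma hvec_eq: "valid v c \<Longrightarrow> hvec v c = (\<lambda>i. delta a i + v i + c * delta b i)"
  using transvection_delta_a[of v] validD(2) by blast

text \<open>The property of \<open>x\<close> that \<open>self_similar_index\<close> hands to its
  rigidity hypothesis: every line in the \<open>S m\<close>-orbit of the line of \<open>a\<close> is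
  an eigenline with eigenvalue congruent to 1.\<close>

definition line_fixing :: "'k mat \<Rightarrow> bool" where
  "line_fixing x \<longleftrightarrow> x \<in> S m \<and> (\<forall>g\<in>S m. \<exists>r. r - 1 \<in> I m \<and> (\<forall>i<n. (\<Sum>j<n. g $$ (j, a) * x $$ (i, j)) = r * g $$ (i, a)))"

lemma eigenvector:
  assumes x: "line_fixing x" and v: "valid v c"
  shows "\<exists>r. r - 1 \<in> I m \<and> (\<forall>i<n. mat_app n x (hvec v c) i = r * hvec v c i)"
proof -
  from x tmat_S[OF v] obtain r where r: "r - 1 \<in> I m"
    "\<forall>i<n. (\<Sum>j<n. tmat v c $$ (j, a) * x $$ (i, j)) = r * tmat v c $$ (i, a)"
    unfolding line_fixing_def by blast
  have "mat_app n x (hvec v c) i = r * hvec v c i" if "i < n" for i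
    using r(2) that a_less unfolding mat_app_def by (simp add: tmat_index)
  with r(1) show ?thesis by blast
qed

lemma eigenvalue_mult:
  assumes x: "line_fixing x"
    and r: "\<And>i. i < n \<Longrightarrow> mat_app n x u i = r * u i" and s: "\<And>i. i < n \<Longrightarrow> mat_app n x v i = s * v i"
    and nz: "B u v \<noteq> 0"
  shows "r * s = 1"
proof -
  have xM: "x \<in> M" using x S_M unfolding line_fixing_def by blast
  have "B (mat_app n x u) (mat_app n x v) = B u v"
    using preserves_B[OF M_carrier[OF xM], of u v] M_C[OF xM] unfolding isometry_def mat_app_def by blast
  moreover have "B (mat_app n x u) (mat_app n x v) = B (\<lambda>i. r * u i) (\<lambda>i. s * v i)"
    using r s by (rule B_cong)
  ultimately have "r * s * B u v = 1 * B u v" unfolding B_scale by simp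
  then show ?thesis using nz by (simp only: mult_cancel_right simp_thms)
qed

text \<open>
  Eigenvalues of an isometry along non-orthogonal lines are inverse to each other; three mutually
  non-orthogonal fixed lines therefore have eigenvalue \<open>\<plusminus>1\<close>, and \<open>-1\<close> is excluded modulo \<open>\<pi>\<close>.
\<close>
lemma fixed_triple:
  assumes x: "line_fixing x" and v: "valid v1 c1" "valid v2 c2" "valid v3 c3"
    and nz: "\<eta> * c1 + c2 + B v1 v2 \<noteq> 0" "\<eta> * c1 + c3 + B v1 v3 \<noteq> 0" "\<eta> * c2 + c3 + B v2 v3 \<noteq> 0"
  shows "fixed x (hvec v1 c1)" "fixed x (hvec v2 c2)" "fixed x (hvec v3 c3)"
proof -
  from eigenvector[OF x v(1)] obtain r1 where r1: "r1 - 1 \<in> I m" "\<forall>i<n. mat_app n x (hvec v1 c1) i = r1 * hvec v1 c1 i"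
    by (elim exE conjE)
  from eigenvector[OF x v(2)] obtain r2 where r2: "r2 - 1 \<in> I m" "\<forall>i<n. mat_app n x (hvec v2 c2) i = r2 * hvec v2 c2 i"
    by (elim exE conjE)
  from eigenvector[OF x v(3)] obtain r3 where r3: "r3 - 1 \<in> I m" "\<forall>i<n. mat_app n x (hvec v3 c3) i = r3 * hvec v3 c3 i"
    by (elim exE conjE)
  have B: "B (hvec v1 c1) (hvec v2 c2) \<noteq> 0" "B (hvec v1 c1) (hvec v3 c3) \<noteq> 0" "B (hvec v2 c2) (hvec v3 c3) \<noteq> 0"
    using nz B_transvected[of v1 v2 c1 c2] B_transvected[of v1 v3 c1 c3] B_transvected[of v2 v3 c2 c3]
      validD(1,2)[OF v(1)] validD(1,2)[OF v(2)] validD(1,2)[OF v(3)] by simp_all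
  have p: "r1 * r2 = 1" "r1 * r3 = 1" "r2 * r3 = 1"
    using eigenvalue_mult[OF x _ _ B(1), of r1 r2] eigenvalue_mult[OF x _ _ B(2), of r1 r3]
      eigenvalue_mult[OF x _ _ B(3), of r2 r3] r1(2) r2(2) r3(2) by simp_all
  have "r1 * r1 = (r1 * r2) * (r1 * r3) * (r2 * r3)"
  proof -
    have "(r1 * r2) * (r1 * r3) * (r2 * r3) = (r1 * r1) * ((r2 * r3) * (r2 * r3))" by (simp add: mult_ac)
    then show ?thesis unfolding p(3) by simp
  qed
  then have "r1 * r1 = 1" unfolding p by simp
  then have 1: "r1 = 1" by (rule square_one_cong_one[OF half_in two_nonzero r1(1) m1])
  then have "r2 = 1" "r3 = 1" using p by simp_all
  with 1 show "fixed x (hvec v1 c1)" "fixed x (hvec v2 c2)" "fixed x (hvec v3 c3)"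
    using r1(2) r2(2) r3(2) unfolding fixed_def by simp_all
qed

lemma valid_zero: "valid (\<lambda>_. 0) 0"
  unfolding valid_def by (simp add: B_zero)

lemma hvec_zero: "hvec (\<lambda>_. 0) 0 = delta a"
  unfolding hvec_eq[OF valid_zero] by simp

lemma pi_power_nonzero: "\<pi> ^ r \<noteq> 0"
  using pi_nonzero by simp

lemma pi_power_in: "\<pi> ^ m \<in> I m"
  using I_I[OF one_in, of m] by simp

lemma symplectic_B_self:
  assumes "\<not> special"
  shows "B v v = 0"
proof -
  have "B v v = - B v v" using B_sym[of v v] \<eta>_eq assms by simp
  then have "2 * B v v = 0" by (simp add: eq_neg_iff_add_eq_0)
  then show ?thesis using two_nonzero by simp
qed

lemma symplectic_valid:
  assumes "\<not> special" "v a = 0" "v b = 0" "\<And>i. i < n \<Longrightarrow> v i \<in> I m" "c \<in> I m"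
  shows "valid v c"
  unfolding valid_def using assms \<eta>_eq symplectic_B_self[OF assms(1)] by simp

text \<open>The three lines have parameters \<open>(0, 0)\<close>, \<open>(v, \<pi>^m)\<close> and
  \<open>(0, 2 \<pi>^m)\<close>; their mutual pairings are \<open>\<pi>^m\<close>,
  \<open>2 \<pi>^m\<close> and \<open>\<pi>^m\<close>. Varying \<open>v\<close> and taking
  differences of fixed vectors yields every basis vector up to the factor
  \<open>\<pi>^m\<close>.\<close>

lemma symplectic_rigid:
  assumes ns: "\<not> special" and x: "line_fixing x"
  shows "x = 1\<^sub>m n"
proof (rule fixed_imp_one)
  show "x \<in> carrier_mat n n" using x S_M M_carrier unfolding line_fixing_def by blast
  have \<eta>: "\<eta> = - 1" using \<eta>_eq ns by simp
  let ?p = "\<pi> ^ m"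
  have "1 + 1 \<in> A" by (intro add_in one_in)
  then have two: "2 * ?p \<in> I m" using I_mult_left[OF _ pi_power_in] by simp
  have v2: "valid (\<lambda>_. 0) (2 * ?p)" using two by (intro symplectic_valid[OF ns]) simp_all
  have main: "fixed x (delta a) \<and> fixed x (\<lambda>i. delta a i + v i + ?p * delta b i)"
    if "v a = 0" "v b = 0" "\<And>i. i < n \<Longrightarrow> v i \<in> I m" for v
  proof -
    have v1: "valid v ?p" using that pi_power_in by (intro symplectic_valid[OF ns])
    show ?thesis
      using fixed_triple(1,2)[OF x valid_zero v1 v2] pi_power_nonzero two_nonzero
      unfolding hvec_zero hvec_eq[OF v1] by (simp add: \<eta> B_zero)
  qed
  have fa: "fixed x (delta a)" using main[of "\<lambda>_. 0"] by simp
  have "fixed x (\<lambda>i. delta a i + 0 + ?p * delta b i)" using main[of "\<lambda>_. 0"] by simp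
  from fixed_lin[OF this fa, of "-1"] have "fixed x (\<lambda>i. ?p * delta b i)" by simp
  then have fb: "fixed x (delta b)" by (rule fixed_scale[OF _ pi_power_nonzero])
  fix j assume j: "j < n"
  show "fixed x (delta j)"
  proof (cases "j = a \<or> j = b")
    case False
    have "fixed x (\<lambda>i. delta a i + ?p * delta j i + ?p * delta b i)"
      using False pi_power_in by (intro conjunct2[OF main]) (auto simp: delta_def)
    from fixed_lin[OF fixed_lin[OF this fb, of "- ?p"] fa, of "-1"]
    have "fixed x (\<lambda>i. ?p * delta j i)" by (simp add: algebra_simps)
    then show ?thesis by (rule fixed_scale[OF _ pi_power_nonzero])
  qed (use fa fb in auto)
qed

text \<open>Representatives consist of \<open>n - 2\<close> coordinates modulo
  \<open>\<pi>^k\<close> and a free corner modulo \<open>\<pi>^(2k)\<close>, which gives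
  \<open>q^(n k)\<close> in total.\<close>

theorem symplectic_self_similar:
  assumes ns: "\<not> special" and G: "subgroup G GL" "S m \<subseteq> G"
  shows "self_similar_of_index (GL\<lparr>carrier := G\<rparr>)
    (card (rcosets\<^bsub>GL\<lparr>carrier := G\<rparr>\<^esub> (S m)) * q ^ (n * k))"
proof -
  from residue_system[of k] obtain Sk where Sk: "Sk \<subseteq> A" "finite Sk" "card Sk = q ^ k"
    and Sk1: "\<forall>x\<in>A. \<exists>!s. s \<in> Sk \<and> x - s \<in> I k" by (elim exE conjE)
  from residue_system[of "2 * k"] obtain T where T: "T \<subseteq> A" "finite T" "card T = q ^ (2 * k)"
    and T1: "\<forall>x\<in>A. \<exists>!s. s \<in> T \<and> x - s \<in> I (2 * k)" by (elim exE conjE)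
  define P where "P = (W \<rightarrow>\<^sub>E Sk) \<times> T"
  define V where "V t = vec_of (fst t)" for t :: "(nat \<Rightarrow> 'k) \<times> 'k"
  define Cf where "Cf t = snd t * \<pi> ^ m" for t :: "(nat \<Rightarrow> 'k) \<times> 'k"
  have gA: "g i \<in> A" if "g \<in> W \<rightarrow>\<^sub>E Sk" "i \<in> W" for g i using PiE_mem[OF that] Sk(1) by blast
  have valid: "valid (V t) (Cf t)" if "t \<in> P" for t
    unfolding V_def Cf_def
  proof (rule symplectic_valid[OF ns])
    have g: "fst t \<in> W \<rightarrow>\<^sub>E Sk" and s: "snd t \<in> A" using that T(1) unfolding P_def by auto
    note vv = vec_of_valid[of "fst t", OF gA[OF g]]
    show "vec_of (fst t) a = 0" "vec_of (fst t) b = 0" "vec_of (fst t) i \<in> I m" for i using vv by simp_all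
    show "snd t * \<pi> ^ m \<in> I m" by (rule I_I[OF s])
  qed
  have ex1: "\<exists>!t. t \<in> P \<and> equivalent (V t) (Cf t) v c" if "valid v c" for v c
  proof -
    note v = validD[OF that]
    have "\<exists>!g. g \<in> W \<rightarrow>\<^sub>E Sk \<and> (\<forall>i\<in>W. v i - g i * \<pi> ^ m \<in> I (m + k))"
      using v(3) by (intro residue_vectors[OF finite_W Sk1]) (simp add: W_iff)
    note g1 = this[folded vec_of_diff[of v, OF v(1,2)]]
    from g1 obtain g where g: "g \<in> W \<rightarrow>\<^sub>E Sk" "\<forall>i<n. v i - vec_of g i \<in> I (m + k)" by (elim ex1E conjE)
    \<comment> \<open>Relative to the base point \<open>vec_of g\<close> the corner of the quotient
      is \<open>d - s * \<pi> ^ m\<close>. The residue \<open>s\<close> can thus be chosen only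
      after \<open>g\<close>, once the correction by the form is known.\<close>
    define d where "d = c + B (vec_of g) (\<lambda>i. v i - vec_of g i)"
    note vv = vec_of_valid[of g, OF gA[OF g(1)]]
    have "B (vec_of g) (\<lambda>i. v i - vec_of g i) \<in> I (m + (m + k))" using vv(3) g(2) by (intro B_in_I) simp_all
    then have "B (vec_of g) (\<lambda>i. v i - vec_of g i) \<in> I m" by (rule I_mono[OF le_add1])
    then have "d \<in> I m" unfolding d_def by (rule I_add[OF v(4)])
    then have dA: "d / \<pi> ^ m \<in> A" unfolding I_iff .
    have sh: "shift_coeff (vec_of g) (s * \<pi> ^ m) v c \<in> I (m + 2 * k) \<longleftrightarrow> d / \<pi> ^ m - s \<in> I (2 * k)" for s
    proof -
      have "shift_coeff (vec_of g) (s * \<pi> ^ m) v c = (d / \<pi> ^ m - s) * \<pi> ^ m"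
        unfolding shift_coeff_def d_def using pi_power_nonzero[of m] by (simp add: field_simps)
      then show ?thesis using I_shift[of "d / \<pi> ^ m - s" m "2 * k"] by (simp add: add.commute)
    qed
    note s1 = bspec[OF T1 dA]
    from s1 obtain s where s: "s \<in> T" "d / \<pi> ^ m - s \<in> I (2 * k)" by (elim ex1E conjE)
    show ?thesis
    proof (rule ex1I[of _ "(g, s)"])
      show "(g, s) \<in> P \<and> equivalent (V (g, s)) (Cf (g, s)) v c"
        unfolding P_def V_def Cf_def equivalent_def using g s sh by simp
      fix t assume t: "t \<in> P \<and> equivalent (V t) (Cf t) v c"
      obtain g' s' where tt: "t = (g', s')" by (cases t)
      have g': "g' \<in> W \<rightarrow>\<^sub>E Sk" "\<forall>i<n. v i - vec_of g' i \<in> I (m + k)"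
        and s': "s' \<in> T" "shift_coeff (vec_of g') (s' * \<pi> ^ m) v c \<in> I (m + 2 * k)"
        using t unfolding tt P_def V_def Cf_def equivalent_def by auto
      have "g' = g" by (intro ex1_unique[OF g1] conjI g g')
      moreover from this s'(2) have "d / \<pi> ^ m - s' \<in> I (2 * k)" using sh by simp
      then have "s' = s" by (intro ex1_unique[OF s1] conjI s s')
      ultimately show "t = (g, s)" using tt by simp
    qed
  qed
  have cardP: "card P = q ^ (n * k)"
  proof -
    have "card P = (q ^ k) ^ (n - 2) * q ^ (2 * k)"
      unfolding P_def by (simp add: card_cartesian_product card_PiE[OF finite_W] Sk(3) T(3) card_W)
    also have "\<dots> = q ^ (k * (n - 2) + 2 * k)" by (simp add: power_add power_mult)
    also have "k * (n - 2) + 2 * k = n * k" using n_ge_2 by (cases n; cases "n - 1") (auto simp: algebra_simps)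
    finally show ?thesis .
  qed
  have finP: "finite P" unfolding P_def using finite_W Sk(2) T(2) by (intro finite_cartesian_product finite_PiE)
  show ?thesis unfolding cardP[symmetric]
  proof (rule self_similar_index[OF G finP, where \<tau> = "\<lambda>t. tmat (V t) (Cf t)"])
    show "tmat (V t) (Cf t) \<in> S m" if "t \<in> P" for t by (rule tmat_S[OF valid[OF that]])
    show "\<exists>!t. t \<in> P \<and> (\<exists>y\<in>D. x = tmat (V t) (Cf t) * y)" if "x \<in> S m" for x
      by (rule transversal_D[OF valid ex1 that])
    show "x = 1\<^sub>m n" if "x \<in> S m" "\<And>g. g \<in> S m \<Longrightarrow> \<exists>r. r - 1 \<in> I m \<and> (\<forall>i<n. (\<Sum>j<n. g $$ (j, a) * x $$ (i, j)) = r * g $$ (i, a))" for x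
      using that by (intro symplectic_rigid[OF ns]) (simp add: line_fixing_def)
  qed
qed

text \<open>The corner coefficient that isotropy dictates for a symmetric form.\<close>

definition half_norm :: "(nat \<Rightarrow> 'k) \<Rightarrow> 'k" where
  "half_norm v = - B v v * inverse 2"

lemma two_half_norm: "2 * half_norm v = - B v v"
  using two_nonzero unfolding half_norm_def by simp

lemma orthogonal_valid:
  assumes "special" "v a = 0" "v b = 0" "\<And>i. i < n \<Longrightarrow> v i \<in> I m"
  shows "valid v (half_norm v)"
proof -
  have "B v v \<in> I m" by (rule I_mono[OF le_add1 B_in_I[OF assms(4) assms(4)]])
  then have "half_norm v \<in> I m" unfolding half_norm_def by (intro I_mult_right half_in I_uminus)
  moreover have "half_norm v * (1 + \<eta>) + B v v = 0"
    using two_half_norm[of v] \<eta>_eq assms(1) by (simp add: mult.commute)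
  ultimately show ?thesis unfolding valid_def using assms by simp
qed

text \<open>The corner is no longer free, so the three lines are taken along one non-isotropic
  direction, with parameters \<open>0\<close>, \<open>v\<close> and \<open>2 v\<close>. With
  \<open>c = half_norm v\<close> the corners are \<open>0\<close>, \<open>c\<close> and
  \<open>4 c\<close>, and the pairings are \<open>c\<close>, \<open>4 c\<close> and
  \<open>c + 4 c - 4 c = c\<close>.\<close>

lemma orthogonal_fixed:
  assumes sp: "special" and x: "line_fixing x" and v: "v a = 0" "v b = 0" "\<And>i. i < n \<Longrightarrow> v i \<in> I m"
    and nz: "B v v \<noteq> 0"
  shows "fixed x (delta a) \<and> fixed x (\<lambda>i. delta a i + v i + half_norm v * delta b i)"
proof -
  have \<eta>: "\<eta> = 1" using \<eta>_eq sp by simp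
  let ?c = "half_norm v"
  have c: "?c \<noteq> 0" using two_half_norm[of v] nz by auto
  have Bv: "B v v = - 2 * ?c" using two_half_norm[of v] by simp
  have "1 + 1 \<in> A" by (intro add_in one_in)
  then have 2: "2 \<in> A" by simp
  have h2: "half_norm (\<lambda>i. 2 * v i) = 4 * ?c" unfolding half_norm_def B_scale by simp
  have v1: "valid v ?c" using sp v by (intro orthogonal_valid)
  have v2: "valid (\<lambda>i. 2 * v i) (4 * ?c)" unfolding h2[symmetric] using sp v by (intro orthogonal_valid) (simp_all add: I_mult_left[OF 2])
  have "(4::'k) = 2 * 2" by simp
  then have four: "(4::'k) \<noteq> 0" using two_nonzero by (metis mult_eq_0_iff)
  have n1: "\<eta> * 0 + ?c + B (\<lambda>_. 0) v \<noteq> 0" using c by (simp add: B_zero)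
  have n2: "\<eta> * 0 + 4 * ?c + B (\<lambda>_. 0) (\<lambda>i. 2 * v i) \<noteq> 0" using c four by (simp add: B_zero)
  have s: "\<eta> * ?c + 4 * ?c + B v (\<lambda>i. 2 * v i) = ?c" unfolding B_scale Bv \<eta> by (simp add: algebra_simps)
  have n3: "\<eta> * ?c + 4 * ?c + B v (\<lambda>i. 2 * v i) \<noteq> 0" unfolding s by (rule c)
  show ?thesis
    using fixed_triple(1,2)[OF x valid_zero v1 v2 n1 n2 n3] unfolding hvec_zero hvec_eq[OF v1] by (rule conjI)
qed

text \<open>The vectors \<open>v\<close> and \<open>- v\<close> have the same corner. Adding the two
  fixed vectors and subtracting twice that of \<open>a\<close> isolates \<open>2 c\<close> times the
  vector of \<open>b\<close>; then \<open>v\<close> itself remains.\<close>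

lemma orthogonal_fixed_vector:
  assumes sp: "special" and x: "line_fixing x" and v: "v a = 0" "v b = 0" "\<And>i. i < n \<Longrightarrow> v i \<in> I m"
    and nz: "B v v \<noteq> 0"
  shows "fixed x (delta a)" "fixed x (delta b)" "fixed x v"
proof -
  let ?c = "half_norm v"
  have c: "?c \<noteq> 0" using two_half_norm[of v] nz by auto
  have hm: "half_norm (\<lambda>i. - v i) = ?c" unfolding half_norm_def B_minus ..
  have f1: "fixed x (delta a)" "fixed x (\<lambda>i. delta a i + v i + ?c * delta b i)"
    using orthogonal_fixed[OF sp x v nz] by blast+
  have "fixed x (\<lambda>i. delta a i + - v i + half_norm (\<lambda>i. - v i) * delta b i)"
    using v nz by (intro conjunct2[OF orthogonal_fixed[OF sp x]]) (simp_all add: B_minus I_uminus)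
  then have f2: "fixed x (\<lambda>i. delta a i + - v i + ?c * delta b i)" unfolding hm .
  have e: "(\<lambda>i. (delta a i + v i + ?c * delta b i) + 1 * (delta a i + - v i + ?c * delta b i) + (- 2) * delta a i)
      = (\<lambda>i. (2 * ?c) * delta b i)" by (simp add: algebra_simps)
  have "fixed x (\<lambda>i. (2 * ?c) * delta b i)"
    using fixed_lin[OF fixed_lin[OF f1(2) f2, of 1] f1(1), of "- 2"] unfolding e .
  then have fb: "fixed x (delta b)" by (rule fixed_scale) (use c two_nonzero in simp)
  have e': "(\<lambda>i. (delta a i + v i + ?c * delta b i) + (- ?c) * delta b i + (- 1) * delta a i) = v" by (simp add: algebra_simps)
  have "fixed x v" using fixed_lin[OF fixed_lin[OF f1(2) fb, of "- ?c"] f1(1), of "- 1"] unfolding e' .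
  with f1(1) fb show "fixed x (delta a)" "fixed x (delta b)" "fixed x v" by blast+
qed

text \<open>The basis vector of \<open>i\<close> is isotropic when
  \<open>\<sigma> i \<noteq> i\<close>. In that case the non-isotropic sums and differences with its
  partner \<open>\<sigma> i\<close> are used and averaged; otherwise the vector itself serves. The
  factor \<open>\<pi>^m\<close> moves them into the range of admissible parameters.\<close>

lemma orthogonal_fixed_basis:
  assumes sp: "special" and x: "line_fixing x" and i: "i \<in> W"
  shows "fixed x (delta a)" "fixed x (delta b)" "fixed x (delta i)"
proof -
  have \<eta>: "\<eta> = 1" using \<eta>_eq sp by simp
  have il: "i < n" "i \<noteq> a" "i \<noteq> b" using i unfolding W_iff by auto
  have si: "\<sigma> i < n" "\<sigma> i \<noteq> a" "\<sigma> i \<noteq> b"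
    using il \<sigma>_less[OF il(1)] \<sigma>_eq_iff[OF il(1) a_less] \<sigma>_eq_iff[OF il(1) b_less] \<sigma>_a \<sigma>_b by auto
  have e0: "\<epsilon> i \<noteq> 0" using \<epsilon>_square[OF il(1)] by auto
  have dI: "\<pi> ^ m * (delta i l + r * delta (\<sigma> i) l) \<in> I m" if "r \<in> A" for r l
    using pi_power_in that by (intro I_mult_right add_in mult_in) (auto simp: delta_def one_in zero_in)
  have Bv: "B (\<lambda>l. \<pi> ^ m * (delta i l + r * delta (\<sigma> i) l)) (\<lambda>l. \<pi> ^ m * (delta i l + r * delta (\<sigma> i) l))
      = \<pi> ^ m * (\<pi> ^ m * (delta i (\<sigma> i) * (1 + r * r) + 2 * r) * \<epsilon> i)" for r
  proof -
    have "B (delta i) (delta i) = \<epsilon> i * delta i (\<sigma> i)" "B (delta i) (delta (\<sigma> i)) = \<epsilon> i"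
      "B (delta (\<sigma> i)) (delta i) = \<epsilon> i" "B (delta (\<sigma> i)) (delta (\<sigma> i)) = \<epsilon> i * delta i (\<sigma> i)"
      using B_delta_right[OF il(1)] B_delta_right[OF si(1)] \<epsilon>_\<sigma>[OF il(1)] \<sigma>_\<sigma>[OF il(1)] \<eta>
      by (auto simp: delta_def)
    then show ?thesis unfolding B_scale B_lin_left B_lin_right by (simp add: algebra_simps)
  qed
  \<comment> \<open>The value is \<open>2 * r\<close> when \<open>i\<close> has a partner, and 1 for
    a fixed point of \<open>\<sigma>\<close> with \<open>r = 0\<close>.\<close>
  have nz: "(delta i (\<sigma> i) * (1 + r * r) + 2 * r :: 'k) \<noteq> 0" if "\<sigma> i \<noteq> i \<and> r \<noteq> 0 \<or> \<sigma> i = i \<and> r = 0" for r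
    using that two_nonzero by (auto simp: delta_def)
  have fx: "fixed x (delta a) \<and> fixed x (delta b) \<and> fixed x (\<lambda>l. delta i l + r * delta (\<sigma> i) l)"
    if r: "r \<in> A" "\<sigma> i \<noteq> i \<and> r \<noteq> 0 \<or> \<sigma> i = i \<and> r = 0" for r
  proof -
    let ?v = "\<lambda>l. \<pi> ^ m * (delta i l + r * delta (\<sigma> i) l)"
    have "?v a = 0" "?v b = 0" using il si by (simp_all add: delta_def)
    moreover have "B ?v ?v \<noteq> 0" unfolding Bv using nz[OF r(2)] e0 pi_power_nonzero by simp
    ultimately have "fixed x (delta a)" "fixed x (delta b)" "fixed x ?v"
      using orthogonal_fixed_vector[OF sp x, of ?v] dI[OF r(1)] by blast+
    moreover from this(3) have "fixed x (\<lambda>l. delta i l + r * delta (\<sigma> i) l)"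
      by (rule fixed_scale[OF _ pi_power_nonzero])
    ultimately show ?thesis by blast
  qed
  show "fixed x (delta a)" "fixed x (delta b)" "fixed x (delta i)"
  proof (atomize (full), cases "\<sigma> i = i")
    case True
    then show "fixed x (delta a) \<and> fixed x (delta b) \<and> fixed x (delta i)" using fx[of 0] zero_in by simp
  next
    case False
    have p: "fixed x (delta a) \<and> fixed x (delta b) \<and> fixed x (\<lambda>l. delta i l + 1 * delta (\<sigma> i) l)"
      using False one_in by (intro fx) simp_all
    have q: "fixed x (\<lambda>l. delta i l + (- 1) * delta (\<sigma> i) l)"
      using fx[of "- 1"] False uminus_in[OF one_in] by simp
    have e: "(\<lambda>l. delta i l + 1 * delta (\<sigma> i) l + 1 * (delta i l + (- 1) * delta (\<sigma> i) l)) = (\<lambda>l. 2 * delta i l :: 'k)"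
      by simp
    have "fixed x (\<lambda>l. 2 * delta i l)"
      using fixed_lin[OF conjunct2[OF conjunct2[OF p]] q, of 1] unfolding e .
    then have "fixed x (delta i)" by (rule fixed_scale[OF _ two_nonzero])
    with p show "fixed x (delta a) \<and> fixed x (delta b) \<and> fixed x (delta i)" by blast
  qed
qed

text \<open>For \<open>n \<ge> 3\<close> there is a coordinate off the hyperbolic plane; it supplies
  the non-isotropic vectors that fix the vectors of \<open>a\<close> and \<open>b\<close>.\<close>

lemma orthogonal_rigid:
  assumes sp: "special" and n3: "n \<ge> 3" and x: "line_fixing x"
  shows "x = 1\<^sub>m n"
proof (rule fixed_imp_one)
  show "x \<in> carrier_mat n n" using x S_M M_carrier unfolding line_fixing_def by blast
  have "card W \<noteq> 0" unfolding card_W using n3 by simp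
  then have "W \<noteq> {}" by auto
  then obtain i where i: "i \<in> W" by blast
  fix j assume j: "j < n"
  consider "j = a" | "j = b" | "j \<in> W" using j unfolding W_iff by blast
  then show "fixed x (delta j)"
    using orthogonal_fixed_basis[OF sp x i] orthogonal_fixed_basis(3)[OF sp x, of j] by cases simp_all
qed

text \<open>The corner needs no representatives. For two valid parameters with difference
  \<open>z\<close> the corner of the quotient is \<open>- B z z / 2\<close>, so the condition on it
  follows from that on \<open>z\<close>.\<close>

theorem orthogonal_self_similar:
  assumes sp: "special" and n3: "n \<ge> 3" and G: "subgroup G GL" "S m \<subseteq> G"
  shows "self_similar_of_index (GL\<lparr>carrier := G\<rparr>)
    (card (rcosets\<^bsub>GL\<lparr>carrier := G\<rparr>\<^esub> (S m)) * q ^ ((n - 2) * k))"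
proof -
  have \<eta>: "\<eta> = 1" using \<eta>_eq sp by simp
  from residue_system[of k] obtain Sk where Sk: "Sk \<subseteq> A" "finite Sk" "card Sk = q ^ k"
    and Sk1: "\<forall>x\<in>A. \<exists>!s. s \<in> Sk \<and> x - s \<in> I k" by (elim exE conjE)
  define P where "P = W \<rightarrow>\<^sub>E Sk"
  have gA: "g i \<in> A" if "g \<in> P" "i \<in> W" for g i using PiE_mem[of g W "\<lambda>_. Sk" i] that Sk(1) unfolding P_def by blast
  have valid: "valid (vec_of g) (half_norm (vec_of g))" if "g \<in> P" for g
    using vec_of_valid[of g, OF gA[OF that]] by (intro orthogonal_valid[OF sp])
  have eq: "equivalent (vec_of g) (half_norm (vec_of g)) v c \<longleftrightarrow> (\<forall>i<n. v i - vec_of g i \<in> I (m + k))"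
    if v: "valid v c" for g v c
  proof -
    let ?z = "\<lambda>i. v i - vec_of g i"
    let ?s = "shift_coeff (vec_of g) (half_norm (vec_of g)) v c"
    have c: "2 * c = - B v v" using validD(5)[OF v] unfolding \<eta> by (simp add: eq_neg_iff_add_eq_0 mult.commute)
    have sy: "B u w = B w u" for u w using B_sym[of u w] \<eta> by simp
    have zv: "B ?z w = B v w - B (vec_of g) w" for w using B_lin_left[of v "-1" "vec_of g" w] by simp
    have vz: "B w ?z = B w v - B w (vec_of g)" for w using B_lin_right[of w v "-1" "vec_of g"] by simp
    have "2 * ?s = 2 * c - 2 * half_norm (vec_of g) + 2 * B (vec_of g) ?z"
      unfolding shift_coeff_def by (simp add: algebra_simps)
    also have "\<dots> = - B ?z ?z"
      unfolding c two_half_norm zv vz sy[of v "vec_of g"] by (simp add: algebra_simps)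
    finally have "?s = - B ?z ?z * inverse 2" using two_nonzero by (simp add: field_simps)
    moreover have "- B ?z ?z * inverse 2 \<in> I (m + 2 * k)" if "\<forall>i<n. ?z i \<in> I (m + k)"
    proof -
      have "B ?z ?z \<in> I (m + k + (m + k))" using that by (intro B_in_I) simp_all
      \<comment> \<open>The quadratic term gains the exponent twice, and
        \<open>2 (m + k) \<ge> m + 2 k\<close>.\<close>
      then have "B ?z ?z \<in> I (m + 2 * k)" by (rule I_mono[rotated]) simp
      then show ?thesis by (intro I_mult_right half_in I_uminus)
    qed
    ultimately show ?thesis unfolding equivalent_def by metis
  qed
  have ex1: "\<exists>!g. g \<in> P \<and> equivalent (vec_of g) (half_norm (vec_of g)) v c" if v: "valid v c" for v c
  proof -
    have "\<exists>!g. g \<in> W \<rightarrow>\<^sub>E Sk \<and> (\<forall>i\<in>W. v i - g i * \<pi> ^ m \<in> I (m + k))"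
      using validD(3)[OF v] by (intro residue_vectors[OF finite_W Sk1]) (simp add: W_iff)
    then show ?thesis unfolding eq[OF v] vec_of_diff[of v, OF validD(1,2)[OF v]] P_def .
  qed
  have cardP: "card P = q ^ ((n - 2) * k)"
    unfolding P_def card_PiE[OF finite_W] by (simp add: Sk(3) card_W mult.commute flip: power_mult)
  have finP: "finite P" unfolding P_def using finite_W Sk(2) by (intro finite_PiE)
  show ?thesis unfolding cardP[symmetric]
  proof (rule self_similar_index[OF G finP, where \<tau> = "\<lambda>g. tmat (vec_of g) (half_norm (vec_of g))"])
    show "tmat (vec_of t) (half_norm (vec_of t)) \<in> S m" if "t \<in> P" for t by (rule tmat_S[OF valid[OF that]])
    show "\<exists>!t. t \<in> P \<and> (\<exists>y\<in>D. x = tmat (vec_of t) (half_norm (vec_of t)) * y)" if "x \<in> S m" for x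
      by (rule transversal_D[OF valid ex1 that])
    show "x = 1\<^sub>m n" if "x \<in> S m" "\<And>g. g \<in> S m \<Longrightarrow> \<exists>r. r - 1 \<in> I m \<and> (\<forall>i<n. (\<Sum>j<n. g $$ (j, a) * x $$ (i, j)) = r * g $$ (i, a))" for x
      using that by (intro orthogonal_rigid[OF sp n3]) (simp add: line_fixing_def)
  qed
qed

end

section \<open>Special linear groups\<close>

locale pi_adic_special_linear = pi_adic A \<pi> q for A :: "'k::field set" and \<pi> q +
  fixes n m k :: nat
  assumes n2: "n \<ge> 2" and m1: "m \<ge> 1" and k1: "k \<ge> 1"
    and two_nonzero: "(2::'k) \<noteq> 0"
    and n_nonzero: "of_nat n \<noteq> (0::'k)" and inverse_n_in: "inverse (of_nat n) \<in> A"
begin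

definition weight :: "nat \<Rightarrow> 'k" where
  "weight i = (if i = 0 then \<pi> ^ k else 1)"

lemma weight_nonzero: "weight i \<noteq> 0"
  using pi_nonzero by (simp add: weight_def)

sublocale pi_adic_matrix_group A \<pi> q n "\<lambda>x. det x = 1"
proof
  show "det (x * y) = 1" if "x \<in> carrier_mat n n" "y \<in> carrier_mat n n" "det x = 1" "det y = 1" for x y :: "'k mat"
    using det_mult[OF that(1,2)] that(3,4) by simp
  show "det y = 1" if x: "x \<in> carrier_mat n n" and y: "y \<in> carrier_mat n n" and xy: "x * y = 1\<^sub>m n" and d: "det x = 1" for x y :: "'k mat"
    using det_mult[OF x y] d unfolding xy by simp
qed simp_all

sublocale pi_adic_conjugation A \<pi> q n "\<lambda>x. det x = 1" m weight 0
proof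
  show "det (diag_conj n weight x) = 1" if "x \<in> carrier_mat n n" "det x = 1" for x
    using det_diag_conj[of n weight, OF weight_nonzero that(1)] that(2) by simp
  show "\<exists>l\<ge>1. weight 0 = weight i * \<pi> ^ l" if "i < n" "i \<noteq> 0" for i
    using that k1 by (intro exI[of _ k]) (simp add: weight_def)
qed (use m1 n2 weight_nonzero in simp_all)

definition lower :: "(nat \<Rightarrow> 'k) \<Rightarrow> 'k mat" where
  "lower v = mat n n (\<lambda>(i, j). delta j i + (if j = 0 then v i else 0))"

definition valid :: "(nat \<Rightarrow> 'k) \<Rightarrow> bool" where
  "valid v \<longleftrightarrow> v 0 = 0 \<and> (\<forall>i<n. v i \<in> I m)"

lemma lower_carrier [simp]: "lower v \<in> carrier_mat n n"
  by (simp add: lower_def)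

lemma lower_index: "i < n \<Longrightarrow> j < n \<Longrightarrow> lower v $$ (i, j) = delta j i + (if j = 0 then v i else 0)"
  by (simp add: lower_def)

lemma n_pos: "0 < n" using n2 by simp

lemma lower_mult_index:
  assumes x: "x \<in> carrier_mat n n" and ij: "i < n" "j < n"
  shows "(lower v * x) $$ (i, j) = x $$ (i, j) + v i * x $$ (0, j)"
proof -
  have "(lower v * x) $$ (i, j) = (\<Sum>l<n. delta l i * x $$ (l, j)) + (\<Sum>l<n. delta 0 l * (v i * x $$ (l, j)))"
    unfolding index_mult_mat_sum[OF lower_carrier x ij] sum.distrib[symmetric]
    by (intro sum.cong) (auto simp: lower_index ij delta_def algebra_simps)
  then show ?thesis using ij n_pos by simp
qed

lemma lower_mult:
  assumes "v' 0 = 0"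
  shows "lower v * lower v' = lower (\<lambda>i. v i + v' i)"
proof (rule eq_matI)
  fix i j assume "i < dim_row (lower (\<lambda>i. v i + v' i))" "j < dim_col (lower (\<lambda>i. v i + v' i))"
  then have ij: "i < n" "j < n" by (auto simp: lower_def)
  show "(lower v * lower v') $$ (i, j) = lower (\<lambda>i. v i + v' i) $$ (i, j)"
    unfolding lower_mult_index[OF lower_carrier ij] using ij n_pos assms
    by (auto simp: lower_index delta_def)
qed (auto simp: lower_def)

lemma lower_zero: "lower (\<lambda>_. 0) = 1\<^sub>m n"
  by (rule eq_matI) (auto simp: lower_def delta_def)

lemma lower_S:
  assumes v: "valid v"
  shows "lower v \<in> S m"
proof (rule mem_S_I[OF lower_carrier])
  have "lower v $$ (i, j) = 0" if "i < j" "j < n" for i j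
    using that by (simp add: lower_index)
  then have "det (lower v) = prod_list (diag_mat (lower v))" by (rule det_lower_triangular[OF _ lower_carrier])
  also have "diag_mat (lower v) = map (\<lambda>i. 1) [0..<n]"
    using v by (auto simp: diag_mat_def lower_def valid_def intro!: map_cong)
  also have "prod_list (map (\<lambda>i. 1::'k) [0..<n]) = 1" by (induction n) simp_all
  finally show "det (lower v) = 1" .
  show "lower v $$ (i, j) - delta i j \<in> I m" if "i < n" "j < n" for i j
    using that v by (simp add: lower_index valid_def delta_def)
qed

lemma lower_cancel:
  assumes v: "v 0 = 0" and x: "x \<in> carrier_mat n n"
  shows "lower v * (lower (\<lambda>i. - v i) * x) = x"
  unfolding assoc_mult_mat[OF lower_carrier lower_carrier x, symmetric]
  using lower_mult[of "\<lambda>i. - v i" v] v x by (simp add: lower_zero)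

lemma valid_uminus: "valid v \<Longrightarrow> valid (\<lambda>i. - v i)"
  unfolding valid_def by (simp add: I_uminus)

text \<open>Only column 0 is ever divided by a power of \<open>\<pi>\<close>, so it is enough to
  clear the entries below its unit pivot \<open>r\<close> by one elimination step.\<close>

lemma decompose:
  assumes x: "x \<in> S m"
  shows "\<exists>v. valid v \<and> (\<exists>y\<in>D. x = lower v * y)"
proof -
  note xc = M_carrier[OF S_M[OF x]]
  define r where "r = x $$ (0, 0)"
  have "r - 1 \<in> I m" using S_I[OF x n_pos n_pos] by (simp add: r_def)
  note r = cong_one_unit[OF m1 this]
  define v where "v i = (if i = 0 then 0 else x $$ (i, 0) * inverse r)" for i
  have vI: "v i \<in> I m" if "i < n" for i
    using S_I[OF x that n_pos] r(2) unfolding v_def by (auto simp: I_mult_right delta_def)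
  have v: "valid v" unfolding valid_def using vI by (simp add: v_def)
  let ?y = "lower (\<lambda>i. - v i) * x"
  have yS: "?y \<in> S m" by (rule S_mult[OF lower_S[OF valid_uminus[OF v]] x])
  have "?y \<in> D"
  proof (rule D_I[OF yS])
    fix i j assume ij: "i < n" "j < n" "i \<noteq> j"
    show "weight i * ?y $$ (i, j) / weight j \<in> I m"
    proof (cases "j = 0")
      case True
      have "?y $$ (i, 0) = 0"
        unfolding lower_mult_index[OF xc ij(1) n_pos] using True ij(3) r(1) by (simp add: v_def r_def)
      then show ?thesis using True by simp
    next
      case False
      have "?y $$ (i, j) \<in> I m" using S_I[OF yS ij(1,2)] ij(3) by simp
      moreover have "weight i \<in> A" by (simp add: weight_def one_in power_in pi_in)
      ultimately show ?thesis using False I_mult_left by (simp add: weight_def)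
    qed
  qed
  moreover have "x = lower v * ?y" by (rule lower_cancel[OF _ xc, symmetric]) (simp add: v_def)
  ultimately show ?thesis using v by blast
qed

lemma lower_D_iff:
  assumes z: "z 0 = 0" and S: "lower z \<in> S m"
  shows "lower z \<in> D \<longleftrightarrow> (\<forall>i<n. z i \<in> I (m + k))"
proof -
  have Ik: "x / \<pi> ^ k \<in> I m \<longleftrightarrow> x \<in> I (m + k)" for x
    using I_shift[of "x / \<pi> ^ k" k m] pi_nonzero by simp
  show ?thesis
  proof
    assume D: "lower z \<in> D"
    show "\<forall>i<n. z i \<in> I (m + k)"
    proof (intro allI impI)
      fix i assume i: "i < n"
      show "z i \<in> I (m + k)"
      proof (cases "i = 0")
        case False
        then show ?thesis using D_E[OF D i n_pos] i n_pos Ik[of "z i"] by (simp add: lower_index weight_def)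
      qed (simp add: z)
    qed
  next
    assume H: "\<forall>i<n. z i \<in> I (m + k)"
    show "lower z \<in> D"
    proof (rule D_I[OF S])
      fix i j assume ij: "i < n" "j < n" "i \<noteq> j"
      show "weight i * lower z $$ (i, j) / weight j \<in> I m"
        using ij H Ik[of "z i"] by (cases "j = 0") (simp_all add: lower_index weight_def)
    qed
  qed
qed

lemma equivalent_iff:
  assumes v: "valid v" and v': "valid v'"
  shows "(\<exists>y\<in>D. lower v' = lower v * y) \<longleftrightarrow> (\<forall>i<n. v' i - v i \<in> I (m + k))"
proof -
  let ?z = "lower (\<lambda>i. v' i - v i)"
  have v0: "v 0 = 0" "v' 0 = 0" using v v' unfolding valid_def by blast+
  have zeq: "lower (\<lambda>i. - v i) * lower v' = ?z" using lower_mult[of v' "\<lambda>i. - v i"] v0 by simp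
  have zS: "?z \<in> S m" using S_mult[OF lower_S[OF valid_uminus[OF v]] lower_S[OF v']] unfolding zeq .
  have "(\<exists>y\<in>D. lower v' = lower v * y) \<longleftrightarrow> ?z \<in> D"
  proof
    assume "?z \<in> D"
    moreover have "lower v' = lower v * ?z"
      unfolding zeq[symmetric] by (rule lower_cancel[of v, OF v0(1) lower_carrier, symmetric])
    ultimately show "\<exists>y\<in>D. lower v' = lower v * y" by blast
  next
    assume "\<exists>y\<in>D. lower v' = lower v * y"
    then obtain y where y: "y \<in> D" "lower v' = lower v * y" by (elim bexE)
    note yc = M_carrier[OF S_M[OF D_S[OF y(1)]]]
    have "lower (\<lambda>i. - v i) * lower v = 1\<^sub>m n" using lower_mult[of v "\<lambda>i. - v i"] v0 by (simp add: lower_zero)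
    then have "lower (\<lambda>i. - v i) * (lower v * y) = y"
      unfolding assoc_mult_mat[OF lower_carrier lower_carrier yc, symmetric] using yc by simp
    then have "?z = y" unfolding y(2)[symmetric] zeq .
    then show "?z \<in> D" using y(1) by simp
  qed
  also have "\<dots> \<longleftrightarrow> (\<forall>i<n. v' i - v i \<in> I (m + k))" using v0 by (intro lower_D_iff zS) simp
  finally show ?thesis .
qed

text \<open>If \<open>r \<noteq> 1\<close>, the geometric sum \<open>1 + r + ... + r^(n - 1)\<close>
  vanishes. It is congruent to \<open>n\<close>, which is a unit, and this is a
  contradiction.\<close>

lemma scalar_power_one:
  assumes r: "r - 1 \<in> I m" and p: "r ^ n = 1"
  shows "r = 1"
proof (rule ccontr)
  assume "r \<noteq> 1"
  note rA = cong_one_unit(3)[OF m1 r]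
  have "(r - 1) * (\<Sum>i<n. r ^ i) = 0" using power_diff_1_eq[of r n] p by simp
  then have s: "(\<Sum>i<n. r ^ i) = 0" using \<open>r \<noteq> 1\<close> by simp
  have pow: "r ^ i - 1 \<in> I m" for i
  proof (induction i)
    case (Suc i)
    have "r ^ Suc i - 1 = r * (r ^ i - 1) + (r - 1)" by (simp add: algebra_simps)
    then show ?case using I_add[OF I_mult_left[OF rA Suc.IH] r] by (simp only:)
  qed simp
  have "(\<Sum>i<n. r ^ i - 1) \<in> I m" using pow by (intro I_sum)
  then have "- of_nat n \<in> I m" using s by (simp add: sum_subtractf)
  from I_mult_right[OF inverse_n_in I_uminus[OF this]] have "1 \<in> I m" using n_nonzero by simp
  then have "0 - 1 \<in> I m" using I_uminus[of 1 m] by simp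
  from cong_one_unit(1)[OF m1 this] show False by simp
qed

text \<open>For \<open>j > 0\<close> the lines through \<open>e_0\<close>,
  \<open>e_0 + \<pi>^m e_j\<close> and \<open>e_0 + 2 \<pi>^m e_j\<close> are eigenlines with
  eigenvalues \<open>r\<close>, \<open>s\<close>, \<open>t\<close>. Coordinate \<open>j\<close>
  gives \<open>s = t\<close>, both equal to the diagonal entry. Coordinate 0 then gives
  \<open>r + \<pi>^m x_0j = s = r + 2 \<pi>^m x_0j\<close>, so \<open>x_0j = 0\<close> and
  \<open>s = r\<close>. Hence \<open>x\<close> is a scalar matrix of determinant 1.\<close>

lemma rigid:
  assumes x: "x \<in> S m"
    and lines: "\<And>g. g \<in> S m \<Longrightarrow> \<exists>r. r - 1 \<in> I m \<and> (\<forall>i<n. (\<Sum>j<n. g $$ (j, 0) * x $$ (i, j)) = r * g $$ (i, 0))"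
  shows "x = 1\<^sub>m n"
proof -
  note xM = S_M[OF x]
  note xc = M_carrier[OF xM]
  have eig: "\<exists>r. r - 1 \<in> I m \<and> (\<forall>i<n. x $$ (i, 0) + mat_app n x v i = r * (delta 0 i + v i))" if v: "valid v" for v
  proof -
    from lines[OF lower_S[OF v]] obtain r where r: "r - 1 \<in> I m"
      "\<forall>i<n. (\<Sum>j<n. lower v $$ (j, 0) * x $$ (i, j)) = r * lower v $$ (i, 0)" by (elim exE conjE)
    have "x $$ (i, 0) + mat_app n x v i = r * (delta 0 i + v i)" if i: "i < n" for i
    proof -
      have "(\<Sum>j<n. lower v $$ (j, 0) * x $$ (i, j)) = (\<Sum>j<n. delta 0 j * x $$ (i, j)) + mat_app n x v i"
        unfolding mat_app_def sum.distrib[symmetric] using n_pos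
        by (intro sum.cong) (simp_all add: lower_index algebra_simps)
      then show ?thesis using r(2) i n_pos by (simp add: lower_index)
    qed
    then show ?thesis using r(1) by (intro exI[of _ r]) simp
  qed
  have "valid (\<lambda>_. 0)" by (simp add: valid_def)
  from eig[OF this] obtain r where r: "r - 1 \<in> I m" "\<And>i. i < n \<Longrightarrow> x $$ (i, 0) = r * delta 0 i"
    by (auto simp: mat_app_def)
  have col: "x $$ (i, j) = r * delta j i" if j: "0 < j" "j < n" and i: "i < n" for i j
  proof -
    define P where "P = \<pi> ^ m"
    have p0: "P \<noteq> 0" unfolding P_def using pi_nonzero by simp
    \<comment> \<open>Used for \<open>c = 1\<close> and \<open>c = 2\<close>: two multiples of one
      basis vector are needed to separate the eigenvalue from the entry in row 0.\<close>
    have ex: "\<exists>s. \<forall>i<n. r * delta 0 i + c * P * x $$ (i, j) = s * (delta 0 i + c * P * delta j i)" if c: "c \<in> A" for c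
    proof -
      have "valid (\<lambda>i. c * P * delta j i)"
        unfolding valid_def P_def using j I_I[OF c, of m] by (simp add: delta_def)
      from eig[OF this] obtain s where
        s: "\<forall>i<n. x $$ (i, 0) + mat_app n x (\<lambda>i. c * P * delta j i) i = s * (delta 0 i + c * P * delta j i)"
        by blast
      have "mat_app n x (\<lambda>i. c * P * delta j i) i = c * P * x $$ (i, j)" for i
        using mat_app_lin[of n x "\<lambda>_. 0" "c * P" "delta j" i] mat_app_delta[OF j(2), of x i] by (simp add: mat_app_def)
      then show ?thesis using s r(2) by (intro exI[of _ s]) simp
    qed
    from ex[OF one_in] obtain s where s: "\<forall>i<n. r * delta 0 i + 1 * P * x $$ (i, j) = s * (delta 0 i + 1 * P * delta j i)"
      by (elim exE)
    have "1 + 1 \<in> A" by (intro add_in one_in)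
    then have "2 \<in> A" by simp
    from ex[OF this] obtain t where t: "\<forall>i<n. r * delta 0 i + 2 * P * x $$ (i, j) = t * (delta 0 i + 2 * P * delta j i)"
      by (elim exE)
    have "P * x $$ (j, j) = s * P" using spec[OF s, of j] j by (simp add: delta_def)
    then have xs: "x $$ (j, j) = s" using p0 by simp
    have "2 * P * x $$ (j, j) = t * (2 * P)" using spec[OF t, of j] j by (simp add: delta_def)
    then have "(2 * P) * x $$ (j, j) = (2 * P) * t" by (simp only: mult.commute)
    then have xt: "x $$ (j, j) = t" using p0 two_nonzero by (simp only: mult_cancel_left) simp
    have s0: "r + P * x $$ (0, j) = s" using spec[OF s, of 0] j n_pos by (simp add: delta_def)
    have t0: "r + 2 * P * x $$ (0, j) = s" using spec[OF t, of 0] j n_pos xt xs by (simp add: delta_def)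
    have "P * x $$ (0, j) = 0"
    proof -
      have "r + 2 * P * x $$ (0, j) = (r + P * x $$ (0, j)) + P * x $$ (0, j)" by (simp add: algebra_simps)
      then show ?thesis using s0 t0 by simp
    qed
    then have sr: "s = r" using s0 p0 by simp
    have "r * delta 0 i + P * x $$ (i, j) = r * (delta 0 i + P * delta j i)" using s i sr by simp
    then have "P * x $$ (i, j) = P * (r * delta j i)" by (simp add: algebra_simps)
    then show ?thesis using p0 by simp
  qed
  have xr: "x = r \<cdot>\<^sub>m 1\<^sub>m n"
  proof (rule eq_matI)
    fix i j assume "i < dim_row (r \<cdot>\<^sub>m 1\<^sub>m n)" "j < dim_col (r \<cdot>\<^sub>m 1\<^sub>m n)"
    then have ij: "i < n" "j < n" by auto
    show "x $$ (i, j) = (r \<cdot>\<^sub>m 1\<^sub>m n) $$ (i, j)"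
      using ij r(2)[OF ij(1)] col[OF _ ij(2,1)] by (cases "j = 0") (auto simp: delta_def)
  qed (use xc in auto)
  have "det x = r ^ n" unfolding xr by (simp add: det_smult)
  then have "r = 1" using scalar_power_one[OF r(1)] M_C[OF xM] by simp
  then show ?thesis unfolding xr by (intro eq_matI) simp_all
qed

definition vec_of :: "(nat \<Rightarrow> 'k) \<Rightarrow> nat \<Rightarrow> 'k" where
  "vec_of g i = (if 0 < i \<and> i < n then g i * \<pi> ^ m else 0)"

theorem special_linear_self_similar:
  assumes G: "subgroup G GL" "S m \<subseteq> G"
  shows "self_similar_of_index (GL\<lparr>carrier := G\<rparr>)
    (card (rcosets\<^bsub>GL\<lparr>carrier := G\<rparr>\<^esub> (S m)) * q ^ ((n - 1) * k))"
proof -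
  from residue_system[of k] obtain Sk where Sk: "Sk \<subseteq> A" "finite Sk" "card Sk = q ^ k"
    and Sk1: "\<forall>x\<in>A. \<exists>!s. s \<in> Sk \<and> x - s \<in> I k" by (elim exE conjE)
  define W where "W = {1..<n}"
  have finW: "finite W" unfolding W_def by simp
  define P where "P = W \<rightarrow>\<^sub>E Sk"
  have gA: "g i \<in> A" if "g \<in> P" "i \<in> W" for g i using PiE_mem[of g W "\<lambda>_. Sk" i] that Sk(1) unfolding P_def by blast
  have val: "valid (vec_of g)" if "g \<in> P" for g
    unfolding valid_def vec_of_def using I_I[OF gA[OF that]] by (simp add: W_def)
  have ex1: "\<exists>!g. g \<in> P \<and> (\<exists>y\<in>D. lower v = lower (vec_of g) * y)" if v: "valid v" for v
  proof -
    have vI: "v i \<in> I m" if "i \<in> W" for i using v that unfolding valid_def W_def by simp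
    have v0: "v 0 = 0" using v unfolding valid_def by blast
    show ?thesis
    proof (rule ex1_iff_cong)
      show "\<exists>!g. g \<in> W \<rightarrow>\<^sub>E Sk \<and> (\<forall>i\<in>W. v i - g i * \<pi> ^ m \<in> I (m + k))"
        by (rule residue_vectors[OF finW Sk1 vI])
      fix g
      have "(\<forall>i<n. v i - vec_of g i \<in> I (m + k)) \<longleftrightarrow> (\<forall>i\<in>W. v i - g i * \<pi> ^ m \<in> I (m + k))"
        using v0 by (auto simp: vec_of_def W_def)
      then show "g \<in> P \<and> (\<exists>y\<in>D. lower v = lower (vec_of g) * y) \<longleftrightarrow>
          g \<in> W \<rightarrow>\<^sub>E Sk \<and> (\<forall>i\<in>W. v i - g i * \<pi> ^ m \<in> I (m + k))"
        using equivalent_iff[OF val v, of g] unfolding P_def by (intro conj_cong refl) simp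
    qed
  qed
  have cardP: "card P = q ^ ((n - 1) * k)"
    unfolding P_def card_PiE[OF finW] by (simp add: Sk(3) W_def mult.commute flip: power_mult)
  have finP: "finite P" unfolding P_def using finW Sk(2) by (intro finite_PiE)
  show ?thesis unfolding cardP[symmetric]
  proof (rule self_similar_index[OF G finP, where \<tau> = "\<lambda>g. lower (vec_of g)"])
    show "lower (vec_of t) \<in> S m" if "t \<in> P" for t by (rule lower_S[OF val[OF that]])
    show "\<exists>!t. t \<in> P \<and> (\<exists>y\<in>D. x = lower (vec_of t) * y)" if "x \<in> S m" for x
      by (rule coset_transversal[of valid lower P vec_of x, OF decompose lower_S val ex1 that])
    show "x = 1\<^sub>m n" if "x \<in> S m" "\<And>g. g \<in> S m \<Longrightarrow> \<exists>r. r - 1 \<in> I m \<and> (\<forall>i<n. (\<Sum>j<n. g $$ (j, 0) * x $$ (i, j)) = r * g $$ (i, 0))" for x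
      by (rule rigid[OF that])
  qed
qed

end

section \<open>Classical groups over the ring of integers\<close>

context extension_integers
begin

lemma unit_cong_one:
  assumes x: "x \<in> A"
  shows "1 + x * \<pi> \<noteq> 0 \<and> inverse (1 + x * \<pi>) \<in> A"
proof
  have ndvd: "1 + x * \<pi> \<noteq> r * \<pi>" if r: "r \<in> A" for r
  proof
    assume "1 + x * \<pi> = r * \<pi>"
    then have "1 = r * \<pi> - x * \<pi>" by (rule eq_diff_eq[THEN iffD2])
    then have "1 = (r - x) * \<pi>" unfolding left_diff_distrib .
    with one_notin_pi[OF A_diff[OF r x]] show False by contradiction
  qed
  show "1 + x * \<pi> \<noteq> 0" using ndvd[OF A_zero] by simp
  show "inverse (1 + x * \<pi>) \<in> A"
    by (rule unit_if_not_pi_multiple[OF A_add[OF A_one A_mult[OF x pi_in]] ndvd])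
qed

lemma pi_adic_integers: "pi_adic A \<pi> (p ^ f)"
proof (rule pi_adic.intro)
  show "x = 0" if "\<And>i. \<exists>r\<in>A. x = r * \<pi> ^ i" for x by (rule pi_divisible_imp_zero[OF that])
  show "\<exists>S. S \<subseteq> A \<and> finite S \<and> card S = p ^ f \<and> (\<forall>x\<in>A. \<exists>!s. s \<in> S \<and> (\<exists>r\<in>A. x - s = r * \<pi>))"
    by (rule residue_representatives)
qed (rule A_one A_add A_mult A_uminus pi_in pi_nonzero unit_cong_one; assumption?)+

sublocale V: pi_adic A \<pi> "p ^ f" by (rule pi_adic_integers)

lemma small_nat_unit:
  assumes "0 < j" "j < p"
  shows "of_nat j \<noteq> (0::'k)" "inverse (of_nat j) \<in> A"
proof -
  note nd = small_nat_not_pi_multiple[OF assms]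
  show "of_nat j \<noteq> (0::'k)" using nd[OF A_zero] by simp
  show "inverse (of_nat j) \<in> A" by (rule unit_if_not_pi_multiple[OF A_of_nat nd])
qed

text \<open>A space of dimension 0 cannot contain \<open>1 \<noteq> 0\<close>. Positivity of
  \<open>d\<close> is what lets the numerical condition bound \<open>p\<close> from below in terms
  of \<open>n\<close>.\<close>

lemma degree_pos: "d > 0"
proof (rule ccontr)
  assume "\<not> d > 0"
  then have "ring.dimension (cring_class_ops :: 'k ring) 0 Qp UNIV"
    using ext unfolding padic_extension_def by simp
  then have "(UNIV :: 'k set) = {\<zero>\<^bsub>cring_class_ops\<^esub>}"
    by (rule ring.dimension_zero[OF cring.axioms(1)[OF cring_class] Qp_subfield])
  then have "(1::'k) = 0" unfolding zero_class by blast
  then show False by simp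
qed

lemma reduction_map_eq_iff:
  assumes x: "x \<in> carrier_mat n n" "elements_mat x \<subseteq> A" and y: "y \<in> carrier_mat n n" "elements_mat y \<subseteq> A"
  shows "map_mat (reduction R (\<pi> ^ m)) x = map_mat (reduction R (\<pi> ^ m)) y \<longleftrightarrow>
    (\<forall>i<n. \<forall>j<n. x $$ (i, j) - y $$ (i, j) \<in> V.I m)"
proof -
  have eA: "x $$ (i, j) \<in> A" "y $$ (i, j) \<in> A" if "i < n" "j < n" for i j
    using subsetD[OF x(2) elements_matI[OF x(1) that refl]] subsetD[OF y(2) elements_matI[OF y(1) that refl]] .
  have "map_mat (reduction R (\<pi> ^ m)) x = map_mat (reduction R (\<pi> ^ m)) y \<longleftrightarrow>
    (\<forall>i<n. \<forall>j<n. reduction R (\<pi> ^ m) (x $$ (i, j)) = reduction R (\<pi> ^ m) (y $$ (i, j)))"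
    using x(1) y(1) unfolding mat_eq_iff by simp
  also have "\<dots> \<longleftrightarrow> (\<forall>i<n. \<forall>j<n. x $$ (i, j) - y $$ (i, j) \<in> V.I m)"
    unfolding V.I_def using reduction_eq_iff[OF A_power[OF pi_in] eA] by (simp add: Bex_def conj_commute)
  finally show ?thesis .
qed

lemma classical_carrier:
  "x \<in> carrier (classical_group \<Sigma> n R) \<Longrightarrow> x \<in> carrier_mat n n \<and> elements_mat x \<subseteq> A"
  unfolding classical_group_def classical_matrices_def by simp

lemma elements_subset_iff:
  assumes "x \<in> carrier_mat n n"
  shows "elements_mat x \<subseteq> A \<longleftrightarrow> (\<forall>i<n. \<forall>j<n. x $$ (i, j) \<in> A)"
proof
  assume "elements_mat x \<subseteq> A"
  then show "\<forall>i<n. \<forall>j<n. x $$ (i, j) \<in> A" using elements_matI[OF assms _ _ refl] by blast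
next
  assume H: "\<forall>i<n. \<forall>j<n. x $$ (i, j) \<in> A"
  show "elements_mat x \<subseteq> A"
  proof
    fix z assume "z \<in> elements_mat x"
    then obtain i j where "i < dim_row x" "j < dim_col x" "z = x $$ (i, j)" using elements_matD by blast
    then show "z \<in> A" using H assms by simp
  qed
qed

text \<open>It carries results about the abstract \<open>GL\<close> and \<open>S m\<close> over to
  \<open>classical_group\<close> and \<open>congruence_subgroup\<close>, as soon as \<open>C\<close>
  agrees on square matrices with the defining equations.\<close>

lemma matrix_group_eq:
  assumes "pi_adic_matrix_group A \<pi> (p ^ f) n C"
    and C: "\<And>x. x \<in> carrier_mat n n \<Longrightarrow> C x \<longleftrightarrow> (case \<Sigma> of
         SL \<Rightarrow> det x = 1
       | Sp \<Rightarrow> transpose_mat x * symplectic_form (n div 2) * x = symplectic_form (n div 2)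
       | SO \<Rightarrow> det x = 1 \<and> transpose_mat x * orthogonal_form n * x = orthogonal_form n)"
  shows "pi_adic_matrix_group.GL A n C = classical_group \<Sigma> n R"
    and "pi_adic_matrix_group.S A \<pi> n C m = congruence_subgroup \<Sigma> n R \<pi> m"
proof -
  interpret G: pi_adic_matrix_group A \<pi> "p ^ f" n C by fact
  have M: "G.M = classical_matrices \<Sigma> n R"
    unfolding G.M_def classical_matrices_def
    by (intro Collect_cong conj_cong refl) (simp_all only: elements_subset_iff C)
  show "G.GL = classical_group \<Sigma> n R" unfolding G.GL_def classical_group_def M ..
  have one: "1\<^sub>m n \<in> carrier_mat n n" "elements_mat (1\<^sub>m n) \<subseteq> A"
    using A_one A_zero by (simp_all add: elements_subset_iff[OF one_carrier_mat])
  have "x \<in> G.S m \<longleftrightarrow> x \<in> congruence_subgroup \<Sigma> n R \<pi> m" for x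
  proof -
    have "map_mat (reduction R (\<pi> ^ m)) x = map_mat (reduction R (\<pi> ^ m)) (1\<^sub>m n) \<longleftrightarrow>
      (\<forall>i<n. \<forall>j<n. x $$ (i, j) - delta i j \<in> V.I m)" if "x \<in> classical_matrices \<Sigma> n R"
    proof -
      have "x \<in> carrier_mat n n" "elements_mat x \<subseteq> A" using that unfolding classical_matrices_def by simp_all
      from reduction_map_eq_iff[OF this one] show ?thesis by (simp add: delta_def eq_commute)
    qed
    then show ?thesis
      unfolding G.S_def congruence_subgroup_def M classical_group_def by (simp cong: conj_cong)
  qed
  then show "G.S m = congruence_subgroup \<Sigma> n R \<pi> m" by blast
qed

end

section \<open>The symplectic and orthogonal forms as monomial forms\<close>

lemma symplectic_monomial_form:
  assumes "l \<ge> 1"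
  shows "monomial_form (2 * l) (\<lambda>i. if i < l then i + l else i - l)
    (\<lambda>i. if i < l then 1 else - 1 :: 'k::field) (- 1) 0 l"
  by unfold_locales (use assms in auto)

lemma symplectic_gram:
  "monomial_form.gram (2 * l) (\<lambda>i. if i < l then i + l else i - l)
    (\<lambda>i. if i < l then 1 else - 1 :: 'k::field) = symplectic_form l" if "l \<ge> 1"
proof -
  interpret monomial_form "2 * l" "\<lambda>i. if i < l then i + l else i - l"
    "\<lambda>i. if i < l then 1 else - 1 :: 'k" "- 1" 0 l by (rule symplectic_monomial_form[OF that])
  show ?thesis
  proof (rule eq_matI)
    fix i j assume "i < dim_row (symplectic_form l :: 'k mat)" "j < dim_col (symplectic_form l :: 'k mat)"
    then have "i < 2 * l" "j < 2 * l" by (auto simp: symplectic_form_def)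
    then show "gram $$ (i, j) = symplectic_form l $$ (i, j)"
      by (auto simp: gram_def symplectic_form_def delta_def)
  qed (auto simp: gram_def symplectic_form_def)
qed

lemma split_monomial_form:
  assumes "l \<ge> 1"
  shows "monomial_form (2 * l) (\<lambda>i. if i < l then i + l else i - l) (\<lambda>i. 1 :: 'k::field) 1 0 l"
  by unfold_locales (use assms in auto)

lemma split_gram:
  "monomial_form.gram (2 * l) (\<lambda>i. if i < l then i + l else i - l) (\<lambda>i. 1 :: 'k::field) = orthogonal_form (2 * l)"
  if "l \<ge> 1"
proof -
  interpret monomial_form "2 * l" "\<lambda>i. if i < l then i + l else i - l" "\<lambda>i. 1 :: 'k" 1 0 l
    by (rule split_monomial_form[OF that])
  show ?thesis
  proof (rule eq_matI)
    fix i j assume "i < dim_row (orthogonal_form (2 * l) :: 'k mat)" "j < dim_col (orthogonal_form (2 * l) :: 'k mat)"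
    then have "i < 2 * l" "j < 2 * l" by (auto simp: orthogonal_form_def split_form_def)
    then show "gram $$ (i, j) = orthogonal_form (2 * l) $$ (i, j)"
      by (auto simp: gram_def orthogonal_form_def split_form_def delta_def)
  qed (auto simp: gram_def orthogonal_form_def split_form_def)
qed

text \<open>Coordinate 0 carries the anisotropic summand and is fixed by the involution, so the
  hyperbolic pair starts at 1 and is \<open>1\<close>, \<open>1 + l\<close>.\<close>

lemma odd_monomial_form:
  assumes "l \<ge> 1" "n = 2 * l + 1"
  shows "monomial_form n (\<lambda>i. if i = 0 then 0 else if i \<le> l then i + l else i - l) (\<lambda>i. 1 :: 'k::field) 1 1 (1 + l)"
  by unfold_locales (use assms in auto)

lemma odd_gram:
  assumes l: "l \<ge> 1" and n: "n = 2 * l + 1"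
  shows "monomial_form.gram n (\<lambda>i. if i = 0 then 0 else if i \<le> l then i + l else i - l) (\<lambda>i. 1 :: 'k::field)
    = orthogonal_form n"
proof -
  interpret monomial_form n "\<lambda>i. if i = 0 then 0 else if i \<le> l then i + l else i - l" "\<lambda>i. 1 :: 'k" 1 1 "1 + l"
    by (rule odd_monomial_form[OF l n])
  have "odd n" "n div 2 = l" using n by simp_all
  then have form: "orthogonal_form n = (four_block_mat (1\<^sub>m 1) (0\<^sub>m 1 (2 * l)) (0\<^sub>m (2 * l) 1) (split_form l) :: 'k mat)"
    unfolding orthogonal_form_def by simp
  show ?thesis
  proof (rule eq_matI)
    fix i j assume "i < dim_row (orthogonal_form n :: 'k mat)" "j < dim_col (orthogonal_form n :: 'k mat)"
    moreover have "dim_row (orthogonal_form n :: 'k mat) = 2 * l + 1" "dim_col (orthogonal_form n :: 'k mat) = 2 * l + 1"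
      unfolding form split_form_def by simp_all
    ultimately have ij: "i < n" "j < n" "i < 2 * l + 1" "j < 2 * l + 1" unfolding n by (simp_all only:)
    have "gram $$ (i, j) = delta (if i = 0 then 0 else if i \<le> l then i + l else i - l) j"
      by (simp add: gram_def ij(1,2))
    also have "\<dots> = orthogonal_form n $$ (i, j)"
    proof -
      consider "i = 0" | "0 < i" "i \<le> l" | "l < i" by linarith
      then show ?thesis
      proof cases
        case 1
        then show ?thesis unfolding form split_form_def using ij(4) l by (cases "j = 0") (simp_all add: delta_def)
      next
        case 2
        then obtain i' where i': "i = Suc i'" by (cases i) auto
        show ?thesis
        proof (cases "j \<le> l")
          case True
          then show ?thesis unfolding form split_form_def using ij(3,4) l 2
            by (cases "j = 0") (simp_all add: delta_def, arith?)
        next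
          case False
          then obtain j' where j': "j = Suc (l + j')" by (metis less_iff_Suc_add not_le)
          then show ?thesis unfolding form split_form_def using ij(3,4) l 2
            unfolding i' j' by (auto simp: delta_def)
        qed
      next
        case 3
        then show ?thesis unfolding form split_form_def using ij(3,4) l
          by (cases "j = 0"; cases "j \<le> l") (simp_all add: delta_def, arith?)
      qed
    qed
    finally show "gram $$ (i, j) = orthogonal_form n $$ (i, j)" .
  next
    show "dim_row gram = dim_row (orthogonal_form n :: 'k mat)" "dim_col gram = dim_col (orthogonal_form n :: 'k mat)"
      unfolding form gram_def split_form_def by (simp_all add: n)
  qed
qed

section \<open>Indices for the classical groups and open subgroups\<close>

context extension_integers
begin

lemma form_self_similar_index:
  assumes "pi_adic_form A \<pi> (p ^ f) n \<sigma> \<epsilon> \<eta> a b special m k"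
    and G: "subgroup G (classical_group \<Sigma> n R)" "congruence_subgroup \<Sigma> n R \<pi> m \<subseteq> G"
    and type: "\<Sigma> = (if special then SO else Sp)"
    and gram: "monomial_form.gram n \<sigma> \<epsilon> = (if special then orthogonal_form n else symplectic_form (n div 2))"
    and n: "special \<Longrightarrow> n \<ge> 3"
  shows "self_similar_of_index ((classical_group \<Sigma> n R)\<lparr>carrier := G\<rparr>)
    (subgroup_index ((classical_group \<Sigma> n R)\<lparr>carrier := G\<rparr>) (congruence_subgroup \<Sigma> n R \<pi> m)
      * (p ^ f) ^ (index_exponent \<Sigma> n * k))"
proof -
  interpret F: pi_adic_form A \<pi> "p ^ f" n \<sigma> \<epsilon> \<eta> a b special m k by fact
  have C: "F.isometry x \<longleftrightarrow> (case \<Sigma> of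
         SL \<Rightarrow> det x = 1
       | Sp \<Rightarrow> transpose_mat x * symplectic_form (n div 2) * x = symplectic_form (n div 2)
       | SO \<Rightarrow> det x = 1 \<and> transpose_mat x * orthogonal_form n * x = orthogonal_form n)" for x
    unfolding F.isometry_def F.preserves_def gram type by auto
  note eqs = matrix_group_eq[OF F.pi_adic_matrix_group_axioms C]
  show ?thesis
  proof (cases special)
    case True
    then show ?thesis
      using F.orthogonal_self_similar[OF True n[OF True], unfolded eqs, OF G] type
      unfolding subgroup_index_def by simp
  next
    case False
    then show ?thesis
      using F.symplectic_self_similar[OF False, unfolded eqs, OF G] type
      unfolding subgroup_index_def by simp
  qed
qed

lemma pi_adic_formI:
  assumes "monomial_form n \<sigma> \<epsilon> \<eta> a b" "\<eta> = (if special then 1 else - 1 :: 'k)" "p \<ge> 3" "m \<ge> 1" "k \<ge> 1"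
  shows "pi_adic_form A \<pi> (p ^ f) n \<sigma> \<epsilon> \<eta> a b special m k"
  using small_nat_unit[of 2] assms pi_adic_integers
  by (intro pi_adic_form.intro pi_adic_form_axioms.intro) simp_all

theorem self_similar_index_classical:
  assumes n2: "n \<ge> 2" and adm: "admissible \<Sigma> n d p" and k: "k \<ge> 1" and m: "m \<ge> 1"
    and G: "subgroup G (classical_group \<Sigma> n R)" "congruence_subgroup \<Sigma> n R \<pi> m \<subseteq> G"
  shows "self_similar_of_index ((classical_group \<Sigma> n R)\<lparr>carrier := G\<rparr>)
    (subgroup_index ((classical_group \<Sigma> n R)\<lparr>carrier := G\<rparr>) (congruence_subgroup \<Sigma> n R \<pi> m)
      * (p ^ f) ^ (index_exponent \<Sigma> n * k))"
proof (cases \<Sigma>)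
  case SL
  have "(n\<^sup>2 - 1) * 1 \<le> (n\<^sup>2 - 1) * d" using degree_pos by (intro mult_left_mono) auto
  also have "\<dots> \<le> p" using adm SL by (simp add: admissible_def)
  finally have "n\<^sup>2 - 1 \<le> p" by simp
  \<comment> \<open>This gives \<open>n + 1 \<le> n\<^sup>2 - 1 \<le> p\<close>, so \<open>2\<close>
    and \<open>n\<close> are both smaller than \<open>p\<close> and hence units.\<close>
  moreover have "n + 2 \<le> n\<^sup>2"
  proof -
    obtain t where "n = 2 + t" using n2 le_Suc_ex by blast
    then show ?thesis by (simp add: power2_eq_square algebra_simps)
  qed
  ultimately have np: "n < p" "2 < p" using n2 by linarith+
  interpret L: pi_adic_special_linear A \<pi> "p ^ f" n m k
  proof
    show "(2::'k) \<noteq> 0" using small_nat_unit(1)[of 2] np by simp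
    show "of_nat n \<noteq> (0::'k)" "inverse (of_nat n) \<in> A" using small_nat_unit[of n] np n2 by simp_all
  qed fact+
  have C: "det x = 1 \<longleftrightarrow> (case \<Sigma> of
         SL \<Rightarrow> det x = 1
       | Sp \<Rightarrow> transpose_mat x * symplectic_form (n div 2) * x = symplectic_form (n div 2)
       | SO \<Rightarrow> det x = 1 \<and> transpose_mat x * orthogonal_form n * x = orthogonal_form n)" for x :: "'k mat"
    unfolding SL by simp
  note eqs = matrix_group_eq[OF L.pi_adic_matrix_group_axioms C]
  show ?thesis
    using L.special_linear_self_similar[unfolded eqs, OF G] SL unfolding subgroup_index_def by simp
next
  case Sp
  then have ev: "even n" and bound: "(n\<^sup>2 + n) * d \<le> 2 * p" using adm by (simp_all add: admissible_def)
  \<comment> \<open>Only \<open>p \<ge> 3\<close> is to be extracted: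
    \<open>6 \<le> 3 n \<le> n\<^sup>2 + n \<le> 2 p\<close>.\<close>
  have "n * 2 \<le> n\<^sup>2" using mult_le_mono2[OF n2, of n] by (simp add: power2_eq_square)
  then have "3 * n \<le> n\<^sup>2 + n" by linarith
  also have "\<dots> \<le> (n\<^sup>2 + n) * d" using degree_pos by simp
  also note bound
  finally have "3 * n \<le> 2 * p" .
  then have p3: "p \<ge> 3" using n2 by linarith
  obtain l where l: "n = 2 * l" using ev by (elim evenE)
  then have l1: "l \<ge> 1" and h: "n div 2 = l" using n2 by simp_all
  show ?thesis
  proof (rule form_self_similar_index[OF pi_adic_formI G])
    show "monomial_form n (\<lambda>i. if i < l then i + l else i - l) (\<lambda>i. if i < l then 1 else - 1 :: 'k) (- 1) 0 l"
      unfolding l by (rule symplectic_monomial_form[OF l1])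
    show "monomial_form.gram n (\<lambda>i. if i < l then i + l else i - l) (\<lambda>i. if i < l then 1 else - 1 :: 'k)
      = (if False then orthogonal_form n else symplectic_form (n div 2))"
      unfolding h unfolding l using symplectic_gram[OF l1] by simp
  qed (use p3 k m Sp in simp_all)
next
  case SO
  then have n3: "n \<ge> 3" and "(n\<^sup>2 - n) * d \<le> 2 * p" using adm by (simp_all add: admissible_def)
  moreover have "(n\<^sup>2 - n) * 1 \<le> (n\<^sup>2 - n) * d" using degree_pos by (intro mult_left_mono) auto
  \<comment> \<open>Here \<open>6 \<le> 2 n \<le> n\<^sup>2 - n \<le> 2 p\<close>, again with the
    aim that 2 is a unit.\<close>
  moreover have "n * 3 \<le> n\<^sup>2" using mult_le_mono2[OF n3, of n] by (simp add: power2_eq_square)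
  ultimately have p3: "p \<ge> 3" by linarith
  show ?thesis
  proof (cases "even n")
    case True
    then obtain l where l: "n = 2 * l" by (elim evenE)
    then have l1: "l \<ge> 1" using n2 by simp
    show ?thesis
    proof (rule form_self_similar_index[OF pi_adic_formI G])
      show "monomial_form n (\<lambda>i. if i < l then i + l else i - l) (\<lambda>i. 1 :: 'k) 1 0 l"
        unfolding l by (rule split_monomial_form[OF l1])
      show "monomial_form.gram n (\<lambda>i. if i < l then i + l else i - l) (\<lambda>i. 1 :: 'k)
        = (if True then orthogonal_form n else symplectic_form (n div 2))"
        unfolding l using split_gram[OF l1] by simp
    qed (use p3 k m SO n3 in simp_all)
  next
    case False
    then obtain l where l: "n = 2 * l + 1" by (elim oddE)
    then have l1: "l \<ge> 1" using n2 by simp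
    show ?thesis
    proof (rule form_self_similar_index[OF pi_adic_formI G])
      show "monomial_form n (\<lambda>i. if i = 0 then 0 else if i \<le> l then i + l else i - l) (\<lambda>i. 1 :: 'k) 1 1 (1 + l)"
        by (rule odd_monomial_form[OF l1 l])
      show "monomial_form.gram n (\<lambda>i. if i = 0 then 0 else if i \<le> l then i + l else i - l) (\<lambda>i. 1 :: 'k)
        = (if True then orthogonal_form n else symplectic_form (n div 2))"
        using odd_gram[OF l1 l] by simp
    qed (use p3 k m SO n3 in simp_all)
  qed
qed

text \<open>The topology is given by generators, so the proof is by induction on how the open set is
  generated. The case with content is an intersection, where the classes modulo the larger of the
  two exponents are contained in both sets.\<close>

lemma open_contains_congruence_class:
  assumes "generate_topology_on {{y \<in> carrier (classical_group \<Sigma> n R).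
          map_mat (reduction R (\<pi> ^ m)) y = map_mat (reduction R (\<pi> ^ m)) x}
       | x m. x \<in> carrier (classical_group \<Sigma> n R)} U" and "z \<in> U"
  shows "\<exists>m. {y \<in> carrier (classical_group \<Sigma> n R).
    map_mat (reduction R (\<pi> ^ m)) y = map_mat (reduction R (\<pi> ^ m)) z} \<subseteq> U"
  using assms
proof (induction arbitrary: z rule: generate_topology_on.induct)
  case Empty
  then show ?case by simp
next
  case (Int u v)
  let ?E = "\<lambda>m. {y \<in> carrier (classical_group \<Sigma> n R).
    map_mat (reduction R (\<pi> ^ m)) y = map_mat (reduction R (\<pi> ^ m)) z}"
  from Int.IH(1)[of z] Int.prems obtain r where r: "?E r \<subseteq> u" by blast
  from Int.IH(2)[of z] Int.prems obtain s where s: "?E s \<subseteq> v" by blast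
  have z: "z \<in> carrier (classical_group \<Sigma> n R)"
    using openin_subset[OF openin_topology_generated_by_iff[THEN iffD2, OF Int.hyps(1)]] Int.prems
    unfolding topology_generated_by_topspace by blast
  have mono: "?E t \<subseteq> ?E m" if "m \<le> t" for m t
  proof
    fix y assume y: "y \<in> ?E t"
    then have yc: "y \<in> carrier (classical_group \<Sigma> n R)" by simp
    note iff = reduction_map_eq_iff[OF conjunct1[OF classical_carrier[OF yc]] conjunct2[OF classical_carrier[OF yc]]
      conjunct1[OF classical_carrier[OF z]] conjunct2[OF classical_carrier[OF z]]]
    have "\<forall>i<n. \<forall>j<n. y $$ (i, j) - z $$ (i, j) \<in> V.I t" using y unfolding iff[symmetric] by simp
    then have "\<forall>i<n. \<forall>j<n. y $$ (i, j) - z $$ (i, j) \<in> V.I m" using V.I_mono[OF that] by blast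
    then show "y \<in> ?E m" using yc unfolding iff[symmetric] by simp
  qed
  have "?E (max r s) \<subseteq> u \<inter> v" using mono[of r "max r s"] mono[of s "max r s"] r s by auto
  then show ?case by blast
next
  case (UN K)
  then obtain u where "u \<in> K" "z \<in> u" by blast
  from UN.IH[OF this] \<open>u \<in> K\<close> show ?case by blast
next
  case (Basis u)
  then obtain x m where u: "u = {y \<in> carrier (classical_group \<Sigma> n R).
          map_mat (reduction R (\<pi> ^ m)) y = map_mat (reduction R (\<pi> ^ m)) x}" by blast
  then have "map_mat (reduction R (\<pi> ^ m)) z = map_mat (reduction R (\<pi> ^ m)) x" using Basis.prems by simp
  then show ?case unfolding u by (intro exI[of _ m]) simp
qed

lemma congruence_subgroup_antimono:
  assumes "r \<le> s"
  shows "congruence_subgroup \<Sigma> n R \<pi> s \<subseteq> congruence_subgroup \<Sigma> n R \<pi> r"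
proof
  have one: "1\<^sub>m n \<in> carrier_mat n n" "elements_mat (1\<^sub>m n) \<subseteq> A"
    using A_one A_zero by (simp_all add: elements_subset_iff[OF one_carrier_mat])
  fix x assume x: "x \<in> congruence_subgroup \<Sigma> n R \<pi> s"
  then have xc: "x \<in> carrier (classical_group \<Sigma> n R)" unfolding congruence_subgroup_def by simp
  note iff = reduction_map_eq_iff[OF conjunct1[OF classical_carrier[OF xc]] conjunct2[OF classical_carrier[OF xc]] one]
  have "\<forall>i<n. \<forall>j<n. x $$ (i, j) - 1\<^sub>m n $$ (i, j) \<in> V.I s"
    using x unfolding iff[symmetric] congruence_subgroup_def by simp
  then have "\<forall>i<n. \<forall>j<n. x $$ (i, j) - 1\<^sub>m n $$ (i, j) \<in> V.I r" using V.I_mono[OF assms] by blast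
  then show "x \<in> congruence_subgroup \<Sigma> n R \<pi> r"
    using xc unfolding iff[symmetric] congruence_subgroup_def by simp
qed

text \<open>The neighbourhood of the identity found inside \<open>G\<close> may have exponent 0;
  passing to \<open>Suc m\<close> shrinks it and secures a positive exponent.\<close>

lemma open_subgroup_contains_congruence_subgroup:
  assumes G: "subgroup G (classical_group \<Sigma> n R)" and "openin (adic_topology \<Sigma> n R \<pi>) G"
  shows "\<exists>m\<ge>1. congruence_subgroup \<Sigma> n R \<pi> m \<subseteq> G"
proof -
  have one: "1\<^sub>m n \<in> G" using subgroup.one_closed[OF G] by (simp add: classical_group_def)
  obtain m where "congruence_subgroup \<Sigma> n R \<pi> m \<subseteq> G"
    using open_contains_congruence_class[OF openin_topology_generated_by[OF assms(2)[unfolded adic_topology_def]] one]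
    unfolding congruence_subgroup_def by blast
  moreover have "congruence_subgroup \<Sigma> n R \<pi> (Suc m) \<subseteq> congruence_subgroup \<Sigma> n R \<pi> m"
    by (rule congruence_subgroup_antimono) simp
  ultimately show ?thesis by (intro exI[of _ "Suc m"]) simp
qed

end

theorem corollary3:
  fixes p d e f q n :: nat
    and \<iota> :: "(nat \<Rightarrow> rat) set \<Rightarrow> 'k::field"
    and R :: "'k ring"
    and \<pi> :: 'k
    and \<Sigma> :: classical_type
  assumes "prime p"
    and "padic_extension p d \<iota>"
    and "R = ring_of_integers p \<iota>"
    and "uniformizer R \<pi>"
    and "ramification_index p R \<pi> e"
    and "inertia_degree p \<iota> \<pi> f"
    and "q = p ^ f"
    and "n \<ge> 2"
    and "admissible \<Sigma> n d p"
  shows "(\<forall>G. subgroup G (classical_group \<Sigma> n R) \<longrightarrow> openin (adic_topology \<Sigma> n R \<pi>) G \<longrightarrow>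
            self_similar ((classical_group \<Sigma> n R)\<lparr>carrier := G\<rparr>)) \<and>
         (\<forall>k m G. k \<ge> 1 \<longrightarrow> m \<ge> e \<longrightarrow> subgroup G (classical_group \<Sigma> n R) \<longrightarrow>
            congruence_subgroup \<Sigma> n R \<pi> m \<subseteq> G \<longrightarrow>
            self_similar_of_index ((classical_group \<Sigma> n R)\<lparr>carrier := G\<rparr>)
              (subgroup_index ((classical_group \<Sigma> n R)\<lparr>carrier := G\<rparr>)
                 (congruence_subgroup \<Sigma> n R \<pi> m)
               * q ^ (index_exponent \<Sigma> n * k)))"
proof -
  interpret extension_integers p d \<iota> R \<pi> e f
    by (intro extension_integers.intro padic_extension_field.intro extension_integers_axioms.intro assms)
  note main = self_similar_index_classical[OF assms(8,9), folded assms(7)]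
  show ?thesis
  proof (intro conjI allI impI)
    fix G assume G: "subgroup G (classical_group \<Sigma> n R)" and op: "openin (adic_topology \<Sigma> n R \<pi>) G"
    from open_subgroup_contains_congruence_subgroup[OF G op]
    obtain m where m: "m \<ge> 1" "congruence_subgroup \<Sigma> n R \<pi> m \<subseteq> G" by (elim exE conjE)
    show "self_similar ((classical_group \<Sigma> n R)\<lparr>carrier := G\<rparr>)"
      \<comment> \<open>\<open>le_refl\<close> instantiates \<open>k\<close> to 1; the index is then
        whatever the second statement gives for this \<open>m\<close>.\<close>
      unfolding self_similar_def by (intro exI) (rule main[OF le_refl m(1) G m(2)])
  next
    fix k m :: nat and G assume km: "1 \<le> k" "e \<le> m" and G: "subgroup G (classical_group \<Sigma> n R)" "congruence_subgroup \<Sigma> n R \<pi> m \<subseteq> G"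
    have "1 \<le> m" using e_pos km(2) by simp
    then show "self_similar_of_index ((classical_group \<Sigma> n R)\<lparr>carrier := G\<rparr>)
              (subgroup_index ((classical_group \<Sigma> n R)\<lparr>carrier := G\<rparr>)
                 (congruence_subgroup \<Sigma> n R \<pi> m)
               * q ^ (index_exponent \<Sigma> n * k))"
      by (rule main[OF km(1) _ G])
  qed
qed

end
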